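(* Let $\mathcal{H}$ be a complex Hilbert space and let $\mathcal{T}:\mathbb{R}\to B(\mathcal{H})$ be a strongly continuous isometric representation such that its Beurling spectrum satisfies $\Lambda(\mathcal{H},\mathcal{T})\subseteq[-\gamma,\gamma]$ for some $\gamma>0$. Assume that a vector $x\in\mathcal{H}$ and a set $\Gamma=\{\gamma_n:n\in\mathbb{Z}\}\subset\mathbb{R}$ are such that the system of vectors $\{\mathcal{T}(\gamma_n)x\}_{n\in\mathbb{Z}}$ forms a frame for $\mathcal{H}$ with bounds $B\ge A>0$. Let $\widetilde\Gamma=\{\widetilde\gamma_n:n\in\mathbb{Z}\}\subset\mathbb{R}$ be such that $$\delta:=\sup\{|\widetilde\gamma_n-\gamma_n|:n\in\mathbb{Z}\}<\frac{\pi}{4\gamma}-\frac1\gamma\arcsin\left(\frac{1}{\sqrt2}\left(1-\sqrt{\frac AB}\right)\right).$$ Then the system of vectors $\{\mathcal{T}(\widetilde\gamma_n)x\}_{n\in\mathbb{Z}}$ also forms a frame for $\mathcal{H}$, with (lower and upper) bounds $$A\left(1-\sqrt{\frac BA}\,(1-\cos\delta\gamma+\sin\delta\gamma)\right)^2\quad\text{and}\quad B\left(2-\cos\delta\gamma+\sin\delta\gamma\right)^2.$$ If additionally $\{\mathcal{T}(\gamma_n)x\}_{n\in\mathbb{Z}}$ is a Riesz basis for $\mathcal{H}$, then so is $\{\mathcal{T}(\widetilde\gamma_n)x\}_{n\in\mathbb{Z}}$.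
   Context: $B(\mathcal{H})$ denotes the algebra of bounded linear operators on $\mathcal{H}$. A representation $\mathcal{T}:\mathbb{R}\to B(\mathcal{H})$ satisfies $\mathcal{T}(0)=I$ and $\mathcal{T}(s+t)=\mathcal{T}(s)\mathcal{T}(t)$; it is isometric if every $\mathcal{T}(t)$ is an isometry, and strongly continuous if $t\mapsto\mathcal{T}(t)y$ is continuous for every $y\in\mathcal{H}$. For $f\in L^1(\mathbb{R})$ and $y\in\mathcal{H}$ put $fy=\int_{\mathbb{R}}f(t)\mathcal{T}(-t)y\,dt$ (Bochner integral), and let $\widehat f(\xi)=\int_{\mathbb{R}}f(t)e^{-it\xi}\,dt$. The Beurling spectrum is $$\Lambda(\mathcal{H},\mathcal{T})=\{\lambda\in\mathbb{R}:\ \text{if } f\in L^1(\mathbb{R}) \text{ and } fy=0 \text{ for all } y\in\mathcal{H},\text{ then } \widehat f(\lambda)=0\}.$$ A sequence $\{\varphi_n\}_{n\in\mathbb{Z}}$ in $\mathcal{H}$ is a frame for $\mathcal{H}$ with bounds $B\ge A>0$ if $A\|y\|^2\le\sum_{n\in\mathbb{Z}}|\langle y,\varphi_n\rangle|^2\le B\|y\|^2$ for all $y\in\mathcal{H}$. It is a Riesz basis for $\mathcal{H}$ with bounds $B\ge A>0$ if its linear span is dense in $\mathcal{H}$ and $A\|c\|_2^2\le\left\|\sum_{n\in\mathbb{Z}}c_n\varphi_n\right\|^2\le B\|c\|_2^2$ for all $c\in\ell^2(\mathbb{Z})$. A Riesz basis (without mention of bounds) is one that is a Riesz basis with some bounds.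 *)

theory Defs
  imports "HOL-Analysis.Analysis"
begin

section \<open>Complex Hilbert spaces\<close>

text \<open>
  HOL-Analysis only has real inner products, so the complex structure is added on top of the
  library classes for real (normed) vector spaces. The inner product is linear in its first argument.
\<close>

class complex_vector = real_vector +
  fixes scaleC :: "complex \<Rightarrow> 'a \<Rightarrow> 'a" (infixr \<open>*\<^sub>C\<close> 75)
  assumes scaleC_add_right: "c *\<^sub>C (x + y) = c *\<^sub>C x + c *\<^sub>C y"
    and scaleC_add_left: "(c + d) *\<^sub>C x = c *\<^sub>C x + d *\<^sub>C x"
    and scaleC_scaleC: "c *\<^sub>C d *\<^sub>C x = (c * d) *\<^sub>C x"
    and scaleC_one: "1 *\<^sub>C x = x"
    and scaleR_scaleC: "r *\<^sub>R x = complex_of_real r *\<^sub>C x"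

global_interpretation complex_vector:
  vector_space "scaleC :: complex \<Rightarrow> 'a \<Rightarrow> 'a :: complex_vector"
  by unfold_locales (rule scaleC_add_right scaleC_add_left scaleC_scaleC scaleC_one)+

text \<open>
  The last axiom says that the norm is the one induced by the inner product; as the norm of a
  normed space is definite, it also makes the inner product positive definite.
\<close>

class complex_inner = complex_vector + real_normed_vector +
  fixes cinner :: "'a \<Rightarrow> 'a \<Rightarrow> complex"
  assumes cinner_commute: "cinner x y = cnj (cinner y x)"
    and cinner_add_left: "cinner (x + y) z = cinner x z + cinner y z"
    and cinner_scaleC_left: "cinner (c *\<^sub>C x) y = c * cinner x y"
    and cinner_norm: "cinner x x = complex_of_real ((norm x)\<^sup>2)"

class complex_hilbert_space = complex_inner + complete_space

subclass (in complex_hilbert_space) banach ..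

instantiation complex :: complex_hilbert_space
begin

definition "scaleC_complex = ((*) :: complex \<Rightarrow> complex \<Rightarrow> complex)"

definition "cinner_complex x y = x * cnj (y :: complex)"

instance
  by standard
    (simp_all add: scaleC_complex_def cinner_complex_def scaleR_conv_of_real algebra_simps
      complex_norm_square [symmetric])

end

definition bounded_clinear :: "('a::complex_hilbert_space \<Rightarrow> 'b::complex_hilbert_space) \<Rightarrow> bool" where
  "bounded_clinear f \<longleftrightarrow> bounded_linear f \<and> (\<forall>c y. f (c *\<^sub>C y) = c *\<^sub>C f y)"

section \<open>Bochner integral in arbitrary Banach spaces\<close>

text \<open>
  The library's \<^const>\<open>has_bochner_integral\<close> and \<^const>\<open>lebesgue_integral\<close>
  require the codomain to be of class \<^class>\<open>second_countable_topology\<close>. The definitions below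
  are the same without that restriction, so that the Hilbert space need not be assumed separable.
\<close>

definition has_bochner_int ::
    "'a measure \<Rightarrow> ('a \<Rightarrow> 'b::real_normed_vector) \<Rightarrow> 'b \<Rightarrow> bool" where
  "has_bochner_int M f v \<longleftrightarrow>
     f \<in> borel_measurable M \<and>
     (\<exists>s. (\<forall>i. Bochner_Integration.simple_bochner_integrable M (s i)) \<and>
          (\<lambda>i. \<integral>\<^sup>+ t. ennreal (norm (f t - s i t)) \<partial>M) \<longlonglongrightarrow> 0 \<and>
          (\<lambda>i. Bochner_Integration.simple_bochner_integral M (s i)) \<longlonglongrightarrow> v)"

definition bochner_int :: "'a measure \<Rightarrow> ('a \<Rightarrow> 'b::real_normed_vector) \<Rightarrow> 'b" where
  "bochner_int M f =
     (if \<exists>v. has_bochner_int M f v then THE v. has_bochner_int M f v else 0)"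

lemma has_bochner_int_eq_has_bochner_integral:
  fixes f :: "'a \<Rightarrow> 'b::{real_normed_vector, second_countable_topology}"
  shows "has_bochner_int M f v \<longleftrightarrow> has_bochner_integral M f v"
  unfolding has_bochner_int_def has_bochner_integral.simps by auto

lemma bochner_int_eq_lebesgue_integral:
  fixes f :: "'a \<Rightarrow> 'b::{banach, second_countable_topology}"
  shows "bochner_int M f = lebesgue_integral M f"
  unfolding bochner_int_def lebesgue_integral_def has_bochner_int_eq_has_bochner_integral ..

section \<open>Representations of the real line and the Beurling spectrum\<close>

definition operator_representation :: "(real \<Rightarrow> 'a::complex_hilbert_space \<Rightarrow> 'a) \<Rightarrow> bool" where
  "operator_representation T \<longleftrightarrow>
     (\<forall>t. bounded_clinear (T t)) \<and> T 0 = id \<and> (\<forall>s t. T (s + t) = T s \<circ> T t)"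

definition isometric :: "(real \<Rightarrow> 'a::complex_hilbert_space \<Rightarrow> 'a) \<Rightarrow> bool" where
  "isometric T \<longleftrightarrow> (\<forall>t y. norm (T t y) = norm y)"

definition strongly_continuous :: "(real \<Rightarrow> 'a::complex_hilbert_space \<Rightarrow> 'a) \<Rightarrow> bool" where
  "strongly_continuous T \<longleftrightarrow> (\<forall>y. continuous_on UNIV (\<lambda>t. T t y))"

definition L1_action ::
    "(real \<Rightarrow> 'a::complex_hilbert_space \<Rightarrow> 'a) \<Rightarrow> (real \<Rightarrow> complex) \<Rightarrow> 'a \<Rightarrow> 'a" where
  "L1_action T f y = bochner_int lborel (\<lambda>t. f t *\<^sub>C T (- t) y)"

definition fourier :: "(real \<Rightarrow> complex) \<Rightarrow> real \<Rightarrow> complex" where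
  "fourier f \<xi> = (LINT t|lborel. f t * exp (- (\<i> * of_real t * of_real \<xi>)))"

definition beurling_spectrum :: "(real \<Rightarrow> 'a::complex_hilbert_space \<Rightarrow> 'a) \<Rightarrow> real set" where
  "beurling_spectrum T =
     {\<mu>. \<forall>f. integrable lborel f \<and> (\<forall>y. L1_action T f y = 0) \<longrightarrow> fourier f \<mu> = 0}"

section \<open>Frames and Riesz bases\<close>

text \<open>
  The summability conditions are explicit because \<^const>\<open>infsum\<close> is \<open>0\<close> on families that are
  not summable.
\<close>

definition frame_bounds :: "(int \<Rightarrow> 'a::complex_hilbert_space) \<Rightarrow> real \<Rightarrow> real \<Rightarrow> bool" where
  "frame_bounds \<phi> A B \<longleftrightarrow> 0 < A \<and> A \<le> B \<and>
     (\<forall>y. (\<lambda>n. (cmod (cinner y (\<phi> n)))\<^sup>2) summable_on UNIV \<and>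
          A * (norm y)\<^sup>2 \<le> (\<Sum>\<^sub>\<infinity>n. (cmod (cinner y (\<phi> n)))\<^sup>2) \<and>
          (\<Sum>\<^sub>\<infinity>n. (cmod (cinner y (\<phi> n)))\<^sup>2) \<le> B * (norm y)\<^sup>2)"

definition riesz_basis_bounds ::
    "(int \<Rightarrow> 'a::complex_hilbert_space) \<Rightarrow> real \<Rightarrow> real \<Rightarrow> bool" where
  "riesz_basis_bounds \<phi> A B \<longleftrightarrow> 0 < A \<and> A \<le> B \<and>
     closure (complex_vector.span (range \<phi>)) = UNIV \<and>
     (\<forall>c :: int \<Rightarrow> complex. (\<lambda>n. (cmod (c n))\<^sup>2) summable_on UNIV \<longrightarrow>
          (\<lambda>n. c n *\<^sub>C \<phi> n) summable_on UNIV \<and>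
          A * (\<Sum>\<^sub>\<infinity>n. (cmod (c n))\<^sup>2) \<le> (norm (\<Sum>\<^sub>\<infinity>n. c n *\<^sub>C \<phi> n))\<^sup>2 \<and>
          (norm (\<Sum>\<^sub>\<infinity>n. c n *\<^sub>C \<phi> n))\<^sup>2 \<le> B * (\<Sum>\<^sub>\<infinity>n. (cmod (c n))\<^sup>2))"

definition riesz_basis :: "(int \<Rightarrow> 'a::complex_hilbert_space) \<Rightarrow> bool" where
  "riesz_basis \<phi> \<longleftrightarrow> (\<exists>A B. riesz_basis_bounds \<phi> A B)"

end

theory Submission
  imports Defs "HOL-Probability.Probability"
begin

text \<open>
  A trigonometric polynomial \<open>g \<xi> = \<Sum> c\<^sub>j exp (i t\<^sub>j \<xi>)\<close> acts as \<open>R = \<Sum> c\<^sub>j T t\<^sub>j\<close>, and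
  \<open>\<parallel>R y\<parallel> \<le> M \<parallel>y\<parallel>\<close> whenever \<open>\<bar>g\<bar> \<le> M\<close> on the Beurling spectrum: Gaussian regularization of
  \<open>t \<mapsto> \<langle>T t y, y\<rangle>\<close> gives densities \<open>q\<^sub>n \<ge> 0\<close> with \<open>\<integral> \<bar>g\<bar>\<^sup>2 q\<^sub>n \<longlongrightarrow> \<parallel>R y\<parallel>\<^sup>2\<close>, and they carry no
  mass in the limit off the spectrum, since there some annihilating \<open>f\<close> has a nonzero transform
  while \<open>\<integral> \<bar>fourier f\<bar>\<^sup>2 q\<^sub>n \<longlongrightarrow> \<parallel>f y\<parallel>\<^sup>2 = 0\<close>.

  Kadec's expansions of \<open>cos (d \<xi>)\<close> and \<open>sin (d \<xi>)\<close> on \<open>[-\<gamma>, \<gamma>]\<close> therefore become expansions of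
  \<open>T d - I\<close> into contractions that do not depend on \<open>d\<close>. With \<open>\<tau> = \<delta> \<gamma> \<le> pi / 4\<close> their coefficients
  are maximal at \<open>\<bar>d\<bar> = \<delta>\<close> and then sum to \<open>\<lambda> = 1 - cos \<tau> + sin \<tau>\<close>, so the differences
  \<open>T (\<Gamma>' n) x - T (\<Gamma> n) x\<close> form a Bessel sequence with constant \<open>sqrt B * \<lambda>\<close>. The assumption on \<open>\<delta>\<close>
  says that \<open>sqrt B * \<lambda> < sqrt A\<close>, hence frames and Riesz bases survive the perturbation.
\<close>

section \<open>Complex inner products\<close>

text \<open>A bound on each \<open>T (d n) - I\<close> separately says nothing about a Bessel
  constant, which concerns the whole sequence tested against one \<open>y\<close>. This is why the
  expansion must use operators common to all \<open>n\<close>: their adjoints can be moved onto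
  \<open>y\<close>, and what depends on \<open>n\<close> is left as a scalar multiplier of the
  \<open>n\<close>-th entry.

  The frequencies are integer multiples of pi / \<gamma> for the cosine but half-integer ones for
  the sine. Both functions then extend continuously beyond the interval, which makes the
  coefficients absolutely summable, and at the endpoint all correction terms have one sign, so that
  the absolute sums can be read off there.

  No spectral measure is constructed; only limits of integrals against densities occur. The danger
  in this is mass escaping to infinity, and strong continuity of \<open>T\<close> excludes it.

  The Riesz hypothesis provides bounds unrelated to \<open>A\<close> and \<open>B\<close>, whereas
  \<delta> is measured against \<open>A\<close> and \<open>B\<close>. So the lower frame bound is
  first shown to be a lower Riesz bound as well.\<close>

lemma cinner_add_right: "cinner x (y + z) = cinner x y + cinner (x :: 'a::complex_inner) z"
  by (metis cinner_add_left cinner_commute complex_cnj_add)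

lemma cinner_scaleC_right: "cinner x (c *\<^sub>C y) = cnj c * cinner (x :: 'a::complex_inner) y"
  by (metis cinner_scaleC_left cinner_commute complex_cnj_mult)

lemma cinner_scaleR_left: "cinner (r *\<^sub>R x) y = of_real r * cinner (x :: 'a::complex_inner) y"
  by (simp add: scaleR_scaleC cinner_scaleC_left)

lemma cinner_scaleR_right: "cinner x (r *\<^sub>R y) = of_real r * cinner (x :: 'a::complex_inner) y"
  by (simp add: scaleR_scaleC cinner_scaleC_right)

lemma norm_scaleC: "norm (c *\<^sub>C x) = cmod c * norm (x :: 'a::complex_inner)"
proof -
  have "complex_of_real ((norm (c *\<^sub>C x))\<^sup>2) = of_real ((cmod c * norm x)\<^sup>2)"
    unfolding power_mult_distrib of_real_mult complex_norm_square [of c]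
      cinner_norm [of x, symmetric] cinner_norm [of "c *\<^sub>C x", symmetric]
    by (simp add: cinner_scaleC_left cinner_scaleC_right)
  then show ?thesis
    by (metis of_real_eq_iff norm_ge_zero power2_eq_imp_eq mult_nonneg_nonneg)
qed

lemma norm_add_sq:
  "(norm (x + y))\<^sup>2 = (norm x)\<^sup>2 + 2 * Re (cinner x y) + (norm (y :: 'a::complex_inner))\<^sup>2"
proof -
  have "complex_of_real ((norm (x + y))\<^sup>2) =
      of_real ((norm x)\<^sup>2) + (cinner x y + cnj (cinner x y)) + of_real ((norm y)\<^sup>2)"
    by (simp only: cinner_norm [symmetric] cinner_add_left cinner_add_right
        cinner_commute [of x y, symmetric] flip: cinner_commute [of y x]) (simp add: algebra_simps)
  also have "\<dots> = of_real ((norm x)\<^sup>2 + 2 * Re (cinner x y) + (norm y)\<^sup>2)"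
    by (simp add: complex_add_cnj)
  finally show ?thesis
    by (simp only: of_real_eq_iff)
qed

lemma cinner_cauchy_schwarz: "cmod (cinner x y) \<le> norm x * norm (y :: 'a::complex_inner)"
proof (cases "y = 0")
  case True
  then show ?thesis
    using cinner_scaleR_right [of x 0 y] by simp
next
  case False
  \<comment> \<open>With this \<open>c\<close> the vector \<open>x + c *\<^sub>C y\<close> is the
    component of \<open>x\<close> orthogonal to \<open>y\<close>; its squared norm is
    nonnegative.\<close>
  define c where "c = - (cinner x y / of_real ((norm y)\<^sup>2))"
  have "cinner x (c *\<^sub>C y) = - of_real ((cmod (cinner x y))\<^sup>2 / (norm y)\<^sup>2)"
    using complex_norm_square [of "cinner x y"]
    unfolding c_def cinner_scaleC_right by (simp add: mult.commute)
  moreover have "(norm (c *\<^sub>C y))\<^sup>2 = (cmod (cinner x y))\<^sup>2 / (norm y)\<^sup>2"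
    using False by (simp add: norm_scaleC c_def norm_divide norm_power power_divide power2_eq_square norm_mult)
  ultimately have "(norm (x + c *\<^sub>C y))\<^sup>2 = (norm x)\<^sup>2 - (cmod (cinner x y))\<^sup>2 / (norm y)\<^sup>2"
    by (simp add: norm_add_sq del: of_real_divide of_real_power)
  then have "(cmod (cinner x y))\<^sup>2 / (norm y)\<^sup>2 \<le> (norm x)\<^sup>2"
    by (metis diff_ge_0_iff_ge zero_le_power2)
  then have "(cmod (cinner x y))\<^sup>2 \<le> (norm x * norm y)\<^sup>2"
    using False by (simp add: divide_le_eq power_mult_distrib)
  then show ?thesis
    by (meson mult_nonneg_nonneg norm_ge_zero power2_le_imp_le)
qed

lemma bounded_bilinear_cinner: "bounded_bilinear (cinner :: 'a::complex_inner \<Rightarrow> 'a \<Rightarrow> complex)"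
  by (standard; auto simp: cinner_add_left cinner_add_right cinner_scaleR_left cinner_scaleR_right
      scaleR_conv_of_real intro!: exI [of _ 1] cinner_cauchy_schwarz)

lemma bounded_bilinear_scaleC: "bounded_bilinear (scaleC :: complex \<Rightarrow> 'a::complex_inner \<Rightarrow> 'a)"
  by (standard; auto simp: scaleC_add_left scaleC_add_right scaleR_scaleC [where ?'a = 'a]
      scaleC_scaleC mult.commute norm_scaleC scaleR_conv_of_real intro!: exI [of _ 1])

interpretation cinner: bounded_bilinear "cinner :: 'a::complex_inner \<Rightarrow> 'a \<Rightarrow> complex"
  by (rule bounded_bilinear_cinner)

interpretation scaleC: bounded_bilinear "scaleC :: complex \<Rightarrow> 'a::complex_inner \<Rightarrow> 'a"
  by (rule bounded_bilinear_scaleC)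

text \<open>Polarization: norms determine the real part through \<open>norm_add_sq\<close>, and
  replacing \<open>y\<close> by \<open>\<i> *\<^sub>C y\<close> turns the imaginary part into a real
  part.\<close>

lemma cinner_isometry:
  fixes U :: "'a::complex_inner \<Rightarrow> 'b::complex_inner"
  assumes add: "\<And>y z. U (y + z) = U y + U z" and scale: "\<And>c y. U (c *\<^sub>C y) = c *\<^sub>C U y"
    and norm: "\<And>y. norm (U y) = norm y"
  shows "cinner (U y) (U z) = cinner y z"
proof -
  have Re: "Re (cinner (U y) (U z)) = Re (cinner y z)" for y z
    using norm_add_sq [of y z] norm_add_sq [of "U y" "U z"] by (simp add: norm flip: add)
  have "Im (cinner (U y) (U z)) = Im (cinner y z)"
    using Re [of "\<i> *\<^sub>C y" z] by (simp add: scale cinner_scaleC_left)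
  with Re show ?thesis
    by (simp add: complex_eq_iff)
qed

section \<open>The Bochner integral of a representation\<close>

text \<open>Without second countability a difference of measurable functions may fail to be
  measurable. A simple \<open>s\<close> has finitely many values, so it suffices to subtract
  constants.\<close>

lemma borel_measurable_norm_diff_simple:
  fixes f s :: "'m \<Rightarrow> 'a::real_normed_vector"
  assumes [measurable]: "f \<in> borel_measurable M" and s: "simple_function M s"
  shows "(\<lambda>t. norm (f t - s t)) \<in> borel_measurable M"
proof (rule measurable_compose_countable' [where g = s and I = "s ` space M"])
  show "(\<lambda>t. norm (f t - c)) \<in> borel_measurable M" for c
    by (rule measurable_compose [OF assms(1) borel_measurable_continuous_onI [where f = "\<lambda>x. norm (x - c)"]])
       (intro continuous_intros)
  show "s \<in> measurable M (count_space (s ` space M))"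
    by (rule measurableI) (use measurable_sets [OF measurable_simple_function [OF s]] in auto)
  show "countable (s ` space M)"
    using s by (simp add: simple_function_def countable_finite)
qed

text \<open>The bridge from the possibly nonseparable space to scalar integration: with
  \<open>L\<close> the inner product against a fixed vector, all later facts about
  \<open>L1_action\<close> become facts about ordinary integrals.\<close>

lemma bounded_linear_has_bochner_int:
  fixes f :: "'m \<Rightarrow> 'a::real_normed_vector" and L :: "'a \<Rightarrow> 'b::{banach, second_countable_topology}"
  assumes "bounded_linear L" and "has_bochner_int M f v"
  shows "has_bochner_integral M (\<lambda>t. L (f t)) (L v)"
proof -
  interpret L: bounded_linear L by fact
  obtain s where s: "\<And>i. Bochner_Integration.simple_bochner_integrable M (s i)"
    "(\<lambda>i. \<integral>\<^sup>+ t. ennreal (norm (f t - s i t)) \<partial>M) \<longlonglongrightarrow> 0"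
    "(\<lambda>i. Bochner_Integration.simple_bochner_integral M (s i)) \<longlonglongrightarrow> v"
    and fm [measurable]: "f \<in> borel_measurable M"
    using assms(2) by (auto simp: has_bochner_int_def)
  have [measurable]: "L \<in> borel_measurable borel"
    by (rule borel_measurable_continuous_onI)
       (intro linear_continuous_on assms)
  obtain K where K: "K > 0" "\<And>x. norm (L x) \<le> norm x * K"
    using L.pos_bounded by auto
  show ?thesis
  proof (rule has_bochner_integral.intros)
    show "(\<lambda>t. L (f t)) \<in> borel_measurable M" by measurable
    show si: "Bochner_Integration.simple_bochner_integrable M (\<lambda>t. L (s i t))" for i
      by (rule simple_bochner_integrable_compose2 [where p = "\<lambda>x y. L x" and g = "s i", OF _ s(1) s(1)])
         (simp add: L.zero)
    have "(\<integral>\<^sup>+ t. ennreal (norm (L (f t) - L (s i t))) \<partial>M) \<le>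
        ennreal K * (\<integral>\<^sup>+ t. ennreal (norm (f t - s i t)) \<partial>M)" for i
    proof -
      have "(\<integral>\<^sup>+ t. ennreal (norm (L (f t) - L (s i t))) \<partial>M) \<le>
          (\<integral>\<^sup>+ t. ennreal K * ennreal (norm (f t - s i t)) \<partial>M)"
        using K by (intro nn_integral_mono)
          (simp add: ennreal_mult [symmetric] mult.commute [of K] ennreal_leI flip: L.diff)
      also have "\<dots> = ennreal K * (\<integral>\<^sup>+ t. ennreal (norm (f t - s i t)) \<partial>M)"
        using borel_measurable_norm_diff_simple [OF fm, of "s i"] s(1) [of i]
        by (intro nn_integral_cmult) (simp add: simple_bochner_integrable.simps)
      finally show ?thesis .
    qed
    moreover have "(\<lambda>i. ennreal K * (\<integral>\<^sup>+ t. ennreal (norm (f t - s i t)) \<partial>M)) \<longlonglongrightarrow> 0"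
      using ennreal_tendsto_cmult [OF _ s(2), of "ennreal K"] by simp
    ultimately show "(\<lambda>i. \<integral>\<^sup>+ t. ennreal (norm (L (f t) - L (s i t))) \<partial>M) \<longlonglongrightarrow> 0"
      by - (rule tendsto_sandwich [OF _ _ tendsto_const], auto)
    have "Bochner_Integration.simple_bochner_integral M (\<lambda>t. L (s i t)) =
        L (Bochner_Integration.simple_bochner_integral M (s i))" for i
      by (rule simple_bochner_integral_linear [OF L.linear_axioms s(1)])
    then show "(\<lambda>i. Bochner_Integration.simple_bochner_integral M (\<lambda>t. L (s i t))) \<longlonglongrightarrow> L v"
      by (simp add: L.tendsto s(3))
  qed
qed

text \<open>Pairing with any \<open>z\<close> reduces this to uniqueness of scalar integrals, and
  \<open>z = v - w\<close> then separates the two values.\<close>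

lemma has_bochner_int_unique:
  fixes v :: "'a::complex_hilbert_space"
  assumes v: "has_bochner_int M f v" and w: "has_bochner_int M f w"
  shows "v = w"
proof -
  have "cinner v z = cinner w z" for z
    using bounded_linear_has_bochner_int [OF cinner.bounded_linear_left v, of z]
      bounded_linear_has_bochner_int [OF cinner.bounded_linear_left w, of z]
    by (rule has_bochner_integral_eq)
  then have "cinner (v - w) (v - w) = 0"
    by (simp add: cinner.diff_left)
  then show ?thesis
    by (simp add: cinner_norm)
qed

lemma bochner_int_eqI:
  fixes v :: "'a::complex_hilbert_space"
  assumes "has_bochner_int M f v"
  shows "bochner_int M f = v"
proof -
  have "(THE w. has_bochner_int M f w) = v"
    using assms has_bochner_int_unique by (intro the_equality) auto
  then show ?thesis
    unfolding bochner_int_def using assms by auto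
qed

lemma simple_bochner_integral_diff_bound:
  assumes s: "Bochner_Integration.simple_bochner_integrable M s"
    and t: "Bochner_Integration.simple_bochner_integrable M t"
    and h: "integrable M h" and le: "\<And>x. norm (s x - t x) \<le> h x"
  shows "norm (Bochner_Integration.simple_bochner_integral M s -
      Bochner_Integration.simple_bochner_integral M t) \<le> integral\<^sup>L M h"
proof -
  have h0: "0 \<le> h x" for x
    using le [of x] norm_ge_zero order_trans by blast
  have "ennreal (norm (Bochner_Integration.simple_bochner_integral M s -
      Bochner_Integration.simple_bochner_integral M t)) =
      ennreal (norm (Bochner_Integration.simple_bochner_integral M (\<lambda>x. s x - t x)))"
    using s t by (subst simple_bochner_integral_diff) auto
  also have "\<dots> \<le> ennreal (Bochner_Integration.simple_bochner_integral M (\<lambda>x. norm (s x - t x)))"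
    using simple_bochner_integrable_compose2 [of "(-)" M s t] s t
    by (auto intro!: ennreal_leI simple_bochner_integral_norm_bound)
  also have "\<dots> = (\<integral>\<^sup>+x. norm (s x - t x) \<partial>M)"
    using simple_bochner_integrable_compose2 [of "\<lambda>x y. norm (x - y)" M s t] s t
    by (auto intro!: simple_bochner_integral_eq_nn_integral)
  also have "\<dots> \<le> (\<integral>\<^sup>+x. h x \<partial>M)"
    using le by (intro nn_integral_mono ennreal_leI)
  also have "\<dots> = ennreal (integral\<^sup>L M h)"
    using h h0 by (intro nn_integral_eq_integral) auto
  finally show ?thesis
    using h0 by (simp add: integral_nonneg_AE)
qed

text \<open>The integrand is approximated by \<open>p i t *\<^sub>C F (G i t)\<close>, where
  \<open>p i\<close> are simple functions tending to \<open>f\<close> and \<open>G i\<close> are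
  simple functions tending to the identity of the line. Continuity of \<open>F\<close> gives
  pointwise convergence, and dominated convergence makes the simple integrals Cauchy. Separability
  is supplied by the domain, not by the codomain.\<close>

lemma has_bochner_int_scaleC_continuous:
  fixes f :: "real \<Rightarrow> complex" and F :: "real \<Rightarrow> 'a::complex_hilbert_space"
  assumes f: "integrable lborel f" and F: "continuous_on UNIV F" and K: "\<And>t. norm (F t) \<le> K"
  shows "\<exists>v. has_bochner_int lborel (\<lambda>t. f t *\<^sub>C F t) v"
proof -
  have K0: "0 \<le> K"
    using K [of 0] norm_ge_zero order_trans by blast
  obtain p where p: "\<And>i. simple_function lborel (p i)" "\<And>x. (\<lambda>i. p i x) \<longlonglongrightarrow> f x"
      "\<And>i x. dist (p i x) 0 \<le> 2 * dist (f x) 0"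
    using borel_measurable_implies_sequence_metric [OF borel_measurable_integrable [OF f], of 0]
    by auto
  \<comment> \<open>\<open>t\<close> is clamped to \<open>[- i, i]\<close> and rounded down to the
    grid of width \<open>1 / (i + 1)\<close>, so that only finitely many values occur;
    \<open>Suc i\<close> avoids division by zero.\<close>
  define G where "G i t = real_of_int \<lfloor>max (- real i) (min (real i) t) * real (Suc i)\<rfloor> / real (Suc i)"
    for i t
  have G_simple: "simple_function lborel (G i)" for i
  proof -
    have "range (\<lambda>t. \<lfloor>max (- real i) (min (real i) t) * real (Suc i)\<rfloor>) \<subseteq>
        {\<lfloor>- real i * real (Suc i)\<rfloor>..\<lfloor>real i * real (Suc i)\<rfloor>}"
      unfolding image_subset_iff atLeastAtMost_iff
      by (intro ballI conjI floor_mono mult_right_mono) auto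
    then have "finite (range (\<lambda>t. \<lfloor>max (- real i) (min (real i) t) * real (Suc i)\<rfloor>))"
      by (rule finite_subset) simp
    moreover have "(\<lambda>t. \<lfloor>max (- real i) (min (real i) t) * real (Suc i)\<rfloor>) \<in> measurable lborel (count_space UNIV)"
      by measurable
    note measurable_sets [OF this]
    ultimately have "simple_function lborel (\<lambda>t. \<lfloor>max (- real i) (min (real i) t) * real (Suc i)\<rfloor>)"
      by (simp add: simple_function_def del: of_nat_Suc)
    then show ?thesis
      unfolding G_def by (rule simple_function_compose1)
  qed
  have G_lim: "(\<lambda>i. G i t) \<longlonglongrightarrow> t" for t
  proof (rule Lim_transform_eventually)
    show "(\<lambda>i. real_of_int \<lfloor>t * real (Suc i)\<rfloor> / real (Suc i)) \<longlonglongrightarrow> t"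
    proof (rule tendsto_sandwich)
      show "\<forall>\<^sub>F i in sequentially. t - 1 / real (Suc i) \<le> real_of_int \<lfloor>t * real (Suc i)\<rfloor> / real (Suc i)"
      proof (intro always_eventually allI)
        fix i
        have "(t * real (Suc i) - 1) / real (Suc i) \<le> real_of_int \<lfloor>t * real (Suc i)\<rfloor> / real (Suc i)"
          by (intro divide_right_mono) linarith+
        then show "t - 1 / real (Suc i) \<le> real_of_int \<lfloor>t * real (Suc i)\<rfloor> / real (Suc i)"
          by (simp add: diff_divide_distrib del: of_nat_Suc)
      qed
      show "\<forall>\<^sub>F i in sequentially. real_of_int \<lfloor>t * real (Suc i)\<rfloor> / real (Suc i) \<le> t"
        by (intro always_eventually allI) (simp add: divide_le_eq del: of_nat_Suc)
      show "(\<lambda>i. t - 1 / real (Suc i)) \<longlonglongrightarrow> t"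
        using tendsto_diff [OF tendsto_const LIMSEQ_inverse_real_of_nat, of t]
        by (simp add: inverse_eq_divide)
    qed auto
    have "\<forall>\<^sub>F i in sequentially. \<bar>t\<bar> \<le> real i"
      using filterlim_real_sequentially by (simp add: filterlim_at_top)
    then show "\<forall>\<^sub>F i in sequentially. real_of_int \<lfloor>t * real (Suc i)\<rfloor> / real (Suc i) = G i t"
    proof eventually_elim
      case (elim i)
      then have "max (- real i) (min (real i) t) = t"
        by linarith
      then show ?case
        by (simp add: G_def)
    qed
  qed
  define s where "s i t = p i t *\<^sub>C F (G i t)" for i t
  let ?g = "\<lambda>t. f t *\<^sub>C F t"
  have s_simple: "simple_function lborel (s i)" for i
    unfolding s_def by (rule simple_function_compose2 [OF p(1) G_simple])
  have s_lim: "(\<lambda>i. s i t) \<longlonglongrightarrow> ?g t" for t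
    unfolding s_def
    by (intro scaleC.tendsto p continuous_on_tendsto_compose [OF F G_lim]) auto
  have s_bound: "norm (s i t) \<le> 2 * K * cmod (f t)" for i t
    using mult_mono [OF p(3) [of i t, simplified] K [of "G i t"]] K0
    by (simp add: s_def norm_scaleC mult_ac)
  have g_bound: "norm (?g t) \<le> K * cmod (f t)" for t
    using mult_left_mono [OF K, of "cmod (f t)" t] by (simp add: norm_scaleC mult.commute)
  have g_meas: "?g \<in> borel_measurable lborel"
    by (rule borel_measurable_LIMSEQ_metric [OF borel_measurable_simple_function [OF s_simple] s_lim])
  have p_bi: "Bochner_Integration.simple_bochner_integrable lborel (p i)" for i
  proof (rule simple_bochner_integrableI_bounded [OF p(1)])
    have "(\<integral>\<^sup>+x. norm (p i x) \<partial>lborel) \<le> (\<integral>\<^sup>+x. norm (2 * f x) \<partial>lborel)"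
      using p(3) [of i] by (intro nn_integral_mono ennreal_leI) (simp add: norm_mult)
    also have "\<dots> < \<infinity>"
      using integrable_mult_right [OF f, of 2] by (simp only: integrable_iff_bounded)
    finally show "(\<integral>\<^sup>+x. norm (p i x) \<partial>lborel) < \<infinity>" .
  qed
  have s_bi: "Bochner_Integration.simple_bochner_integrable lborel (s i)" for i
  proof (rule simple_bochner_integrable.intros [OF s_simple])
    have "emeasure lborel {y \<in> space lborel. s i y \<noteq> 0} \<le> emeasure lborel {y \<in> space lborel. p i y \<noteq> 0}"
    proof (rule emeasure_mono)
      show "{y \<in> space lborel. p i y \<noteq> 0} \<in> sets lborel"
        using borel_measurable_simple_function [OF p(1) [of i]] by measurable
    qed (auto simp: s_def scaleC.zero_left)
    with p_bi [of i] show "emeasure lborel {y \<in> space lborel. s i y \<noteq> 0} \<noteq> \<infinity>"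
      by (auto simp: simple_bochner_integrable.simps top_unique)
  qed
  define h where "h i t = norm (?g t - s i t)" for i t
  have h_meas: "h i \<in> borel_measurable lborel" for i
    unfolding h_def by (rule borel_measurable_norm_diff_simple [OF g_meas s_simple])
  \<comment> \<open>The factor 3 is 1 for the limit plus 2 for the approximants, the 2 coming from
    \<open>p(3)\<close>.\<close>
  have h_bound: "norm (h i t) \<le> 3 * K * cmod (f t)" for i t
    using norm_triangle_ineq4 [of "?g t" "s i t"] s_bound [of i t] g_bound [of t] by (simp add: h_def)
  have dom: "integrable lborel (\<lambda>t. 3 * K * cmod (f t))"
    using f by (intro integrable_mult_right integrable_norm)
  have h_int: "integrable lborel (h i)" for i
    by (rule Bochner_Integration.integrable_bound [OF dom h_meas]) (use h_bound [of i] K0 in simp)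
  have h_lim: "(\<lambda>i. integral\<^sup>L lborel (h i)) \<longlonglongrightarrow> 0"
  proof -
    have "(\<lambda>i. integral\<^sup>L lborel (h i)) \<longlonglongrightarrow> integral\<^sup>L lborel (\<lambda>_ :: real. 0 :: real)"
    proof (rule integral_dominated_convergence [where w = "\<lambda>t. 3 * K * cmod (f t)"])
      show "AE t in lborel. (\<lambda>i. h i t) \<longlonglongrightarrow> 0"
        using tendsto_norm [OF tendsto_diff [OF tendsto_const s_lim], of "?g t" t for t] by (simp add: h_def)
    qed (use h_bound h_meas dom in simp_all)
    then show ?thesis by simp
  qed
  have diff: "norm (Bochner_Integration.simple_bochner_integral lborel (s i) -
      Bochner_Integration.simple_bochner_integral lborel (s j)) \<le>
      integral\<^sup>L lborel (h i) + integral\<^sup>L lborel (h j)" for i j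
  proof -
    have "norm (s i t - s j t) \<le> h i t + h j t" for t
      using norm_triangle_ineq4 [of "?g t - s j t" "?g t - s i t"] by (simp add: h_def)
    then show ?thesis
      using simple_bochner_integral_diff_bound [OF s_bi s_bi, of "\<lambda>t. h i t + h j t" i j] h_int
      by simp
  qed
  have "Cauchy (\<lambda>i. Bochner_Integration.simple_bochner_integral lborel (s i))"
  proof (rule metric_CauchyI)
    fix e :: real
    assume "0 < e"
    then have "\<forall>\<^sub>F i in sequentially. integral\<^sup>L lborel (h i) < e / 2"
      by (intro order_tendstoD(2) [OF h_lim]) simp
    then obtain N where "\<And>i. i \<ge> N \<Longrightarrow> integral\<^sup>L lborel (h i) < e / 2"
      by (auto simp: eventually_sequentially)
    then show "\<exists>M. \<forall>m\<ge>M. \<forall>n\<ge>M. dist (Bochner_Integration.simple_bochner_integral lborel (s m))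
        (Bochner_Integration.simple_bochner_integral lborel (s n)) < e"
      using diff unfolding dist_norm by (intro exI [of _ N]) (smt (verit) field_sum_of_halves)
  qed
  then obtain v where v: "(\<lambda>i. Bochner_Integration.simple_bochner_integral lborel (s i)) \<longlonglongrightarrow> v"
    using Cauchy_convergent convergent_def by blast
  have "(\<integral>\<^sup>+ t. ennreal (norm (?g t - s i t)) \<partial>lborel) = ennreal (integral\<^sup>L lborel (h i))" for i
    using nn_integral_eq_integral [OF h_int [of i]] by (simp add: h_def)
  with tendsto_ennrealI [OF h_lim] g_meas s_bi v show ?thesis
    unfolding has_bochner_int_def by (intro exI [of _ v] conjI exI [of _ s]) auto
qed

locale isometric_rep =
  fixes T :: "real \<Rightarrow> 'a::complex_hilbert_space \<Rightarrow> 'a"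
  assumes rep: "operator_representation T" and iso: "isometric T" and cont: "strongly_continuous T"
begin

lemma T_add: "T t (y + z) = T t y + T t z" and T_scaleC: "T t (c *\<^sub>C y) = c *\<^sub>C T t y"
  and bounded_linear_T: "bounded_linear (T t)"
  and T_zero [simp]: "T 0 y = y" and T_T [simp]: "T s (T t y) = T (s + t) y"
  using rep unfolding operator_representation_def bounded_clinear_def
  by (auto simp: bounded_linear.linear linear_add)

lemma norm_T [simp]: "norm (T t y) = norm y"
  using iso by (simp add: isometric_def)

lemma continuous_on_T [continuous_intros]:
  "continuous_on S g \<Longrightarrow> continuous_on S (\<lambda>s. T (g s) y)"
  using cont continuous_on_compose2 [of UNIV "\<lambda>t. T t y" S g] by (auto simp: strongly_continuous_def)

lemma cinner_T_T: "cinner (T s y) (T t z) = cinner (T (s - t) y) z"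
proof -
  have "cinner (T s y) (T t z) = cinner (T t (T (s - t) y)) (T t z)"
    by simp
  also have "\<dots> = cinner (T (s - t) y) z"
    by (intro cinner_isometry T_add T_scaleC norm_T)
  finally show ?thesis .
qed

lemma has_bochner_int_L1_action:
  assumes "integrable lborel f"
  shows "has_bochner_int lborel (\<lambda>t. f t *\<^sub>C T (- t) y) (L1_action T f y)"
proof -
  have "continuous_on UNIV (\<lambda>t. T (- t) y)"
    by (intro continuous_intros)
  then obtain v where "has_bochner_int lborel (\<lambda>t. f t *\<^sub>C T (- t) y) v"
    using has_bochner_int_scaleC_continuous [OF assms, of "\<lambda>t. T (- t) y" "norm y"] by auto
  then show ?thesis
    unfolding L1_action_def by (simp add: bochner_int_eqI)
qed

lemma has_bochner_integral_cinner_L1_action: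
  assumes "integrable lborel f"
  shows "has_bochner_integral lborel (\<lambda>t. f t * cinner (T (- t) y) z) (cinner (L1_action T f y) z)"
  using bounded_linear_has_bochner_int [OF cinner.bounded_linear_left has_bochner_int_L1_action [OF assms], of y z]
  by (simp add: cinner_scaleC_left)

text \<open>Both arguments of \<open>cinner v v\<close>, with \<open>v\<close> the vector
  \<open>L1_action T f y\<close>, are expanded one after the other. Since \<open>T\<close> preserves
  inner products, the kernel depends on \<open>b - a\<close> only. This form yields positivity for
  Gaussian \<open>f\<close> and is the limit recognized in \<open>fourier_tendsto\<close>.\<close>

lemma norm_L1_action_sq:
  assumes f: "integrable lborel f"
  shows "complex_of_real ((norm (L1_action T f y))\<^sup>2) =
    (LINT b|lborel. LINT a|lborel. f a * cnj (f b) * cinner (T (b - a) y) y)"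
proof -
  let ?v = "L1_action T f y"
  have "cinner ?v (T (- b) y) = (LINT a|lborel. f a * cinner (T (b - a) y) y)" for b
    using has_bochner_integral_cinner_L1_action [OF f, of y "T (- b) y"]
    by (simp add: cinner_T_T has_bochner_integral_iff)
  then have eq: "cnj (f b * cinner (T (- b) y) ?v) = (LINT a|lborel. f a * cnj (f b) * cinner (T (b - a) y) y)" for b
    by (subst cinner_commute) (simp add: mult_ac flip: integral_mult_right_zero)
  have "complex_of_real ((norm ?v)\<^sup>2) = cnj (LINT b|lborel. f b * cinner (T (- b) y) ?v)"
    using has_bochner_integral_cinner_L1_action [OF f, of y ?v]
    by (simp add: has_bochner_integral_iff cinner_norm)
  also have "\<dots> = (LINT b|lborel. cnj (f b * cinner (T (- b) y) ?v))"
    by (rule Bochner_Integration.integral_cnj [symmetric])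
  finally show ?thesis
    by (simp only: eq)
qed

end

section \<open>Bochner's theorem by Gaussian regularization\<close>

lemma integrable_product_bound:
  fixes F :: "real \<Rightarrow> real \<Rightarrow> complex" and g h :: "real \<Rightarrow> real"
  assumes F: "(\<lambda>(x, y). F x y) \<in> borel_measurable (lborel \<Otimes>\<^sub>M lborel)"
    and g: "integrable lborel g" and h: "integrable lborel h"
    and bound: "\<And>x y. cmod (F x y) \<le> g x * h y"
  shows "integrable (lborel \<Otimes>\<^sub>M lborel) (\<lambda>(x, y). F x y)"
proof (rule Bochner_Integration.integrable_bound [OF _ F])
  have [measurable]: "g \<in> borel_measurable lborel" "h \<in> borel_measurable lborel"
    using g h by auto
  show "integrable (lborel \<Otimes>\<^sub>M lborel) (\<lambda>(x, y). g x * h y)"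
  proof (rule lborel_pair.Fubini_integrable)
    show "integrable lborel (\<lambda>x. \<integral>y. norm (case (x, y) of (x, y) \<Rightarrow> g x * h y) \<partial>lborel)"
      using g by (simp add: abs_mult)
    show "AE x in lborel. integrable lborel (\<lambda>y. case (x, y) of (x, y) \<Rightarrow> g x * h y)"
      using h by simp
  qed measurable
  show "AE z in lborel \<Otimes>\<^sub>M lborel. norm (case z of (x, y) \<Rightarrow> F x y) \<le> norm (case z of (x, y) \<Rightarrow> g x * h y)"
    using bound by (auto simp: order_trans [OF _ abs_ge_self])
qed

lemma Fubini_product_bound:
  fixes F :: "real \<Rightarrow> real \<Rightarrow> complex" and g h :: "real \<Rightarrow> real"
  assumes "(\<lambda>(x, y). F x y) \<in> borel_measurable (lborel \<Otimes>\<^sub>M lborel)"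
    and "integrable lborel g" and "integrable lborel h"
    and "\<And>x y. cmod (F x y) \<le> g x * h y"
  shows "(LINT y|lborel. LINT x|lborel. F x y) = (LINT x|lborel. LINT y|lborel. F x y)"
    and "integrable lborel (\<lambda>x. LINT y|lborel. F x y)"
  using lborel_pair.Fubini_integral [OF integrable_product_bound [OF assms]]
    lborel_pair.integrable_fst [OF integrable_product_bound [OF assms]] by auto

lemma integrable_normal_affine:
  "c \<noteq> 0 \<Longrightarrow> integrable lborel (\<lambda>x. std_normal_density (c * x + d))"
  using lborel_integrable_real_affine [of std_normal_density c d]
  by (simp add: add.commute)

lemma integrable_gauss:
  assumes "c > 0"
  shows "integrable lborel (\<lambda>x::real. exp (- (c * (x - d)\<^sup>2)))"
proof -
  have "exp (- (c * (x - d)\<^sup>2)) = sqrt (2 * pi) * std_normal_density (sqrt (2 * c) * x + (- sqrt (2 * c) * d))" for x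
    using assms by (simp add: std_normal_density_def power_mult_distrib flip: right_diff_distrib)
  then show ?thesis
    using assms integrable_normal_affine [of "sqrt (2 * c)" "- sqrt (2 * c) * d"] by simp
qed

lemma lborel_integral_gauss_shift:
  "(LINT x|lborel. exp (- (c * (x - d)\<^sup>2))) = (LINT x|lborel. exp (- (c * x\<^sup>2 :: real)))"
  using lborel_integral_real_affine [of 1 "\<lambda>x. exp (- (c * (x - d)\<^sup>2)) :: real" d] by simp

lemma lborel_integral_gauss_pos:
  assumes "c > 0"
  shows "0 < (LINT x|lborel. exp (- (c * x\<^sup>2 :: real)))"
proof -
  have "exp (- (c * x\<^sup>2)) = sqrt (2 * pi) * std_normal_density (0 + sqrt (2 * c) * x)" for x
    using assms by (simp add: std_normal_density_def power_mult_distrib)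
  moreover have "1 = sqrt (2 * c) * (LINT x|lborel. std_normal_density (0 + sqrt (2 * c) * x))"
    using assms lborel_integral_real_affine [of "sqrt (2 * c)" std_normal_density 0]
    by (simp add: integral_std_normal_moment_even [of 0, simplified])
  then have "0 < (LINT x|lborel. std_normal_density (0 + sqrt (2 * c) * x))"
    using assms by (metis real_sqrt_gt_zero mult_pos_pos zero_less_mult_pos zero_less_numeral zero_less_one)
  ultimately show ?thesis
    by simp
qed

lemma fourier_std_normal:
  "(LINT x|lborel. of_real (std_normal_density x) * cis (t * x)) = of_real (exp (- (t\<^sup>2 / 2)))"
proof -
  have "(LINT x|lborel. of_real (std_normal_density x) * cis (t * x)) =
      (LINT x|lborel. std_normal_density x *\<^sub>R cis (t * x))"
    by (simp add: scaleR_conv_of_real)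
  also have "\<dots> = char std_normal_distribution t"
    by (simp add: char_def integral_density cis_conv_exp mult.commute)
  finally show ?thesis
    by (simp add: char_std_normal_distribution)
qed

lemma fourier_normal_scaled:
  assumes "c > 0"
  shows "(LINT x|lborel. of_real (std_normal_density (c * x)) * cis (t * x)) =
    of_real (sqrt (2 * pi) / c * std_normal_density (t / c))"
proof -
  have "of_real (exp (- ((t / c)\<^sup>2 / 2))) =
      (LINT x|lborel. of_real (std_normal_density x) * cis (t / c * x))"
    by (rule fourier_std_normal [symmetric])
  also have "\<dots> = c *\<^sub>R (LINT x|lborel. of_real (std_normal_density (c * x)) * cis (t * x))"
    using assms lborel_integral_real_affine [of c "\<lambda>x. complex_of_real (std_normal_density x) * cis (t / c * x)" 0]
    by simp
  finally have "(LINT x|lborel. of_real (std_normal_density (c * x)) * cis (t * x)) =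
      of_real (exp (- ((t / c)\<^sup>2 / 2)) / c)"
    using assms by (simp add: scaleR_conv_of_real field_simps)
  then show ?thesis
    by (simp add: std_normal_density_def)
qed

section \<open>Densities in place of the spectral measure of a vector\<close>

context isometric_rep
begin

text \<open>The positive definite function that Bochner's theorem represents by the spectral measure
  of \<open>y\<close>.\<close>

definition autocorr :: "'a \<Rightarrow> real \<Rightarrow> complex" where
  "autocorr y t = cinner (T t y) y"

lemma autocorr_bound: "cmod (autocorr y t) \<le> (norm y)\<^sup>2"
  unfolding autocorr_def using cinner_cauchy_schwarz [of "T t y" y] by (simp add: power2_eq_square)

lemma continuous_autocorr: "continuous_on UNIV (autocorr y)"
  unfolding autocorr_def [abs_def]
  by (intro cinner.continuous_on continuous_intros)

lemma autocorr_measurable [measurable]: "autocorr y \<in> borel_measurable borel"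
  by (rule borel_measurable_continuous_onI [OF continuous_autocorr])

text \<open>
  The Gaussian weight is, up to a factor, the autocorrelation of a Gaussian \<open>u\<close>. Hence the integral is a
  positive multiple of \<open>\<parallel>f y\<parallel>\<^sup>2\<close>, where \<open>f\<close> is \<open>u\<close> times a character.
\<close>

lemma autocorr_gauss_transform_nonneg:
  assumes c: "c > 0"
  shows "(LINT v|lborel. autocorr y v * of_real (exp (- (c * v\<^sup>2))) * cis (- (v * \<xi>))) \<in> \<real>\<^sub>\<ge>\<^sub>0"
proof -
  \<comment> \<open>The exponents 2 c here and 4 c in \<kappa> come from completing the square:
    \<open>2 * (b - v)\<^sup>2 + 2 * b\<^sup>2 = v\<^sup>2 + 4 * (b - v / 2)\<^sup>2\<close>.
    Integrating over \<open>b\<close> thus leaves the weight with exponent c in \<open>v\<close>,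
    times the constant \<kappa>.\<close>
  define u where "u a = exp (- (2 * c * a\<^sup>2))" for a :: real
  define \<kappa> where "\<kappa> = (LINT b|lborel. exp (- (4 * c * b\<^sup>2)))"
  define f where "f a = of_real (u a) * cis (a * \<xi>)" for a
  define F where "F v b = autocorr y v * of_real (u (b - v) * u b) * cis (- (v * \<xi>))" for v b
  have u_meas [measurable]: "u \<in> borel_measurable borel"
    unfolding u_def by measurable
  have [measurable]: "cis \<in> borel_measurable borel"
    by (intro borel_measurable_continuous_onI continuous_intros)
  have u_int: "integrable lborel u"
    unfolding u_def using integrable_gauss [of "2 * c" 0] c by simp
  have f_int: "integrable lborel f"
    unfolding f_def by (rule Bochner_Integration.integrable_bound [OF u_int]) (auto simp: norm_mult)
  have "complex_of_real ((norm (L1_action T f y))\<^sup>2) =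
      (LINT b|lborel. LINT a|lborel. f a * cnj (f b) * autocorr y (b - a))"
    unfolding autocorr_def by (rule norm_L1_action_sq [OF f_int])
  also have "\<dots> = (LINT b|lborel. LINT v|lborel. F v b)"
  proof (rule Bochner_Integration.integral_cong [OF refl])
    fix b
    have "cis ((b - v) * \<xi>) * cnj (cis (b * \<xi>)) = cis (- (v * \<xi>))" for v
      by (simp add: cis_cnj cis_mult algebra_simps)
    then have "F v b = f (b + - 1 * v) * cnj (f b) * autocorr y (b - (b + - 1 * v))" for v
      by (simp add: F_def f_def mult_ac flip: cis_cnj)
    then show "(LINT a|lborel. f a * cnj (f b) * autocorr y (b - a)) = (LINT v|lborel. F v b)"
      using lborel_integral_real_affine [of "-1" "\<lambda>a. f a * cnj (f b) * autocorr y (b - a)" b] by simp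
  qed
  also have "\<dots> = (LINT v|lborel. LINT b|lborel. F v b)"
  proof (rule Fubini_product_bound(1))
    show "(\<lambda>(v, b). F v b) \<in> borel_measurable (lborel \<Otimes>\<^sub>M lborel)"
      unfolding F_def by measurable
    show "integrable lborel (\<lambda>v. (norm y)\<^sup>2 * exp (- (c / 2 * (v - 0)\<^sup>2)))"
      by (intro integrable_mult_right integrable_gauss) (use c in simp)
    show "integrable lborel (\<lambda>b. exp (- (c / 2 * (b - 0)\<^sup>2)))"
      by (intro integrable_gauss) (use c in simp)
    show "cmod (F v b) \<le> (norm y)\<^sup>2 * exp (- (c / 2 * (v - 0)\<^sup>2)) * exp (- (c / 2 * (b - 0)\<^sup>2))" for v b
    proof -
      \<comment> \<open>Fubini is applied with a product majorant, so the mixed quadratic form is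
        bounded below by one without a cross term; the halves leave room for the sum of squares that
        proves it.\<close>
      have "v\<^sup>2 / 2 + b\<^sup>2 / 2 \<le> 2 * (b - v)\<^sup>2 + 2 * b\<^sup>2"
      proof -
        have "2 * (b - v)\<^sup>2 + 2 * b\<^sup>2 - (v\<^sup>2 / 2 + b\<^sup>2 / 2) = ((3 * v - 4 * b)\<^sup>2 + 5 * b\<^sup>2) / 6"
          by (simp add: power2_eq_square algebra_simps)
        also have "\<dots> \<ge> 0"
          by simp
        finally show ?thesis
          by simp
      qed
      then have "c * (v\<^sup>2 / 2 + b\<^sup>2 / 2) \<le> c * (2 * (b - v)\<^sup>2 + 2 * b\<^sup>2)"
        using c by (intro mult_left_mono) auto
      then have "u (b - v) * u b \<le> exp (- (c / 2 * v\<^sup>2)) * exp (- (c / 2 * b\<^sup>2))"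
        unfolding u_def by (simp add: algebra_simps flip: exp_add)
      moreover have "cmod (F v b) = cmod (autocorr y v) * (u (b - v) * u b)"
        by (simp add: F_def norm_mult u_def)
      ultimately show ?thesis
        using autocorr_bound [of y v] by (simp add: mult_mono mult.assoc u_def)
    qed
  qed
  also have "\<dots> = (LINT v|lborel. of_real \<kappa> * (autocorr y v * of_real (exp (- (c * v\<^sup>2))) * cis (- (v * \<xi>))))"
  proof (rule Bochner_Integration.integral_cong [OF refl])
    fix v
    have "u (b - v) * u b = exp (- (c * v\<^sup>2)) * exp (- (4 * c * (b - v / 2)\<^sup>2))" for b
      by (simp add: u_def power2_eq_square algebra_simps flip: exp_add)
    then have "F v b = autocorr y v * of_real (exp (- (c * v\<^sup>2))) * cis (- (v * \<xi>)) *
        of_real (exp (- (4 * c * (b - v / 2)\<^sup>2)))" for b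
      by (simp add: F_def)
    then show "(LINT b|lborel. F v b) =
        of_real \<kappa> * (autocorr y v * of_real (exp (- (c * v\<^sup>2))) * cis (- (v * \<xi>)))"
      by (simp add: \<kappa>_def lborel_integral_gauss_shift integral_complex_of_real)
  qed
  finally have "complex_of_real ((norm (L1_action T f y))\<^sup>2) =
      of_real \<kappa> * (LINT v|lborel. autocorr y v * of_real (exp (- (c * v\<^sup>2))) * cis (- (v * \<xi>)))"
    by simp
  moreover have "\<kappa> > 0"
    unfolding \<kappa>_def using c by (intro lborel_integral_gauss_pos) simp
  ultimately have "(LINT v|lborel. autocorr y v * of_real (exp (- (c * v\<^sup>2))) * cis (- (v * \<xi>))) =
      of_real ((norm (L1_action T f y))\<^sup>2 / \<kappa>)"
    by (simp add: field_simps)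
  then show ?thesis
    using \<open>\<kappa> > 0\<close> by (simp only: nonneg_Reals_of_real_iff) simp
qed

end

context isometric_rep
begin

text \<open>Two Gaussians are at work: one damps \<open>autocorr y\<close>, so that its transform
  \<open>p\<close> exists and is nonnegative; the other damps \<open>p\<close>, so that
  \<open>q\<close> is integrable. Inverting the transform is then a matter of absolutely convergent
  Fubini. The factor of \<open>p\<close> in \<open>q\<close> is a Gaussian divided by 2 pi, the
  constant of Fourier inversion, and the right-hand side arises from the substitution
  \<open>v = s - \<sigma> * z\<close>.\<close>

lemma autocorr_gauss_smoothing:
  fixes \<sigma> s :: real and y :: 'a
  assumes \<sigma>: "\<sigma> > 0"
  defines "p \<equiv> \<lambda>\<xi>. LINT v|lborel. autocorr y v * of_real (exp (- (\<sigma>\<^sup>2 * v\<^sup>2))) * cis (- (v * \<xi>))"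
  defines "q \<equiv> \<lambda>\<xi>. std_normal_density (\<sigma> * \<xi>) / sqrt (2 * pi) * Re (p \<xi>)"
  shows "0 \<le> q \<xi>" and "integrable lborel q"
    and "(LINT \<xi>|lborel. of_real (q \<xi>) * cis (\<xi> * s)) =
      (LINT z|lborel. of_real (std_normal_density z * exp (- (\<sigma>\<^sup>2 * (s - \<sigma> * z)\<^sup>2))) * autocorr y (s - \<sigma> * z))"
proof -
  have [measurable]: "cis \<in> borel_measurable borel"
    by (intro borel_measurable_continuous_onI continuous_intros)
  have p: "p \<xi> = of_real (Re (p \<xi>))" "0 \<le> Re (p \<xi>)" for \<xi>
    using autocorr_gauss_transform_nonneg [of "\<sigma>\<^sup>2" y \<xi>] \<sigma>
    unfolding p_def by (auto simp: complex_nonneg_Reals_iff complex_eq_iff)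
  show "0 \<le> q \<xi>"
    unfolding q_def using p by simp
  define F where "F s \<xi> v = autocorr y v * of_real (exp (- (\<sigma>\<^sup>2 * v\<^sup>2))) *
      of_real (std_normal_density (\<sigma> * \<xi>) / sqrt (2 * pi)) * cis ((s - v) * \<xi>)" for s \<xi> v
  have F_int: "(LINT v|lborel. F s \<xi> v) = of_real (q \<xi>) * cis (\<xi> * s)" for s \<xi>
  proof -
    have "F s \<xi> v = of_real (std_normal_density (\<sigma> * \<xi>) / sqrt (2 * pi)) * cis (\<xi> * s) *
        (autocorr y v * of_real (exp (- (\<sigma>\<^sup>2 * v\<^sup>2))) * cis (- (v * \<xi>)))" for v
    proof -
      have "cis ((s - v) * \<xi>) = cis (\<xi> * s) * cis (- (v * \<xi>))"
        by (simp only: cis_mult) (simp add: algebra_simps)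
      then show ?thesis
        by (simp add: F_def mult_ac)
    qed
    then have "(LINT v|lborel. F s \<xi> v) = of_real (std_normal_density (\<sigma> * \<xi>) / sqrt (2 * pi)) * cis (\<xi> * s) * p \<xi>"
      by (simp add: p_def)
    then show ?thesis
      using p(1) [of \<xi>] by (simp add: q_def)
  qed
  have F_meas: "(\<lambda>(\<xi>, v). F s \<xi> v) \<in> borel_measurable (lborel \<Otimes>\<^sub>M lborel)" for s
    unfolding F_def by measurable
  have g_int: "integrable lborel (\<lambda>\<xi>. std_normal_density (\<sigma> * \<xi>) / sqrt (2 * pi))"
    using integrable_normal_affine [of \<sigma> 0] \<sigma> by simp
  have h_int: "integrable lborel (\<lambda>v. (norm y)\<^sup>2 * exp (- (\<sigma>\<^sup>2 * v\<^sup>2)))"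
    using integrable_gauss [of "\<sigma>\<^sup>2" 0] \<sigma> by simp
  have F_bound: "cmod (F s \<xi> v) \<le>
      std_normal_density (\<sigma> * \<xi>) / sqrt (2 * pi) * ((norm y)\<^sup>2 * exp (- (\<sigma>\<^sup>2 * v\<^sup>2)))" for s \<xi> v
  proof -
    have "cmod (F s \<xi> v) = cmod (autocorr y v) *
        (std_normal_density (\<sigma> * \<xi>) / sqrt (2 * pi) * exp (- (\<sigma>\<^sup>2 * v\<^sup>2)))"
      by (simp add: F_def norm_mult norm_divide)
    also have "\<dots> \<le> (norm y)\<^sup>2 * (std_normal_density (\<sigma> * \<xi>) / sqrt (2 * pi) * exp (- (\<sigma>\<^sup>2 * v\<^sup>2)))"
      by (intro mult_right_mono autocorr_bound) simp
    finally show ?thesis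
      by (simp only: mult_ac)
  qed
  note Fub = Fubini_product_bound [OF F_meas g_int h_int F_bound]
  have "integrable lborel (\<lambda>\<xi>. Re (of_real (q \<xi>) * cis (\<xi> * 0)))"
    using integrable_Re [OF Fub(2) [of 0]] unfolding F_int .
  then show "integrable lborel q"
    by simp
  have "(LINT \<xi>|lborel. of_real (q \<xi>) * cis (\<xi> * s)) = (LINT v|lborel. LINT \<xi>|lborel. F s \<xi> v)"
    using Fub(1) [of s] by (simp add: F_int)
  also have "\<dots> = (LINT v|lborel. autocorr y v *
      of_real (exp (- (\<sigma>\<^sup>2 * v\<^sup>2)) * (std_normal_density ((s - v) / \<sigma>) / \<sigma>)))"
  proof (rule Bochner_Integration.integral_cong [OF refl])
    fix v
    have "(LINT \<xi>|lborel. F s \<xi> v) = autocorr y v * of_real (exp (- (\<sigma>\<^sup>2 * v\<^sup>2))) / of_real (sqrt (2 * pi)) *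
        (LINT \<xi>|lborel. of_real (std_normal_density (\<sigma> * \<xi>)) * cis ((s - v) * \<xi>))"
      unfolding integral_mult_right_zero [symmetric] by (simp add: F_def mult_ac)
    then show "(LINT \<xi>|lborel. F s \<xi> v) =
        autocorr y v * of_real (exp (- (\<sigma>\<^sup>2 * v\<^sup>2)) * (std_normal_density ((s - v) / \<sigma>) / \<sigma>))"
      by (simp add: fourier_normal_scaled [OF \<sigma>])
  qed
  also have "\<dots> = \<sigma> *\<^sub>R (LINT z|lborel. autocorr y (s + - \<sigma> * z) *
      of_real (exp (- (\<sigma>\<^sup>2 * (s + - \<sigma> * z)\<^sup>2)) * (std_normal_density ((s - (s + - \<sigma> * z)) / \<sigma>) / \<sigma>)))"
    using lborel_integral_real_affine [of "- \<sigma>" "\<lambda>v. autocorr y v *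
      of_real (exp (- (\<sigma>\<^sup>2 * v\<^sup>2)) * (std_normal_density ((s - v) / \<sigma>) / \<sigma>))" s] \<sigma> by simp
  also have "\<dots> = (LINT z|lborel. of_real \<sigma> * (autocorr y (s + - \<sigma> * z) *
      of_real (exp (- (\<sigma>\<^sup>2 * (s + - \<sigma> * z)\<^sup>2)) * (std_normal_density ((s - (s + - \<sigma> * z)) / \<sigma>) / \<sigma>))))"
    by (simp only: integral_mult_right_zero scaleR_conv_of_real)
  also have "\<dots> = (LINT z|lborel. of_real (std_normal_density z * exp (- (\<sigma>\<^sup>2 * (s - \<sigma> * z)\<^sup>2))) * autocorr y (s - \<sigma> * z))"
    using \<sigma> by (intro Bochner_Integration.integral_cong refl) (simp add: mult_ac)
  finally show "(LINT \<xi>|lborel. of_real (q \<xi>) * cis (\<xi> * s)) =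
      (LINT z|lborel. of_real (std_normal_density z * exp (- (\<sigma>\<^sup>2 * (s - \<sigma> * z)\<^sup>2))) * autocorr y (s - \<sigma> * z))" .
qed

lemma autocorr_gauss_smoothing_tendsto:
  assumes \<sigma>: "\<sigma> \<longlonglongrightarrow> 0"
  shows "(\<lambda>n. LINT z|lborel. of_real (std_normal_density z * exp (- ((\<sigma> n)\<^sup>2 * (s - \<sigma> n * z)\<^sup>2))) *
      autocorr y (s - \<sigma> n * z)) \<longlonglongrightarrow> autocorr y s"
proof -
  have "(\<lambda>n. LINT z|lborel. of_real (std_normal_density z * exp (- ((\<sigma> n)\<^sup>2 * (s - \<sigma> n * z)\<^sup>2))) *
      autocorr y (s - \<sigma> n * z)) \<longlonglongrightarrow> (LINT z|lborel. of_real (std_normal_density z) * autocorr y s)"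
  proof (rule integral_dominated_convergence [where w = "\<lambda>z. std_normal_density z * (norm y)\<^sup>2"])
    show "AE z in lborel. (\<lambda>n. of_real (std_normal_density z * exp (- ((\<sigma> n)\<^sup>2 * (s - \<sigma> n * z)\<^sup>2))) *
        autocorr y (s - \<sigma> n * z)) \<longlonglongrightarrow> of_real (std_normal_density z) * autocorr y s"
    proof (rule AE_I2)
      fix z
      have "(\<lambda>n. s - \<sigma> n * z) \<longlonglongrightarrow> s"
        using tendsto_diff [OF tendsto_const tendsto_mult [OF \<sigma> tendsto_const], of s z] by simp
      moreover from this have "(\<lambda>n. autocorr y (s - \<sigma> n * z)) \<longlonglongrightarrow> autocorr y s"
        using continuous_on_tendsto_compose [OF continuous_autocorr] by auto
      ultimately have "(\<lambda>n. of_real (std_normal_density z * exp (- ((\<sigma> n)\<^sup>2 * (s - \<sigma> n * z)\<^sup>2))) *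
          autocorr y (s - \<sigma> n * z)) \<longlonglongrightarrow> of_real (std_normal_density z * exp (- (0\<^sup>2 * s\<^sup>2))) * autocorr y s"
        by (intro tendsto_intros \<sigma>)
      then show "(\<lambda>n. of_real (std_normal_density z * exp (- ((\<sigma> n)\<^sup>2 * (s - \<sigma> n * z)\<^sup>2))) *
          autocorr y (s - \<sigma> n * z)) \<longlonglongrightarrow> of_real (std_normal_density z) * autocorr y s"
        by simp
    qed
    show "AE z in lborel. norm (of_real (std_normal_density z * exp (- ((\<sigma> n)\<^sup>2 * (s - \<sigma> n * z)\<^sup>2))) *
        autocorr y (s - \<sigma> n * z)) \<le> std_normal_density z * (norm y)\<^sup>2" for n
    proof (rule AE_I2)
      fix z
      have "exp (- ((\<sigma> n)\<^sup>2 * (s - \<sigma> n * z)\<^sup>2)) * cmod (autocorr y (s - \<sigma> n * z)) \<le> 1 * (norm y)\<^sup>2"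
        by (intro mult_mono autocorr_bound) auto
      then show "norm (of_real (std_normal_density z * exp (- ((\<sigma> n)\<^sup>2 * (s - \<sigma> n * z)\<^sup>2))) *
          autocorr y (s - \<sigma> n * z)) \<le> std_normal_density z * (norm y)\<^sup>2"
        by (simp add: norm_mult mult.assoc mult_left_mono)
    qed
  qed (auto intro: integrable_normal_affine [of 1 0, simplified])
  moreover have "(LINT z|lborel. std_normal_density z) = 1"
    by (simp add: integral_std_normal_moment_even [of 0, simplified])
  ultimately show ?thesis
    by (simp add: integral_complex_of_real)
qed

text \<open>Bochner's theorem in approximate form. The parameter \<sigma> tends to 0 along
  \<open>inverse (real (Suc n))\<close>, which removes both Gaussian factors; no limit of the
  densities themselves is taken.\<close>

theorem autocorr_densities:
  obtains q :: "nat \<Rightarrow> real \<Rightarrow> real"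
  where "\<And>n \<xi>. 0 \<le> q n \<xi>" and "\<And>n. integrable lborel (q n)"
    and "\<And>s. (\<lambda>n. LINT \<xi>|lborel. of_real (q n \<xi>) * cis (\<xi> * s)) \<longlonglongrightarrow> autocorr y s"
proof -
  define \<sigma> where "\<sigma> n = inverse (real (Suc n))" for n
  have \<sigma>: "\<sigma> n > 0" for n
    by (simp add: \<sigma>_def)
  have lim: "\<sigma> \<longlonglongrightarrow> 0"
    unfolding \<sigma>_def by (rule LIMSEQ_inverse_real_of_nat)
  define q where "q n \<xi> = std_normal_density (\<sigma> n * \<xi>) / sqrt (2 * pi) *
      Re (LINT v|lborel. autocorr y v * of_real (exp (- ((\<sigma> n)\<^sup>2 * v\<^sup>2))) * cis (- (v * \<xi>)))" for n \<xi>
  note q = autocorr_gauss_smoothing [OF \<sigma>, where y = y, folded q_def]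
  show ?thesis
    by (rule that [of q, OF q(1,2)]) (simp only: q(3) autocorr_gauss_smoothing_tendsto [OF lim])
qed

end

section \<open>Fourier transforms of integrable functions\<close>

lemma fourier_cis: "fourier f \<xi> = (LINT t|lborel. f t * cis (- (t * \<xi>)))"
  by (simp add: fourier_def cis_conv_exp mult.assoc)

lemma fourier_bound: "cmod (fourier f \<xi>) \<le> (LINT t|lborel. cmod (f t))"
  unfolding fourier_cis
  using integral_norm_bound [of lborel "\<lambda>t. f t * cis (- (t * \<xi>))"] by (simp add: norm_mult)

lemma continuous_fourier:
  assumes f: "integrable lborel f"
  shows "continuous_on UNIV (fourier f)"
proof -
  have [measurable]: "cis \<in> borel_measurable borel"
    by (intro borel_measurable_continuous_onI continuous_intros)
  have [measurable]: "f \<in> borel_measurable lborel"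
    using f by simp
  have "(\<lambda>n. fourier f (u n)) \<longlonglongrightarrow> fourier f \<xi>" if u: "u \<longlonglongrightarrow> \<xi>" for u \<xi>
    unfolding fourier_cis
  proof (rule integral_dominated_convergence [where w = "\<lambda>t. cmod (f t)"])
    show "AE t in lborel. (\<lambda>n. f t * cis (- (t * u n))) \<longlonglongrightarrow> f t * cis (- (t * \<xi>))"
      by (intro AE_I2 tendsto_intros u)
  qed (use f in \<open>auto simp: norm_mult\<close>)
  then show ?thesis
    by (simp add: continuous_on_sequentially o_def)
qed

section \<open>Trigonometric polynomials of a representation\<close>

text \<open>A relation and not a map from functions to operators, so that no operator has to be
  recovered from \<open>g\<close>; properties of trigonometric polynomials follow by induction on
  how they are built.\<close>

inductive (in isometric_rep) symbol :: "('a \<Rightarrow> 'a) \<Rightarrow> (real \<Rightarrow> complex) \<Rightarrow> bool" where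
  base: "symbol (T t) (\<lambda>\<xi>. cis (\<xi> * t))"
| add: "symbol R g \<Longrightarrow> symbol S h \<Longrightarrow> symbol (\<lambda>y. R y + S y) (\<lambda>\<xi>. g \<xi> + h \<xi>)"
| scale: "symbol R g \<Longrightarrow> symbol (\<lambda>y. c *\<^sub>C R y) (\<lambda>\<xi>. c * g \<xi>)"

lemma (in isometric_rep) symbol_continuous: "symbol R g \<Longrightarrow> continuous_on UNIV g"
  by (induction rule: symbol.induct) (auto intro!: continuous_intros)

lemma (in isometric_rep) symbol_bounded: "symbol R g \<Longrightarrow> \<exists>G. \<forall>\<xi>. cmod (g \<xi>) \<le> G"
proof (induction rule: symbol.induct)
  case (base t)
  then show ?case
    by (intro exI [of _ 1]) simp
next
  case (add R g S h)
  then obtain G H where "\<And>\<xi>. cmod (g \<xi>) \<le> G" "\<And>\<xi>. cmod (h \<xi>) \<le> H"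
    by blast
  then show ?case
    by (intro exI [of _ "G + H"]) (meson add_mono norm_triangle_le)
next
  case (scale R g c)
  then obtain G where "\<And>\<xi>. cmod (g \<xi>) \<le> G"
    by blast
  then show ?case
    by (intro exI [of _ "cmod c * G"]) (simp add: norm_mult mult_left_mono)
qed

locale spectral_densities = isometric_rep T for T :: "real \<Rightarrow> 'a::complex_hilbert_space \<Rightarrow> 'a" +
  fixes y :: 'a and q :: "nat \<Rightarrow> real \<Rightarrow> real"
  assumes q_nonneg: "0 \<le> q n \<xi>" and q_int: "integrable lborel (q n)"
    and q_lim: "(\<lambda>n. LINT \<xi>|lborel. of_real (q n \<xi>) * cis (\<xi> * s)) \<longlonglongrightarrow> autocorr y s"
begin

definition Phi :: "nat \<Rightarrow> real \<Rightarrow> complex" where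
  "Phi n s = (LINT \<xi>|lborel. of_real (q n \<xi>) * cis (\<xi> * s))"

lemma cis_meas [measurable]: "cis \<in> borel_measurable borel"
  by (intro borel_measurable_continuous_onI continuous_intros)

lemma cnj_meas [measurable]: "cnj \<in> borel_measurable borel"
  by (intro borel_measurable_continuous_onI continuous_intros)

lemma q_meas [measurable]: "q n \<in> borel_measurable borel"
  using q_int [of n] by simp

lemma Phi_tendsto: "(\<lambda>n. Phi n s) \<longlonglongrightarrow> autocorr y s"
  unfolding Phi_def by (rule q_lim)

lemma Phi_meas [measurable]: "Phi n \<in> borel_measurable borel"
  unfolding Phi_def [abs_def] by measurable

lemma mass_tendsto: "(\<lambda>n. LINT \<xi>|lborel. q n \<xi>) \<longlonglongrightarrow> (norm y)\<^sup>2"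
proof -
  have "(\<lambda>n. Re (Phi n 0)) \<longlonglongrightarrow> Re (autocorr y 0)"
    by (intro tendsto_Re Phi_tendsto)
  then show ?thesis
    by (simp add: Phi_def integral_complex_of_real autocorr_def cinner_norm flip: of_real_power)
qed

lemma Phi_bounded: obtains C where "\<And>n s. cmod (Phi n s) \<le> C"
proof -
  obtain C where C: "\<And>n. norm (LINT \<xi>|lborel. q n \<xi>) \<le> C"
    using convergent_imp_Bseq [OF convergentI [OF mass_tendsto]] by (auto simp: Bseq_def)
  have "cmod (Phi n s) \<le> C" for n s
    using integral_norm_bound [of lborel "\<lambda>\<xi>. of_real (q n \<xi>) * cis (\<xi> * s)"] C [of n] q_nonneg
    by (simp add: Phi_def norm_mult)
  then show ?thesis
    by (rule that)
qed

lemma integrable_q_mult: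
  fixes f :: "real \<Rightarrow> complex"
  assumes [measurable]: "f \<in> borel_measurable borel" and G: "\<And>\<xi>. cmod (f \<xi>) \<le> G"
  shows "integrable lborel (\<lambda>\<xi>. of_real (q n \<xi>) * f \<xi>)"
proof (rule Bochner_Integration.integrable_bound)
  show "integrable lborel (\<lambda>\<xi>. G * q n \<xi>)"
    by (intro integrable_mult_right q_int)
  have "q n \<xi> * cmod (f \<xi>) \<le> \<bar>G * q n \<xi>\<bar>" for \<xi>
    using mult_left_mono [OF G [of \<xi>] q_nonneg [of n \<xi>]] by (simp add: mult.commute)
  then show "AE \<xi> in lborel. norm (of_real (q n \<xi>) * f \<xi>) \<le> norm (G * q n \<xi>)"
    using q_nonneg by (simp add: norm_mult)
qed measurable

lemma integrable_q_symbols: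
  assumes "symbol R g" and "symbol S h"
  shows "integrable lborel (\<lambda>\<xi>. of_real (q n \<xi>) * (g \<xi> * cnj (h \<xi>)))"
proof -
  obtain G H where "\<And>\<xi>. cmod (g \<xi>) \<le> G" "\<And>\<xi>. cmod (h \<xi>) \<le> H"
    using assms symbol_bounded by meson
  then have "cmod (g \<xi> * cnj (h \<xi>)) \<le> G * H" for \<xi>
    by (simp add: norm_mult) (meson mult_mono norm_ge_zero order_trans)
  moreover have "(\<lambda>\<xi>. g \<xi> * cnj (h \<xi>)) \<in> borel_measurable borel"
    using assms by (intro borel_measurable_continuous_onI continuous_intros symbol_continuous)
  ultimately show ?thesis
    by (rule integrable_q_mult [rotated])
qed

text \<open>Both sides are sesquilinear, and for two characters the product has frequency
  \<open>s - t\<close>, as in \<open>cinner_T_T\<close>. Two separate symbols are used because the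
  diagonal case, which is the one wanted, is not preserved under addition.\<close>

lemma symbol_tendsto:
  assumes "symbol R g" and "symbol S h"
  shows "(\<lambda>n. LINT \<xi>|lborel. of_real (q n \<xi>) * (g \<xi> * cnj (h \<xi>))) \<longlonglongrightarrow> cinner (R y) (S y)"
  using assms
proof (induction R g rule: symbol.induct)
  case (base s)
  from base.prems base.prems show ?case
  proof (induction S h rule: symbol.induct)
    case (base t)
    have "cis (\<xi> * s) * cnj (cis (\<xi> * t)) = cis (\<xi> * (s - t))" for \<xi>
      by (simp add: cis_cnj cis_mult algebra_simps)
    then show ?case
      using q_lim [of "s - t"] by (simp add: autocorr_def cinner_T_T)
  next
    case (add R g S h)
    note base = symbol.base [of s]
    have "(LINT \<xi>|lborel. of_real (q n \<xi>) * (cis (\<xi> * s) * cnj (g \<xi> + h \<xi>))) =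
        (LINT \<xi>|lborel. of_real (q n \<xi>) * (cis (\<xi> * s) * cnj (g \<xi>))) +
        (LINT \<xi>|lborel. of_real (q n \<xi>) * (cis (\<xi> * s) * cnj (h \<xi>)))" for n
      using Bochner_Integration.integral_add [OF integrable_q_symbols [OF base add.hyps(1), of n] integrable_q_symbols [OF base add.hyps(2), of n]]
      by (simp add: algebra_simps)
    then show ?case
      using tendsto_add [OF add.IH(1) add.IH(2)] add.hyps by (simp add: cinner_add_right)
  next
    case (scale R g c)
    have "(LINT \<xi>|lborel. of_real (q n \<xi>) * (cis (\<xi> * s) * cnj (c * g \<xi>))) =
        cnj c * (LINT \<xi>|lborel. of_real (q n \<xi>) * (cis (\<xi> * s) * cnj (g \<xi>)))" for n
      unfolding integral_mult_right_zero [symmetric] by (simp add: mult_ac)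
    then show ?case
      using tendsto_mult_left [OF scale.IH, of "cnj c"] scale.hyps by (simp add: cinner_scaleC_right)
  qed
next
  case (add R g R' g')
  have "(LINT \<xi>|lborel. of_real (q n \<xi>) * ((g \<xi> + g' \<xi>) * cnj (h \<xi>))) =
      (LINT \<xi>|lborel. of_real (q n \<xi>) * (g \<xi> * cnj (h \<xi>))) +
      (LINT \<xi>|lborel. of_real (q n \<xi>) * (g' \<xi> * cnj (h \<xi>)))" for n
    using Bochner_Integration.integral_add [OF integrable_q_symbols [OF add.hyps(1) add.prems, of n] integrable_q_symbols [OF add.hyps(2) add.prems, of n]]
    by (simp add: algebra_simps)
  then show ?case
    using tendsto_add [OF add.IH(1) add.IH(2)] add.prems by (simp add: cinner_add_left)
next
  case (scale R g c)
  have "(LINT \<xi>|lborel. of_real (q n \<xi>) * (c * g \<xi> * cnj (h \<xi>))) =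
      c * (LINT \<xi>|lborel. of_real (q n \<xi>) * (g \<xi> * cnj (h \<xi>)))" for n
    unfolding integral_mult_right_zero [symmetric] by (simp add: mult_ac)
  then show ?case
    using tendsto_mult_left [OF scale.IH, of c] scale.prems by (simp add: cinner_scaleC_left)
qed

text \<open>The Gaussian in \<xi> is itself an average of characters with normal weights. Fubini
  turns the integral into an average of \<open>Phi n\<close>, and dominated convergence applies
  because the total masses, hence all \<open>Phi n\<close>, are uniformly bounded.\<close>

lemma gauss_tendsto:
  "(\<lambda>n. LINT \<xi>|lborel. q n \<xi> * exp (- ((\<sigma> * \<xi>)\<^sup>2 / 2))) \<longlonglongrightarrow>
    Re (LINT z|lborel. of_real (std_normal_density z) * autocorr y (\<sigma> * z))"
proof -
  have N_int: "integrable lborel std_normal_density"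
    using integrable_normal_affine [of 1 0] by simp
  obtain C where C: "\<And>n s. cmod (Phi n s) \<le> C"
    using Phi_bounded by blast
  have eq: "(LINT \<xi>|lborel. complex_of_real (q n \<xi> * exp (- ((\<sigma> * \<xi>)\<^sup>2 / 2)))) =
      (LINT z|lborel. of_real (std_normal_density z) * Phi n (\<sigma> * z))" for n
  proof -
    define F where "F \<xi> z = of_real (q n \<xi>) * (of_real (std_normal_density z) * cis (\<sigma> * \<xi> * z))" for \<xi> z
    have "(LINT z|lborel. LINT \<xi>|lborel. F \<xi> z) = (LINT \<xi>|lborel. LINT z|lborel. F \<xi> z)"
    proof (rule Fubini_product_bound(1) [OF _ q_int [of n] N_int])
      show "(\<lambda>(\<xi>, z). F \<xi> z) \<in> borel_measurable (lborel \<Otimes>\<^sub>M lborel)"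
        unfolding F_def by measurable
      show "cmod (F \<xi> z) \<le> q n \<xi> * std_normal_density z" for \<xi> z
        using q_nonneg [of n \<xi>] by (simp add: F_def norm_mult)
    qed
    moreover have "(LINT \<xi>|lborel. F \<xi> z) = of_real (std_normal_density z) * Phi n (\<sigma> * z)" for z
      unfolding Phi_def integral_mult_right_zero [symmetric] by (simp add: F_def mult_ac)
    moreover have "(LINT z|lborel. F \<xi> z) = of_real (q n \<xi> * exp (- ((\<sigma> * \<xi>)\<^sup>2 / 2)))" for \<xi>
      by (simp add: F_def fourier_std_normal)
    ultimately show ?thesis
      by simp
  qed
  have "(\<lambda>n. LINT z|lborel. of_real (std_normal_density z) * Phi n (\<sigma> * z)) \<longlonglongrightarrow>
      (LINT z|lborel. of_real (std_normal_density z) * autocorr y (\<sigma> * z))"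
  proof (rule integral_dominated_convergence [where w = "\<lambda>z. std_normal_density z * C"])
    show "AE z in lborel. (\<lambda>n. of_real (std_normal_density z) * Phi n (\<sigma> * z)) \<longlonglongrightarrow>
        of_real (std_normal_density z) * autocorr y (\<sigma> * z)"
      by (intro AE_I2 tendsto_intros Phi_tendsto)
    show "AE z in lborel. norm (of_real (std_normal_density z) * Phi n (\<sigma> * z)) \<le> std_normal_density z * C" for n
      using C by (intro AE_I2) (simp add: norm_mult mult_left_mono)
  qed (use N_int in auto)
  then have "(\<lambda>n. LINT \<xi>|lborel. complex_of_real (q n \<xi> * exp (- ((\<sigma> * \<xi>)\<^sup>2 / 2)))) \<longlonglongrightarrow>
      (LINT z|lborel. of_real (std_normal_density z) * autocorr y (\<sigma> * z))"
    by (simp only: eq)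
  from tendsto_Re [OF this] show ?thesis
    by (simp only: integral_complex_of_real Re_complex_of_real)
qed

text \<open>The squared modulus of \<open>fourier f\<close> is a double average of characters with
  weights \<open>f a * cnj (f b)\<close>. Two applications of Fubini produce
  \<open>Phi n (b - a)\<close>, two of dominated convergence replace it by
  \<open>autocorr y (b - a)\<close>, and \<open>norm_L1_action_sq\<close> identifies the
  result.\<close>

lemma fourier_tendsto:
  assumes f: "integrable lborel f"
  shows "(\<lambda>n. LINT \<xi>|lborel. q n \<xi> * (cmod (fourier f \<xi>))\<^sup>2) \<longlonglongrightarrow> (norm (L1_action T f y))\<^sup>2"
proof -
  have [measurable]: "f \<in> borel_measurable borel" "fourier f \<in> borel_measurable borel"
    using f by (auto intro: borel_measurable_continuous_onI continuous_fourier)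
  have f_norm: "integrable lborel (\<lambda>t. cmod (f t))"
    using f by (rule integrable_norm)
  obtain C where C: "\<And>n s. cmod (Phi n s) \<le> C"
    using Phi_bounded by blast
  let ?D = "LINT t|lborel. cmod (f t)"
  have inner: "(LINT \<xi>|lborel. of_real (q n \<xi>) * cis (\<xi> * b) * fourier f \<xi>) =
      (LINT a|lborel. f a * Phi n (b - a))" for n b
  proof -
    define F where "F \<xi> a = of_real (q n \<xi>) * (f a * cis (\<xi> * (b - a)))" for \<xi> a
    have "(LINT a|lborel. LINT \<xi>|lborel. F \<xi> a) = (LINT \<xi>|lborel. LINT a|lborel. F \<xi> a)"
    proof (rule Fubini_product_bound(1) [OF _ q_int [of n] f_norm])
      show "(\<lambda>(\<xi>, a). F \<xi> a) \<in> borel_measurable (lborel \<Otimes>\<^sub>M lborel)"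
        unfolding F_def by measurable
      show "cmod (F \<xi> a) \<le> q n \<xi> * cmod (f a)" for \<xi> a
        using q_nonneg [of n \<xi>] by (simp add: F_def norm_mult)
    qed
    moreover have "(LINT \<xi>|lborel. F \<xi> a) = f a * Phi n (b - a)" for a
      unfolding Phi_def integral_mult_right_zero [symmetric] by (simp add: F_def mult_ac)
    moreover have "(LINT a|lborel. F \<xi> a) = of_real (q n \<xi>) * cis (\<xi> * b) * fourier f \<xi>" for \<xi>
    proof -
      have "cis (\<xi> * (b - a)) = cis (\<xi> * b) * cis (- (a * \<xi>))" for a
        by (simp add: cis_mult algebra_simps)
      then show ?thesis
        unfolding fourier_cis integral_mult_right_zero [symmetric] by (simp add: F_def mult_ac)
    qed
    ultimately show ?thesis
      by simp
  qed
  have outer: "(LINT \<xi>|lborel. complex_of_real (q n \<xi> * (cmod (fourier f \<xi>))\<^sup>2)) =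
      (LINT b|lborel. cnj (f b) * (LINT a|lborel. f a * Phi n (b - a)))" for n
  proof -
    define F where "F \<xi> b = cnj (f b) * (of_real (q n \<xi>) * cis (\<xi> * b) * fourier f \<xi>)" for \<xi> b
    have "(LINT b|lborel. LINT \<xi>|lborel. F \<xi> b) = (LINT \<xi>|lborel. LINT b|lborel. F \<xi> b)"
    proof (rule Fubini_product_bound(1))
      show "(\<lambda>(\<xi>, b). F \<xi> b) \<in> borel_measurable (lborel \<Otimes>\<^sub>M lborel)"
        unfolding F_def by measurable
      show "integrable lborel (\<lambda>\<xi>. q n \<xi> * ?D)"
        by (intro integrable_mult_left q_int)
      show "cmod (F \<xi> b) \<le> q n \<xi> * ?D * cmod (f b)" for \<xi> b
        using mult_left_mono [OF fourier_bound [of f \<xi>], of "cmod (f b) * q n \<xi>"] q_nonneg [of n \<xi>]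
        by (simp add: F_def norm_mult mult_ac)
    qed (rule f_norm)
    moreover have "(LINT \<xi>|lborel. F \<xi> b) = cnj (f b) * (LINT a|lborel. f a * Phi n (b - a))" for b
      by (simp add: F_def inner)
    moreover have "(LINT b|lborel. F \<xi> b) = of_real (q n \<xi> * (cmod (fourier f \<xi>))\<^sup>2)" for \<xi>
    proof -
      have "cnj (fourier f \<xi>) = (LINT b|lborel. cnj (f b) * cis (\<xi> * b))"
        unfolding fourier_cis by (simp add: cis_cnj mult.commute flip: Bochner_Integration.integral_cnj)
      then have "(LINT b|lborel. F \<xi> b) = of_real (q n \<xi>) * (fourier f \<xi> * cnj (fourier f \<xi>))"
        unfolding integral_mult_right_zero [symmetric]
        by (simp only: F_def mult_ac flip: integral_mult_right_zero)
      then show ?thesis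
        by (simp add: complex_norm_square [symmetric])
    qed
    ultimately show ?thesis
      by simp
  qed
  have inner_lim: "(\<lambda>n. LINT a|lborel. f a * Phi n (b - a)) \<longlonglongrightarrow> (LINT a|lborel. f a * autocorr y (b - a))" for b
  proof (rule integral_dominated_convergence [where w = "\<lambda>a. cmod (f a) * C"])
    show "AE a in lborel. (\<lambda>n. f a * Phi n (b - a)) \<longlonglongrightarrow> f a * autocorr y (b - a)"
      by (intro AE_I2 tendsto_intros Phi_tendsto)
    show "AE a in lborel. norm (f a * Phi n (b - a)) \<le> cmod (f a) * C" for n
      using C by (intro AE_I2) (simp add: norm_mult mult_left_mono)
  qed (use f_norm in auto)
  have inner_bound: "cmod (LINT a|lborel. f a * Phi n (b - a)) \<le> ?D * C" for n b
  proof -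
    have le: "norm (f a * Phi n (b - a)) \<le> cmod (f a) * C" for a
      using C by (simp add: norm_mult mult_left_mono)
    have int: "integrable lborel (\<lambda>a. cmod (f a) * C)"
      using f_norm by simp
    have "integrable lborel (\<lambda>a. f a * Phi n (b - a))"
    proof (rule Bochner_Integration.integrable_bound [OF int])
      show "AE a in lborel. norm (f a * Phi n (b - a)) \<le> norm (cmod (f a) * C)"
        using order_trans [OF le abs_ge_self] by simp
    qed measurable
    then have "cmod (LINT a|lborel. f a * Phi n (b - a)) \<le> (LINT a|lborel. cmod (f a) * C)"
      using int le by (intro Bochner_Integration.integral_norm_bound_integral)
    then show ?thesis
      by simp
  qed
  have "(\<lambda>n. LINT b|lborel. cnj (f b) * (LINT a|lborel. f a * Phi n (b - a))) \<longlonglongrightarrow>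
      (LINT b|lborel. cnj (f b) * (LINT a|lborel. f a * autocorr y (b - a)))"
  proof (rule integral_dominated_convergence [where w = "\<lambda>b. cmod (f b) * (?D * C)"])
    show "AE b in lborel. (\<lambda>n. cnj (f b) * (LINT a|lborel. f a * Phi n (b - a))) \<longlonglongrightarrow>
        cnj (f b) * (LINT a|lborel. f a * autocorr y (b - a))"
      by (intro AE_I2 tendsto_intros inner_lim)
    show "AE b in lborel. norm (cnj (f b) * (LINT a|lborel. f a * Phi n (b - a))) \<le> cmod (f b) * (?D * C)" for n
      using inner_bound by (intro AE_I2) (simp add: norm_mult mult_left_mono)
  qed (use f_norm in auto)
  also have "(LINT b|lborel. cnj (f b) * (LINT a|lborel. f a * autocorr y (b - a))) =
      of_real ((norm (L1_action T f y))\<^sup>2)"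
    unfolding norm_L1_action_sq [OF f] integral_mult_right_zero [symmetric]
    by (simp only: autocorr_def mult_ac)
  finally have "(\<lambda>n. LINT \<xi>|lborel. complex_of_real (q n \<xi> * (cmod (fourier f \<xi>))\<^sup>2)) \<longlonglongrightarrow>
      of_real ((norm (L1_action T f y))\<^sup>2)"
    by (simp only: outer)
  from tendsto_Re [OF this] show ?thesis
    by (simp only: integral_complex_of_real Re_complex_of_real)
qed

end

lemma (in spectral_densities) integrable_q_real:
  fixes f :: "real \<Rightarrow> real"
  assumes "continuous_on UNIV f" and "\<And>\<xi>. \<bar>f \<xi>\<bar> \<le> G"
  shows "integrable lborel (\<lambda>\<xi>. q n \<xi> * f \<xi>)"
proof -
  have "f \<in> borel_measurable borel"
    using assms(1) by (rule borel_measurable_continuous_onI)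
  then have "integrable lborel (\<lambda>\<xi>. Re (of_real (q n \<xi>) * of_real (f \<xi>)))"
    using assms(2) by (intro integrable_Re integrable_q_mult [where G = G]) auto
  then show ?thesis
    by simp
qed

text \<open>This is where strong continuity gives tightness: \<open>autocorr y\<close> is continuous
  at 0, so by \<open>gauss_tendsto\<close> a wide Gaussian captures almost the whole mass in the
  limit.\<close>

lemma (in isometric_rep) autocorr_normal_average_tendsto:
  assumes \<sigma>: "\<sigma> \<longlonglongrightarrow> 0"
  shows "(\<lambda>n. Re (LINT z|lborel. of_real (std_normal_density z) * autocorr y (\<sigma> n * z))) \<longlonglongrightarrow> (norm y)\<^sup>2"
proof -
  have N_int: "integrable lborel std_normal_density"
    using integrable_normal_affine [of 1 0] by simp
  have "(\<lambda>n. LINT z|lborel. of_real (std_normal_density z) * autocorr y (\<sigma> n * z)) \<longlonglongrightarrow>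
      (LINT z|lborel. of_real (std_normal_density z) * autocorr y 0)"
  proof (rule integral_dominated_convergence [where w = "\<lambda>z. std_normal_density z * (norm y)\<^sup>2"])
    show "AE z in lborel. (\<lambda>n. of_real (std_normal_density z) * autocorr y (\<sigma> n * z)) \<longlonglongrightarrow>
        of_real (std_normal_density z) * autocorr y 0"
    proof (intro AE_I2 tendsto_mult tendsto_const)
      fix z
      have "(\<lambda>n. \<sigma> n * z) \<longlonglongrightarrow> 0"
        using tendsto_mult [OF \<sigma> tendsto_const [of z]] by simp
      then show "(\<lambda>n. autocorr y (\<sigma> n * z)) \<longlonglongrightarrow> autocorr y 0"
        using continuous_on_tendsto_compose [OF continuous_autocorr] by auto
    qed
    show "AE z in lborel. norm (of_real (std_normal_density z) * autocorr y (\<sigma> n * z)) \<le>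
        std_normal_density z * (norm y)\<^sup>2" for n
      by (intro AE_I2) (simp add: norm_mult mult_left_mono autocorr_bound)
  qed (use N_int in auto)
  from tendsto_Re [OF this] show ?thesis
    by (simp add: integral_complex_of_real integral_std_normal_moment_even [of 0, simplified]
        autocorr_def cinner_norm flip: of_real_power)
qed

text \<open>
  Pointwise, \<open>\<bar>g\<bar>\<^sup>2\<close> is at most \<open>M\<^sup>2 + \<eta>\<close> plus a multiple of \<open>\<Sum> \<bar>fourier f\<^sub>j\<bar>\<^sup>2\<close> for finitely many
  annihilating \<open>f\<^sub>j\<close> (these take care of a compact set off the spectrum) plus a multiple of
  \<open>1 - exp (- (\<sigma> \<xi>)\<^sup>2 / 2)\<close> (this takes care of large \<open>\<xi>\<close> and has a small integral for small \<open>\<sigma>\<close>).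
\<close>

theorem (in isometric_rep) symbol_norm_bound:
  assumes sym: "symbol R g" and M0: "0 \<le> M"
    and M: "\<And>\<xi>. \<xi> \<in> beurling_spectrum T \<Longrightarrow> cmod (g \<xi>) \<le> M"
  shows "norm (R y) \<le> M * norm y"
proof -
  obtain q where q: "\<And>n \<xi>. 0 \<le> q n \<xi>" "\<And>n. integrable lborel (q n)"
    "\<And>s. (\<lambda>n. LINT \<xi>|lborel. of_real (q n \<xi>) * cis (\<xi> * s)) \<longlonglongrightarrow> autocorr y s"
    using autocorr_densities [of y] by blast
  interpret spectral_densities T y q
    by unfold_locales (use q in auto)
  obtain G where G: "\<And>\<xi>. cmod (g \<xi>) \<le> G"
    using symbol_bounded [OF sym] by blast
  then have G2: "(cmod (g \<xi>))\<^sup>2 \<le> G\<^sup>2" for \<xi>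
    by (intro power_mono) auto
  note g_cont = symbol_continuous [OF sym]
  have approx: "(norm (R y))\<^sup>2 \<le> (M\<^sup>2 + \<eta>) * (norm y)\<^sup>2 + \<eta>" if \<eta>: "\<eta> > 0" for \<eta>
  proof -
    define A where "A \<sigma> = Re (LINT z|lborel. of_real (std_normal_density z) * autocorr y (\<sigma> * z))" for \<sigma>
    \<comment> \<open>The order of choices matters: \<sigma> is fixed now, so that the contribution
      of large \<xi> is at most \<eta> in the limit. The compact set and the annihilating functions
      may depend on \<sigma>, and the limit over the densities comes last.\<close>
    have "(\<lambda>n. 2 * G\<^sup>2 * ((norm y)\<^sup>2 - A (inverse (real (Suc n))))) \<longlonglongrightarrow> 2 * G\<^sup>2 * ((norm y)\<^sup>2 - (norm y)\<^sup>2)"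
      unfolding A_def by (intro tendsto_intros autocorr_normal_average_tendsto LIMSEQ_inverse_real_of_nat)
    then have "\<forall>\<^sub>F n in sequentially. 2 * G\<^sup>2 * ((norm y)\<^sup>2 - A (inverse (real (Suc n)))) < \<eta>"
      using \<eta> by (intro order_tendstoD(2)) auto
    then obtain n where n: "2 * G\<^sup>2 * ((norm y)\<^sup>2 - A (inverse (real (Suc n)))) < \<eta>"
      by (auto simp: eventually_sequentially)
    define \<sigma> where "\<sigma> = inverse (real (Suc n))"
    have \<sigma>: "\<sigma> > 0" "2 * G\<^sup>2 * ((norm y)\<^sup>2 - A \<sigma>) < \<eta>"
      using n by (auto simp: \<sigma>_def)
    define E where "E \<xi> = exp (- ((\<sigma> * \<xi>)\<^sup>2 / 2))" for \<xi>
    have E: "E \<xi> \<le> 1" "0 \<le> E \<xi>" for \<xi>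
      by (auto simp: E_def)
    \<comment> \<open>The threshold \<open>2 / \<sigma>\<close> makes \<open>1 - E \<xi>\<close> at
      least 1/2, so \<open>2 * G\<^sup>2 * (1 - E \<xi>)\<close> alone already exceeds or equals the
      global bound of the squared symbol.\<close>
    have E_half: "E \<xi> \<le> 1 / 2" if "\<bar>\<xi>\<bar> > 2 / \<sigma>" for \<xi>
    proof -
      have "2 \<le> \<bar>\<sigma> * \<xi>\<bar>"
        using that \<sigma> by (simp add: abs_mult field_simps)
      then have "4 \<le> (\<sigma> * \<xi>)\<^sup>2"
        using power_mono [of 2 "\<bar>\<sigma> * \<xi>\<bar>" 2] by simp
      then have "2 \<le> exp ((\<sigma> * \<xi>)\<^sup>2 / 2)"
        using exp_ge_add_one_self [of "(\<sigma> * \<xi>)\<^sup>2 / 2"] by linarith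
      then show ?thesis
        by (simp add: E_def exp_minus field_simps)
    qed
    \<comment> \<open>The slack \<eta> permits a closed condition, hence a compact \<open>K\<close>,
      while still excluding the spectrum, where the squared symbol is at most
      \<open>M\<^sup>2\<close>.\<close>
    define K where "K = {- (2 / \<sigma>)..2 / \<sigma>} \<inter> {\<xi>. M\<^sup>2 + \<eta> \<le> (cmod (g \<xi>))\<^sup>2}"
    have "compact K"
      unfolding K_def by (intro compact_Int_closed compact_Icc closed_Collect_le continuous_intros g_cont)
    have "\<exists>f. integrable lborel f \<and> (\<forall>z. L1_action T f z = 0) \<and> fourier f \<xi> \<noteq> 0" if "\<xi> \<in> K" for \<xi>
    proof -
      have "\<xi> \<notin> beurling_spectrum T"
      proof
        assume "\<xi> \<in> beurling_spectrum T"
        then have "(cmod (g \<xi>))\<^sup>2 \<le> M\<^sup>2"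
          by (intro power_mono M) auto
        then show False
          using that \<eta> by (simp add: K_def)
      qed
      then show ?thesis
        by (auto simp: beurling_spectrum_def)
    qed
    then obtain F where F: "\<And>\<xi>. \<xi> \<in> K \<Longrightarrow> integrable lborel (F \<xi>)"
        "\<And>\<xi> z. \<xi> \<in> K \<Longrightarrow> L1_action T (F \<xi>) z = 0" "\<And>\<xi>. \<xi> \<in> K \<Longrightarrow> fourier (F \<xi>) \<xi> \<noteq> 0"
      by metis
    have F_cont: "continuous_on UNIV (fourier (F \<xi>))" if "\<xi> \<in> K" for \<xi>
      by (rule continuous_fourier [OF F(1) [OF that]])
    obtain D where D: "D \<subseteq> K" "finite D" "K \<subseteq> (\<Union>\<xi>\<in>D. {\<zeta>. fourier (F \<xi>) \<zeta> \<noteq> 0})"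
    proof (rule compactE_image [OF \<open>compact K\<close>, of K "\<lambda>\<xi>. {\<zeta>. fourier (F \<xi>) \<zeta> \<noteq> 0}"])
      show "open {\<zeta>. fourier (F \<xi>) \<zeta> \<noteq> 0}" if "\<xi> \<in> K" for \<xi>
        by (intro open_Collect_neq F_cont that continuous_on_const)
      show "K \<subseteq> (\<Union>\<xi>\<in>K. {\<zeta>. fourier (F \<xi>) \<zeta> \<noteq> 0})"
        using F(3) by auto
    qed auto
    define s where "s \<zeta> = (\<Sum>\<xi>\<in>D. (cmod (fourier (F \<xi>) \<zeta>))\<^sup>2)" for \<zeta>
    have s_cont: "continuous_on UNIV s"
      unfolding s_def using D(1) by (intro continuous_intros F_cont) auto
    have s_nonneg: "0 \<le> s \<zeta>" for \<zeta>
      by (simp add: s_def sum_nonneg)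
    have s_pos: "0 < s \<zeta>" if \<zeta>: "\<zeta> \<in> K" for \<zeta>
    proof -
      obtain \<xi> where "\<xi> \<in> D" "fourier (F \<xi>) \<zeta> \<noteq> 0"
        using subsetD [OF D(3) \<zeta>] by auto
      then show ?thesis
        unfolding s_def using D(2) by (intro sum_pos2 [of D \<xi>]) auto
    qed
    \<comment> \<open>Compactness gives a positive minimum of \<open>s\<close>; for empty
      \<open>K\<close> the value 1 is arbitrary.\<close>
    obtain m where m: "m > 0" "\<And>\<zeta>. \<zeta> \<in> K \<Longrightarrow> m \<le> s \<zeta>"
    proof (cases "K = {}")
      case True
      then show ?thesis
        by (intro that [of 1]) auto
    next
      case False
      then obtain \<zeta> where "\<zeta> \<in> K" "\<And>\<xi>. \<xi> \<in> K \<Longrightarrow> s \<zeta> \<le> s \<xi>"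
        using continuous_attains_inf [OF \<open>compact K\<close>] continuous_on_subset [OF s_cont] by (metis subset_UNIV)
      then show ?thesis
        by (intro that [of "s \<zeta>"] s_pos)
    qed
    have pointwise: "(cmod (g \<xi>))\<^sup>2 \<le> M\<^sup>2 + \<eta> + G\<^sup>2 / m * s \<xi> + 2 * G\<^sup>2 * (1 - E \<xi>)" for \<xi>
    proof -
      have nn: "0 \<le> G\<^sup>2 / m * s \<xi>" "0 \<le> 2 * G\<^sup>2 * (1 - E \<xi>)" "0 \<le> M\<^sup>2 + \<eta>"
        using m(1) s_nonneg [of \<xi>] E [of \<xi>] \<eta> by auto
      consider "\<bar>\<xi>\<bar> > 2 / \<sigma>" | "\<xi> \<in> K" | "(cmod (g \<xi>))\<^sup>2 < M\<^sup>2 + \<eta>"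
        by (auto simp: K_def abs_le_iff not_le not_less) linarith
      then show ?thesis
      proof cases
        case 1
        then have "G\<^sup>2 * 1 \<le> G\<^sup>2 * (2 * (1 - E \<xi>))"
          using E_half [of \<xi>] by (intro mult_left_mono) auto
        then show ?thesis
          using G2 [of \<xi>] nn by linarith
      next
        case 2
        then have "G\<^sup>2 * 1 \<le> G\<^sup>2 * (s \<xi> / m)"
          using m by (intro mult_left_mono) (auto simp: field_simps)
        then have "G\<^sup>2 \<le> G\<^sup>2 / m * s \<xi>"
          by simp
        then show ?thesis
          using G2 [of \<xi>] nn by linarith
      next
        case 3
        then show ?thesis
          using nn by linarith
      qed
    qed
    have s_bounded: "\<bar>s \<xi>\<bar> \<le> (\<Sum>\<zeta>\<in>D. (LINT t|lborel. cmod (F \<zeta> t))\<^sup>2)" for \<xi>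
      using s_nonneg [of \<xi>] by (auto simp: s_def intro!: sum_mono power_mono fourier_bound)
    have int_g: "integrable lborel (\<lambda>\<xi>. q n \<xi> * (cmod (g \<xi>))\<^sup>2)" for n
      using G2 by (intro integrable_q_real [where G = "G\<^sup>2"] continuous_intros g_cont) auto
    have int_s: "integrable lborel (\<lambda>\<xi>. q n \<xi> * s \<xi>)" for n
      by (rule integrable_q_real [OF s_cont s_bounded])
    have int_E: "integrable lborel (\<lambda>\<xi>. q n \<xi> * E \<xi>)" for n
      using E by (intro integrable_q_real [where G = 1]) (auto simp: E_def intro!: continuous_intros)
    have int_F: "integrable lborel (\<lambda>\<xi>. q n \<xi> * (cmod (fourier (F \<zeta>) \<xi>))\<^sup>2)" if "\<zeta> \<in> D" for n \<zeta>
    proof (rule integrable_q_real)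
      have "\<zeta> \<in> K"
        using D(1) that by auto
      then show "continuous_on UNIV (\<lambda>\<xi>. (cmod (fourier (F \<zeta>) \<xi>))\<^sup>2)"
        by (intro continuous_on_power continuous_on_norm F_cont)
      show "\<bar>(cmod (fourier (F \<zeta>) \<xi>))\<^sup>2\<bar> \<le> (LINT t|lborel. cmod (F \<zeta> t))\<^sup>2" for \<xi>
        using power_mono [OF fourier_bound [of "F \<zeta>" \<xi>], of 2] by simp
    qed
    let ?m = "\<lambda>n. LINT \<xi>|lborel. q n \<xi>"
    let ?E = "\<lambda>n. LINT \<xi>|lborel. q n \<xi> * E \<xi>"
    let ?s = "\<lambda>n. LINT \<xi>|lborel. q n \<xi> * s \<xi>"
    have le: "(LINT \<xi>|lborel. q n \<xi> * (cmod (g \<xi>))\<^sup>2) \<le>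
        (M\<^sup>2 + \<eta>) * ?m n + G\<^sup>2 / m * ?s n + 2 * G\<^sup>2 * (?m n - ?E n)" for n
    proof -
      have "(LINT \<xi>|lborel. q n \<xi> * (cmod (g \<xi>))\<^sup>2) \<le>
          (LINT \<xi>|lborel. (M\<^sup>2 + \<eta>) * q n \<xi> + G\<^sup>2 / m * (q n \<xi> * s \<xi>) + 2 * G\<^sup>2 * (q n \<xi> - q n \<xi> * E \<xi>))"
      proof (rule integral_mono [OF int_g])
        show "integrable lborel (\<lambda>\<xi>. (M\<^sup>2 + \<eta>) * q n \<xi> + G\<^sup>2 / m * (q n \<xi> * s \<xi>) + 2 * G\<^sup>2 * (q n \<xi> - q n \<xi> * E \<xi>))"
          using int_s int_E q_int
          by (intro Bochner_Integration.integrable_add integrable_mult_right Bochner_Integration.integrable_diff)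
        show "q n \<xi> * (cmod (g \<xi>))\<^sup>2 \<le>
            (M\<^sup>2 + \<eta>) * q n \<xi> + G\<^sup>2 / m * (q n \<xi> * s \<xi>) + 2 * G\<^sup>2 * (q n \<xi> - q n \<xi> * E \<xi>)" for \<xi>
          using mult_left_mono [OF pointwise [of \<xi>] q_nonneg [of n \<xi>]] by (simp add: algebra_simps)
      qed
      also have "\<dots> = (M\<^sup>2 + \<eta>) * ?m n + G\<^sup>2 / m * ?s n + 2 * G\<^sup>2 * (?m n - ?E n)"
        using int_s int_E q_int by simp
      finally show ?thesis .
    qed
    have s_sum: "?s n = (\<Sum>\<zeta>\<in>D. LINT \<xi>|lborel. q n \<xi> * (cmod (fourier (F \<zeta>) \<xi>))\<^sup>2)" for n
      using int_F by (simp add: s_def sum_distrib_left Bochner_Integration.integral_sum)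
    have "?s \<longlonglongrightarrow> (\<Sum>\<zeta>\<in>D. (norm (L1_action T (F \<zeta>) y))\<^sup>2)"
      unfolding s_sum using D(1) F(1) by (intro tendsto_sum fourier_tendsto) auto
    also have "(\<Sum>\<zeta>\<in>D. (norm (L1_action T (F \<zeta>) y))\<^sup>2) = 0"
      using D(1) F(2) by (intro sum.neutral) auto
    finally have s_lim: "?s \<longlonglongrightarrow> 0" .
    have "(\<lambda>n. (M\<^sup>2 + \<eta>) * ?m n + G\<^sup>2 / m * ?s n + 2 * G\<^sup>2 * (?m n - ?E n)) \<longlonglongrightarrow>
        (M\<^sup>2 + \<eta>) * (norm y)\<^sup>2 + G\<^sup>2 / m * 0 + 2 * G\<^sup>2 * ((norm y)\<^sup>2 - A \<sigma>)"
      unfolding A_def E_def by (intro tendsto_intros mass_tendsto gauss_tendsto s_lim)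
    moreover have "(\<lambda>n. LINT \<xi>|lborel. q n \<xi> * (cmod (g \<xi>))\<^sup>2) \<longlonglongrightarrow> (norm (R y))\<^sup>2"
    proof -
      have "of_real (q n \<xi>) * (g \<xi> * cnj (g \<xi>)) = complex_of_real (q n \<xi> * (cmod (g \<xi>))\<^sup>2)" for n \<xi>
        by (simp add: complex_norm_square [symmetric])
      then show ?thesis
        using tendsto_Re [OF symbol_tendsto [OF sym sym]]
        by (simp only: integral_complex_of_real Re_complex_of_real cinner_norm)
    qed
    ultimately have "(norm (R y))\<^sup>2 \<le> (M\<^sup>2 + \<eta>) * (norm y)\<^sup>2 + G\<^sup>2 / m * 0 + 2 * G\<^sup>2 * ((norm y)\<^sup>2 - A \<sigma>)"
      using le by (intro LIMSEQ_le) auto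
    then show ?thesis
      using \<sigma>(2) by simp
  qed
  have "(norm (R y))\<^sup>2 \<le> M\<^sup>2 * (norm y)\<^sup>2 + e" if "e > 0" for e
  proof -
    define \<eta> where "\<eta> = e / ((norm y)\<^sup>2 + 1)"
    have pos: "0 < (norm y)\<^sup>2 + 1"
      by (intro add_nonneg_pos) auto
    have "(norm (R y))\<^sup>2 \<le> (M\<^sup>2 + \<eta>) * (norm y)\<^sup>2 + \<eta>"
      using that pos by (intro approx) (simp add: \<eta>_def)
    also have "\<dots> = M\<^sup>2 * (norm y)\<^sup>2 + \<eta> * ((norm y)\<^sup>2 + 1)"
      by (simp add: algebra_simps)
    finally show ?thesis
      using pos by (simp add: \<eta>_def)
  qed
  then have "(norm (R y))\<^sup>2 \<le> (M * norm y)\<^sup>2"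
    unfolding power_mult_distrib by (rule field_le_epsilon)
  then show ?thesis
    by (rule power2_le_imp_le) (use M0 in simp)
qed

section \<open>Cosine and sine expansions\<close>

text \<open>Vanishing cosine moments make \<open>W\<close> orthogonal to all polynomials in
  \<open>cos \<theta>\<close>. By Weierstrass, applied to \<open>W (arccos x)\<close>, these
  approximate \<open>W\<close> uniformly, so \<open>W\<close> is orthogonal to itself.\<close>

lemma cosine_moments_zero:
  fixes W :: "real \<Rightarrow> real"
  assumes W: "continuous_on {0..pi} W"
    and moments: "\<And>m :: nat. ((\<lambda>\<theta>. W \<theta> * cos (m * \<theta>)) has_integral 0) {0..pi}"
    and \<theta>: "\<theta> \<in> {0..pi}"
  shows "W \<theta> = 0"
proof -
  \<comment> \<open>The additional factor \<open>cos (real m * \<theta>)\<close> makes the induction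
    close: one more \<open>cos \<theta>\<close> moves \<open>m\<close> up and down by one, and for
    \<open>m = 0\<close> only to 1.\<close>
  have pow: "((\<lambda>\<theta>. W \<theta> * cos \<theta> ^ i * cos (real m * \<theta>)) has_integral 0) {0..pi}" for i m
  proof (induction i arbitrary: m)
    case 0
    then show ?case
      using moments [of m] by simp
  next
    case (Suc i)
    show ?case
    proof (cases m)
      case 0
      then show ?thesis
        using Suc [of 1] by (simp add: mult_ac)
    next
      case (Suc k)
      have "cos \<theta> * cos (real m * \<theta>) = (cos (real (m + 1) * \<theta>) + cos (real k * \<theta>)) / 2" for \<theta>
        using cos_times_cos [of "real m * \<theta>" \<theta>] Suc by (simp add: algebra_simps)
      then have "W \<theta> * cos \<theta> ^ Suc i * cos (real m * \<theta>) =
          1 / 2 * (W \<theta> * cos \<theta> ^ i * cos (real (m + 1) * \<theta>)) +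
          1 / 2 * (W \<theta> * cos \<theta> ^ i * cos (real k * \<theta>))" for \<theta>
        by (simp add: mult_ac distrib_left [symmetric] add_divide_distrib [symmetric])
      then show ?thesis
        using has_integral_add [OF has_integral_mult_right [OF Suc.IH [of "m + 1"], of "1 / 2"]
            has_integral_mult_right [OF Suc.IH [of k], of "1 / 2"]] by simp
    qed
  qed
  have W_sq: "integral {0..pi} (\<lambda>\<theta>. (W \<theta>)\<^sup>2) \<le> e" if e: "e > 0" for e
  proof -
    have W_int: "(\<lambda>\<theta>. \<bar>W \<theta>\<bar>) integrable_on {0..pi}"
      by (intro integrable_continuous_real continuous_intros W)
    define I where "I = integral {0..pi} (\<lambda>\<theta>. \<bar>W \<theta>\<bar>)"
    have I: "I \<ge> 0"
      unfolding I_def by (intro Henstock_Kurzweil_Integration.integral_nonneg W_int) auto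
    have "continuous_on {-1..1} (\<lambda>x. W (arccos x))"
      by (intro continuous_on_compose2 [OF W] continuous_on_arccos' image_subsetI)
        (auto intro: arccos_lbound arccos_ubound)
    then obtain g where g: "real_polynomial_function g"
        "\<And>x. x \<in> {-1..1} \<Longrightarrow> \<bar>W (arccos x) - g x\<bar> < e / (I + 1)"
      using Stone_Weierstrass_real_polynomial_function [of "{-1..1}" "\<lambda>x. W (arccos x)" "e / (I + 1)"] e I
      by auto
    have close: "\<bar>W \<theta> - g (cos \<theta>)\<bar> \<le> e / (I + 1)" if "\<theta> \<in> {0..pi}" for \<theta>
      using g(2) [of "cos \<theta>"] that by (simp add: arccos_cos less_imp_le)
    obtain a n where g_sum: "g = (\<lambda>x. \<Sum>i\<le>n. a i * x ^ i)"
      using g(1) real_polynomial_function_iff_sum by auto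
    have "((\<lambda>\<theta>. \<Sum>i\<le>(n::nat). a i * (W \<theta> * cos \<theta> ^ i * cos (real 0 * \<theta>))) has_integral (\<Sum>i\<le>n. a i * 0)) {0..pi}"
      by (intro has_integral_sum has_integral_mult_right pow) auto
    then have ortho: "((\<lambda>\<theta>. W \<theta> * g (cos \<theta>)) has_integral 0) {0..pi}"
      by (simp add: g_sum sum_distrib_left mult_ac)
    have g_cont: "continuous_on {0..pi} (\<lambda>\<theta>. g (cos \<theta>))"
      unfolding g_sum by (intro continuous_intros)
    have "integral {0..pi} (\<lambda>\<theta>. (W \<theta>)\<^sup>2) = integral {0..pi} (\<lambda>\<theta>. W \<theta> * (W \<theta> - g (cos \<theta>)) + W \<theta> * g (cos \<theta>))"
      by (intro Henstock_Kurzweil_Integration.integral_cong) (simp add: power2_eq_square algebra_simps)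
    also have "\<dots> = integral {0..pi} (\<lambda>\<theta>. W \<theta> * (W \<theta> - g (cos \<theta>))) + 0"
      using ortho by (subst Henstock_Kurzweil_Integration.integral_add)
        (auto intro!: integrable_continuous_real continuous_intros W g_cont simp: integral_unique)
    also have "\<dots> \<le> integral {0..pi} (\<lambda>\<theta>. e / (I + 1) * \<bar>W \<theta>\<bar>)"
      unfolding add_0_right
    proof (rule integral_le)
      show "W \<theta> * (W \<theta> - g (cos \<theta>)) \<le> e / (I + 1) * \<bar>W \<theta>\<bar>" if "\<theta> \<in> {0..pi}" for \<theta>
      proof -
        have "W \<theta> * (W \<theta> - g (cos \<theta>)) \<le> \<bar>W \<theta>\<bar> * \<bar>W \<theta> - g (cos \<theta>)\<bar>"
          by (metis abs_ge_self abs_mult)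
        also have "\<dots> \<le> \<bar>W \<theta>\<bar> * (e / (I + 1))"
          by (intro mult_left_mono close that) auto
        finally show ?thesis
          by (simp add: mult.commute)
      qed
    qed (use I in \<open>auto intro!: integrable_continuous_real continuous_intros W g_cont\<close>)
    also have "\<dots> = e / (I + 1) * I"
      by (simp add: I_def)
    also have "\<dots> \<le> e"
      using e I by (simp add: field_simps)
    finally show ?thesis .
  qed
  have "integral {0..pi} (\<lambda>\<theta>. (W \<theta>)\<^sup>2) \<le> 0"
    using W_sq by (intro field_le_epsilon [where y = 0]) simp
  moreover have "0 \<le> integral {0..pi} (\<lambda>\<theta>. (W \<theta>)\<^sup>2)"
    by (intro Henstock_Kurzweil_Integration.integral_nonneg integrable_continuous_real continuous_intros W) simp
  ultimately have "integral {0..pi} (\<lambda>\<theta>. (W \<theta>)\<^sup>2) = 0"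
    by simp
  moreover have "continuous_on {0..pi} (\<lambda>\<theta>. (W \<theta>)\<^sup>2)"
    by (intro continuous_intros W)
  ultimately show ?thesis
    using \<theta> integral_eq_0_iff [of 0 pi "\<lambda>\<theta>. (W \<theta>)\<^sup>2"] by auto
qed

definition cos_integral :: "real \<Rightarrow> real" where
  "cos_integral a = (if a = 0 then pi else sin (a * pi) / a)"

lemma has_integral_cos: "((\<lambda>\<theta>. cos (a * \<theta>)) has_integral cos_integral a) {0..pi}"
proof (cases "a = 0")
  case True
  then show ?thesis
    using has_integral_const_real [of "1 :: real" 0 pi] by (simp add: cos_integral_def)
next
  case False
  have "((\<lambda>\<theta>. cos (a * \<theta>)) has_integral (sin (a * pi) / a - sin (a * 0) / a)) {0..pi}"
    using False by (intro fundamental_theorem_of_calculus)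
      (auto intro!: derivative_eq_intros simp flip: has_real_derivative_iff_has_vector_derivative)
  then show ?thesis
    using False by (simp add: cos_integral_def)
qed

lemma has_integral_cos_cos:
  "((\<lambda>\<theta>. cos (a * \<theta>) * cos (b * \<theta>)) has_integral (cos_integral (a + b) + cos_integral (a - b)) / 2) {0..pi}"
proof -
  have eq: "cos (a * \<theta>) * cos (b * \<theta>) = (cos ((a - b) * \<theta>) + cos ((a + b) * \<theta>)) / 2" for \<theta>
    unfolding cos_times_cos by (simp add: algebra_simps)
  show ?thesis
    unfolding eq
    using has_integral_divide [OF has_integral_add [OF has_integral_cos [of "a - b"] has_integral_cos [of "a + b"]], of 2]
    by (simp add: add.commute)
qed

lemma cos_integral_int: "cos_integral (of_int k) = (if k = 0 then pi else 0)"
  by (auto simp: cos_integral_def sin_zero_iff_int2)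

lemma has_integral_cos_cos_nat:
  fixes j m :: nat
  shows "((\<lambda>\<theta>. cos (j * \<theta>) * cos (m * \<theta>)) has_integral
    (if j = m then if m = 0 then pi else pi / 2 else 0)) {0..pi}"
  using has_integral_cos_cos [of j m] cos_integral_int [of "int j + int m"] cos_integral_int [of "int j - int m"]
  by (auto split: if_splits)

text \<open>
  Up to sign, these are the coefficients of \<open>cos (t x)\<close> and \<open>sin (t x)\<close> on \<open>[-1, 1]\<close> with respect to
  \<open>cos (pi (k + 1) x)\<close> and \<open>sin (pi (k + 1 / 2) x)\<close>; the index is shifted to start at \<open>0\<close>.
\<close>

definition kcos :: "real \<Rightarrow> nat \<Rightarrow> real" where
  "kcos t k = 2 * t * sin t / ((pi * (real k + 1))\<^sup>2 - t\<^sup>2)"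

definition ksin :: "real \<Rightarrow> nat \<Rightarrow> real" where
  "ksin t k = 2 * t * cos t / ((pi * (real k + 1 / 2))\<^sup>2 - t\<^sup>2)"


lemma kcos_denominator_ge:
  assumes "\<bar>t\<bar> < pi"
  shows "(pi\<^sup>2 - t\<^sup>2) * (real k + 1)\<^sup>2 \<le> (pi * (real k + 1))\<^sup>2 - t\<^sup>2" and "0 < pi\<^sup>2 - t\<^sup>2"
    and "0 < (pi * (real k + 1))\<^sup>2 - t\<^sup>2"
proof -
  have "t\<^sup>2 * 1 \<le> t\<^sup>2 * (real k + 1)\<^sup>2"
    by (intro mult_left_mono) auto
  then show le: "(pi\<^sup>2 - t\<^sup>2) * (real k + 1)\<^sup>2 \<le> (pi * (real k + 1))\<^sup>2 - t\<^sup>2"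
    unfolding power_mult_distrib left_diff_distrib by simp
  show pos: "0 < pi\<^sup>2 - t\<^sup>2"
    using power_strict_mono [of "\<bar>t\<bar>" pi 2] assms by simp
  show "0 < (pi * (real k + 1))\<^sup>2 - t\<^sup>2"
    by (rule less_le_trans [OF _ le]) (use pos in simp)
qed

lemma kcos_summable:
  assumes "\<bar>t\<bar> < pi"
  shows "summable (\<lambda>k. \<bar>kcos t k\<bar>)"
proof (rule summable_comparison_test')
  let ?C = "\<bar>2 * t * sin t\<bar> / (pi\<^sup>2 - t\<^sup>2)"
  have "summable (\<lambda>k. inverse (real (Suc k) ^ 2))"
    by (subst summable_Suc_iff) (rule inverse_power_summable, simp)
  then show "summable (\<lambda>k. ?C * inverse (real (Suc k) ^ 2))"
    by (rule summable_mult)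
  show "norm \<bar>kcos t k\<bar> \<le> ?C * inverse (real (Suc k) ^ 2)" if "0 \<le> k" for k
  proof -
    have "\<bar>kcos t k\<bar> = \<bar>2 * t * sin t\<bar> / ((pi * (real k + 1))\<^sup>2 - t\<^sup>2)"
      using kcos_denominator_ge(3) [OF assms, of k] by (simp add: kcos_def abs_divide)
    also have "\<dots> \<le> \<bar>2 * t * sin t\<bar> / ((pi\<^sup>2 - t\<^sup>2) * (real k + 1)\<^sup>2)"
      using kcos_denominator_ge(1,3) [OF assms, of k] kcos_denominator_ge(2) [OF assms]
      by (intro divide_left_mono mult_pos_pos) auto
    finally show ?thesis
      by (simp add: field_simps)
  qed
qed

text \<open>By \<open>has_integral_cos_cos\<close> the left side is a cosine moment of
  \<open>cos (t / pi * \<theta>)\<close>. For \<open>m = 0\<close> it gives the mean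
  \<open>sin t / t\<close>; otherwise the partial fractions in \<open>t / pi + m\<close> and
  \<open>t / pi - m\<close> combine into the denominator of \<open>kcos\<close>, whose index is
  \<open>m - 1\<close>.\<close>

lemma kcos_moment:
  fixes t :: real and m :: nat
  assumes t: "0 < t" "t < pi"
  shows "(cos_integral (t / pi + m) + cos_integral (t / pi - m)) / 2 =
    (if m = 0 then pi * (sin t / t) else (-1) ^ (m - 1) * kcos t (m - 1) * (pi / 2))"
proof (cases m)
  case 0
  then show ?thesis
    using t by (simp add: cos_integral_def)
next
  case (Suc j)
  define s where "s = t / pi"
  have s: "0 < s" "s < 1" "t = s * pi"
    using t by (auto simp: s_def)
  have ne: "s + real m \<noteq> 0" "s - real m \<noteq> 0" "(real m)\<^sup>2 - s\<^sup>2 \<noteq> 0"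
  proof -
    show "s + real m \<noteq> 0" "s - real m \<noteq> 0"
      using s Suc by auto
    then show "(real m)\<^sup>2 - s\<^sup>2 \<noteq> 0"
      by (simp add: power2_eq_square square_diff_square_factored)
  qed
  have "sin (t + real m * pi) = (-1) ^ m * sin t" "sin (t - real m * pi) = (-1) ^ m * sin t"
    by (simp_all add: sin_add sin_diff)
  then have sin: "sin ((s + real m) * pi) = (-1) ^ m * sin t" "sin ((s - real m) * pi) = (-1) ^ m * sin t"
    by (simp_all add: s(3) algebra_simps)
  have "(cos_integral (s + m) + cos_integral (s - m)) / 2 =
      (-1) ^ m * sin t * (1 / (s + m) + 1 / (s - m)) / 2"
  proof -
    have "cos_integral (s + m) = (-1) ^ m * sin t / (s + m)" "cos_integral (s - m) = (-1) ^ m * sin t / (s - m)"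
      using ne by (simp_all only: cos_integral_def if_False sin)
    then show ?thesis
      by (simp only:) (simp add: distrib_left)
  qed
  also have "1 / (s + m) + 1 / (s - m) = - (2 * s / ((real m)\<^sup>2 - s\<^sup>2))"
  proof -
    have "(real m)\<^sup>2 - s\<^sup>2 = - ((s + m) * (s - m))"
      by (simp add: power2_eq_square algebra_simps)
    moreover have "1 / (s + m) + 1 / (s - m) = 2 * s / ((s + m) * (s - m))"
      using ne(1,2) by (subst add_frac_eq) simp_all
    ultimately show ?thesis
      by simp
  qed
  also have "(-1) ^ m * sin t * (- (2 * s / ((real m)\<^sup>2 - s\<^sup>2))) / 2 = (-1) ^ j * (sin t * s / ((real m)\<^sup>2 - s\<^sup>2))"
  proof -
    have "(-1) ^ m * sin t * (- (2 * s / d)) / 2 = (-1) ^ j * (sin t * s / d)" for d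
      by (simp add: Suc)
    then show ?thesis .
  qed
  also have "sin t * s / ((real m)\<^sup>2 - s\<^sup>2) = kcos t j * (pi / 2)"
  proof -
    have "(pi * (real j + 1))\<^sup>2 - t\<^sup>2 = pi\<^sup>2 * ((real m)\<^sup>2 - s\<^sup>2)"
      by (simp add: Suc s(3) power_mult_distrib right_diff_distrib add.commute mult.commute)
    then show ?thesis
      using ne by (simp add: kcos_def s(3) field_simps power2_eq_square)
  qed
  finally show ?thesis
    using Suc by (simp add: s_def)
qed

text \<open>The Weierstrass test gives a continuous sum \<open>S\<close>. It has the same cosine
  moments as the target on \<open>[0, pi]\<close>, so the two coincide there by
  \<open>cosine_moments_zero\<close>; evenness of both settles negative \<xi>.\<close>

lemma cosine_expansion:
  assumes t: "0 < t" "t < pi"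
  shows "uniform_limit {-1..1} (\<lambda>N \<xi>. sin t / t + (\<Sum>k<N. (-1) ^ k * kcos t k * cos (pi * (real k + 1) * \<xi>)))
    (\<lambda>\<xi>. cos (t * \<xi>)) sequentially"
proof -
  define u where "u k \<theta> = (-1) ^ k * kcos t k * cos ((real k + 1) * \<theta>)" for k \<theta>
  define S where "S \<theta> = sin t / t + (\<Sum>k. u k \<theta>)" for \<theta>
  define P where "P N \<theta> = sin t / t + (\<Sum>k<N. u k \<theta>)" for N \<theta>
  have "uniform_limit UNIV (\<lambda>N \<theta>. \<Sum>k<N. u k \<theta>) (\<lambda>\<theta>. \<Sum>k. u k \<theta>) sequentially"
  proof (rule Weierstrass_m_test)
    show "norm (u k \<theta>) \<le> \<bar>kcos t k\<bar>" for k \<theta>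
      by (simp add: u_def abs_mult power_abs mult_left_le)
    show "summable (\<lambda>k. \<bar>kcos t k\<bar>)"
      using t by (intro kcos_summable) auto
  qed
  then have unif: "uniform_limit UNIV P S sequentially"
    unfolding P_def S_def by (intro uniform_limit_add uniform_limit_const)
  have P_cont: "continuous_on A (P N)" for A N
    unfolding P_def u_def by (intro continuous_intros)
  have "continuous_on UNIV S"
    by (rule uniform_limit_theorem [OF _ unif]) (simp_all add: P_cont)
  then have S_cont: "continuous_on A S" for A
    by (rule continuous_on_subset) simp
  have S_eq: "cos (t / pi * \<theta>) = S \<theta>" if "\<theta> \<in> {0..pi}" for \<theta>
  proof -
    have "((\<lambda>\<theta>. (cos (t / pi * \<theta>) - S \<theta>) * cos (real m * \<theta>)) has_integral 0) {0..pi}" for m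
    proof -
      let ?v = "(if m = 0 then pi * (sin t / t) else (-1) ^ (m - 1) * kcos t (m - 1) * (pi / 2))"
      \<comment> \<open>By orthogonality at most one term contributes, so the \<open>m\<close>-th
        moment of the partial sums is constant once \<open>N\<close> reaches \<open>m\<close>, and
        uniform convergence carries it over to \<open>S\<close>.\<close>
      have P_int: "((\<lambda>\<theta>. P N \<theta> * cos (real m * \<theta>)) has_integral ?v) {0..pi}" if "N \<ge> m" for N
      proof -
        have "((\<lambda>\<theta>. sin t / t * (cos (real 0 * \<theta>) * cos (real m * \<theta>)) +
            (\<Sum>k<N. (-1) ^ k * kcos t k * (cos (real (k + 1) * \<theta>) * cos (real m * \<theta>)))) has_integral
            (sin t / t * (if 0 = m then if m = 0 then pi else pi / 2 else 0) +
            (\<Sum>k<N. (-1) ^ k * kcos t k * (if k + 1 = m then if m = 0 then pi else pi / 2 else 0)))) {0..pi}"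
          by (intro has_integral_add has_integral_mult_right has_integral_sum has_integral_cos_cos_nat) auto
        moreover have "(\<Sum>k<N. (-1) ^ k * kcos t k * (if k + 1 = m then if m = 0 then pi else pi / 2 else 0)) =
            (if m = 0 then 0 else (-1) ^ (m - 1) * kcos t (m - 1) * (pi / 2))"
        proof (cases m)
          case (Suc j)
          then have "(\<Sum>k<N. (-1) ^ k * kcos t k * (if k + 1 = m then if m = 0 then pi else pi / 2 else 0)) =
              (\<Sum>k<N. if k = j then (-1) ^ j * kcos t j * (pi / 2) else 0)"
            by (intro sum.cong) auto
          then show ?thesis
            using that Suc by simp
        qed simp
        moreover have "P N \<theta> * cos (real m * \<theta>) = sin t / t * (cos (real 0 * \<theta>) * cos (real m * \<theta>)) +
            (\<Sum>k<N. (-1) ^ k * kcos t k * (cos (real (k + 1) * \<theta>) * cos (real m * \<theta>)))" for \<theta>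
          by (simp add: P_def u_def distrib_left [where b = "sin t / t"] sum_distrib_left mult_ac add.commute)
        ultimately show ?thesis
          by (auto simp: mult_ac split: if_splits)
      qed
      have "uniform_limit {0..pi} (\<lambda>N \<theta>. P N \<theta> * cos (real m * \<theta>)) (\<lambda>\<theta>. S \<theta> * cos (real m * \<theta>)) sequentially"
      proof (rule uniform_limitI)
        fix e :: real
        assume "0 < e"
        then have "\<forall>\<^sub>F N in sequentially. \<forall>\<theta>\<in>UNIV. dist (P N \<theta>) (S \<theta>) < e"
          by (rule uniform_limitD [OF unif])
        then show "\<forall>\<^sub>F N in sequentially. \<forall>\<theta>\<in>{0..pi}. dist (P N \<theta> * cos (real m * \<theta>)) (S \<theta> * cos (real m * \<theta>)) < e"
        proof eventually_elim
          case (elim N)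
          have "dist (P N \<theta> * cos (real m * \<theta>)) (S \<theta> * cos (real m * \<theta>)) \<le> dist (P N \<theta>) (S \<theta>)" for \<theta>
            by (simp add: dist_real_def abs_mult mult_left_le flip: left_diff_distrib)
          with elim show ?case
            by (meson UNIV_I le_less_trans)
        qed
      qed
      then obtain I J where I: "\<And>N. ((\<lambda>\<theta>. P N \<theta> * cos (real m * \<theta>)) has_integral I N) {0..pi}"
          and J: "((\<lambda>\<theta>. S \<theta> * cos (real m * \<theta>)) has_integral J) {0..pi}" and lim: "I \<longlonglongrightarrow> J"
        by (rule uniform_limit_integral) (auto intro!: continuous_intros P_cont)
      have "I N = ?v" if "N \<ge> m" for N
        by (rule has_integral_unique [OF I P_int [OF that]])
      then have "I \<longlonglongrightarrow> ?v"
        by (intro tendsto_eventually eventually_sequentiallyI)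
      then have "J = ?v"
        by (rule LIMSEQ_unique [OF lim])
      with J have "((\<lambda>\<theta>. S \<theta> * cos (real m * \<theta>)) has_integral ?v) {0..pi}"
        by simp
      moreover have "((\<lambda>\<theta>. cos (t / pi * \<theta>) * cos (real m * \<theta>)) has_integral ?v) {0..pi}"
        using has_integral_cos_cos [of "t / pi" "real m"] unfolding kcos_moment [OF t] .
      ultimately show ?thesis
        unfolding left_diff_distrib using has_integral_diff [of _ ?v _ _ ?v] by simp
    qed
    then have "cos (t / pi * \<theta>) - S \<theta> = 0"
      using that by (intro cosine_moments_zero [of "\<lambda>\<theta>. cos (t / pi * \<theta>) - S \<theta>"])
        (auto intro!: continuous_intros S_cont)
    then show ?thesis
      by simp
  qed
  have S_even: "S (- \<theta>) = S \<theta>" for \<theta>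
    by (simp add: S_def u_def)
  have S_xi: "S (pi * \<xi>) = cos (t * \<xi>)" if "\<xi> \<in> {-1..1}" for \<xi>
  proof -
    have "pi * \<bar>\<xi>\<bar> \<in> {0..pi}"
      using that by (auto simp: abs_le_iff)
    then have "cos (t / pi * (pi * \<bar>\<xi>\<bar>)) = S (pi * \<bar>\<xi>\<bar>)"
      by (rule S_eq)
    then show ?thesis
      using S_even [of "pi * \<xi>"] by (auto simp: abs_if split: if_splits)
  qed
  show ?thesis
  proof (rule uniform_limitI)
    fix e :: real
    assume "0 < e"
    then have "\<forall>\<^sub>F N in sequentially. \<forall>\<theta>\<in>UNIV. dist (P N \<theta>) (S \<theta>) < e"
      by (rule uniform_limitD [OF unif])
    then show "\<forall>\<^sub>F N in sequentially. \<forall>\<xi>\<in>{-1..1}. dist (sin t / t +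
        (\<Sum>k<N. (-1) ^ k * kcos t k * cos (pi * (real k + 1) * \<xi>))) (cos (t * \<xi>)) < e"
    proof eventually_elim
      case (elim N)
      show ?case
      proof
        fix \<xi> :: real
        assume "\<xi> \<in> {-1..1}"
        then show "dist (sin t / t + (\<Sum>k<N. (-1) ^ k * kcos t k * cos (pi * (real k + 1) * \<xi>))) (cos (t * \<xi>)) < e"
          using bspec [OF elim, of "pi * \<xi>"] S_xi [of \<xi>] by (simp add: P_def u_def mult_ac)
      qed
    qed
  qed
qed

lemma cos_diff_reflect: "cos (a * ((1 - x) / 2)) - cos (a * (1 - (1 - x) / 2)) = 2 * sin (a / 2) * sin (a / 2 * (x :: real))"
proof -
  have "cos (a * ((1 - x) / 2)) - cos (a * (1 - (1 - x) / 2)) =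
      2 * sin ((a * ((1 - x) / 2) + a * (1 - (1 - x) / 2)) / 2) * sin ((a * (1 - (1 - x) / 2) - a * ((1 - x) / 2)) / 2)"
    by (rule cos_diff_cos)
  also have "(a * ((1 - x) / 2) + a * (1 - (1 - x) / 2)) / 2 = a / 2"
    by (simp add: field_simps)
  also have "(a * (1 - (1 - x) / 2) - a * ((1 - x) / 2)) / 2 = a / 2 * x"
    by (simp add: field_simps)
  finally show ?thesis .
qed

text \<open>Only terms of even index in the cosine series for \<open>2 * t\<close> survive the
  reflection. The factor \<open>sin t\<close> split off here cancels against the one that
  \<open>cos_diff_reflect\<close> produces on the other side.\<close>

lemma ksin_eq_kcos: "kcos (2 * t) (2 * j) = sin t * ksin t j"
proof -
  have denom: "(pi * (real (2 * j) + 1))\<^sup>2 - (2 * t)\<^sup>2 = 4 * ((pi * (real j + 1 / 2))\<^sup>2 - t\<^sup>2)"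
    by (simp add: power2_eq_square algebra_simps)
  have num: "2 * (2 * t) * sin (2 * t) = 4 * (sin t * (2 * t * cos t))"
    by (simp add: sin_double)
  have "4 * a / (4 * b) = a / b" for a b :: real
    by simp
  then show ?thesis
    unfolding kcos_def ksin_def denom num by (simp only: times_divide_eq_right)
qed

text \<open>Reflecting \<open>\<zeta> = (1 - x) / 2\<close> in the cosine expansion with parameter \<open>2 t\<close> turns it into the sine expansion.\<close>

lemma sine_expansion:
  assumes t: "0 < t" "t < pi / 2"
  shows "uniform_limit {-1..1} (\<lambda>N \<xi>. \<Sum>k<N. (-1) ^ k * ksin t k * sin (pi * (real k + 1 / 2) * \<xi>))
    (\<lambda>\<xi>. sin (t * \<xi>)) sequentially"
proof -
  have sin_pos: "0 < sin t"
    using t by (intro sin_gt_zero) auto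
  define P where "P N \<zeta> = sin (2 * t) / (2 * t) +
      (\<Sum>k<N. (-1) ^ k * kcos (2 * t) k * cos (pi * (real k + 1) * \<zeta>))" for N \<zeta>
  have P_diff: "P (2 * N) ((1 - x) / 2) - P (2 * N) (1 - (1 - x) / 2) =
      2 * sin t * (\<Sum>k<N. (-1) ^ k * ksin t k * sin (pi * (real k + 1 / 2) * x))" for N x
  proof -
    have "P (2 * N) ((1 - x) / 2) - P (2 * N) (1 - (1 - x) / 2) =
        (\<Sum>k<2 * N. (-1) ^ k * kcos (2 * t) k *
          (2 * sin (pi * (real k + 1) / 2) * sin (pi * (real k + 1) / 2 * x)))"
      unfolding P_def add_diff_cancel_left sum_subtractf [symmetric]
      by (simp only: cos_diff_reflect flip: right_diff_distrib)
    also have "\<dots> = 2 * sin t * (\<Sum>k<N. (-1) ^ k * ksin t k * sin (pi * (real k + 1 / 2) * x))"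
      (is "sum ?f {..<2 * N} = _")
    proof (induction N)
      case (Suc N)
      \<comment> \<open>An odd index means an even multiple of pi as frequency, because of the index
        shift; such a cosine is invariant under the reflection and drops out of the
        difference.\<close>
      have "sin (pi * (real (Suc (2 * N)) + 1) / 2) = 0"
        using sin_npi [of "Suc N"] by (simp add: algebra_simps add_divide_distrib)
      moreover have "sin (pi * (real (2 * N) + 1) / 2) = (-1) ^ N"
      proof -
        have "pi * (real (2 * N) + 1) / 2 = pi / 2 + real N * pi"
          by (simp add: field_simps)
        then have "sin (pi * (real (2 * N) + 1) / 2) = sin (pi / 2 + real N * pi)"
          by (simp only:)
        then show ?thesis
          by (simp add: sin_add)
      qed
      moreover have "pi * (real (2 * N) + 1) / 2 = pi * (real N + 1 / 2)"
        by (simp add: field_simps)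
      ultimately have "?f (2 * N) = 2 * sin t * ((-1) ^ N * ksin t N * sin (pi * (real N + 1 / 2) * x))"
          "?f (Suc (2 * N)) = 0"
        by (simp_all only: ksin_eq_kcos) (simp_all add: power_mult_distrib [symmetric])
      moreover have "sum ?f {..<2 * Suc N} = sum ?f {..<2 * N} + ?f (2 * N) + ?f (Suc (2 * N))"
        by simp
      ultimately show ?case
        by (simp only: Suc.IH sum.lessThan_Suc distrib_left [of "2 * sin t"] add_0_right)
    qed simp
    finally show ?thesis .
  qed
  show ?thesis
  proof (rule uniform_limitI)
    fix e :: real
    assume e: "0 < e"
    have "uniform_limit {-1..1} P (\<lambda>\<xi>. cos (2 * t * \<xi>)) sequentially"
      unfolding P_def using t by (intro cosine_expansion) auto
    \<comment> \<open>Two evaluations contribute an error \<open>e * sin t\<close> each, and the sum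
      is finally divided by \<open>2 * sin t\<close>.\<close>
    then have "\<forall>\<^sub>F N in sequentially. \<forall>\<zeta>\<in>{-1..1}. dist (P N \<zeta>) (cos (2 * t * \<zeta>)) < e * sin t"
      by (rule uniform_limitD) (use e sin_pos in simp)
    moreover have "filterlim (\<lambda>N :: nat. 2 * N) sequentially sequentially"
      by (rule filterlim_subseq) (simp add: strict_mono_def)
    ultimately have "\<forall>\<^sub>F N in sequentially. \<forall>\<zeta>\<in>{-1..1}. dist (P (2 * N) \<zeta>) (cos (2 * t * \<zeta>)) < e * sin t"
      by (rule eventually_compose_filterlim)
    then show "\<forall>\<^sub>F N in sequentially. \<forall>x\<in>{-1..1}.
        dist (\<Sum>k<N. (-1) ^ k * ksin t k * sin (pi * (real k + 1 / 2) * x)) (sin (t * x)) < e"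
    proof eventually_elim
      case (elim N)
      show ?case
      proof
        fix x :: real
        assume x: "x \<in> {-1..1}"
        let ?\<zeta> = "(1 - x) / 2" and ?Q = "\<Sum>k<N. (-1) ^ k * ksin t k * sin (pi * (real k + 1 / 2) * x)"
        have "\<bar>P (2 * N) ?\<zeta> - cos (2 * t * ?\<zeta>)\<bar> < e * sin t"
          "\<bar>P (2 * N) (1 - ?\<zeta>) - cos (2 * t * (1 - ?\<zeta>))\<bar> < e * sin t"
          using x by (auto intro!: bspec [OF elim, unfolded dist_real_def] simp del: times_divide_eq_right)
        then have "\<bar>(P (2 * N) ?\<zeta> - P (2 * N) (1 - ?\<zeta>)) - (cos (2 * t * ?\<zeta>) - cos (2 * t * (1 - ?\<zeta>)))\<bar> < 2 * (e * sin t)"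
          by linarith
        then have "\<bar>2 * sin t * ?Q - 2 * sin t * sin (t * x)\<bar> < 2 * (e * sin t)"
          unfolding P_diff cos_diff_reflect by simp
        also have "2 * sin t * ?Q - 2 * sin t * sin (t * x) = 2 * sin t * (?Q - sin (t * x))"
          by (simp only: right_diff_distrib)
        finally show "dist ?Q (sin (t * x)) < e"
          using sin_pos by (simp add: dist_real_def abs_mult mult.commute)
      qed
    qed
  qed
qed

text \<open>The case \<open>t = 0\<close> is separate because \<open>sin 0 / 0 = 0\<close> would give the value \<open>1\<close>.\<close>

definition kcos0 :: "real \<Rightarrow> real" where
  "kcos0 t = (if t = 0 then 0 else 1 - sin t / t)"

section \<open>Signs, sums and monotonicity of the coefficients\<close>

lemma kcos_nonneg: "0 \<le> t \<Longrightarrow> t < pi \<Longrightarrow> 0 \<le> kcos t k"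
  unfolding kcos_def using kcos_denominator_ge(3) [of t k] sin_ge_zero [of t]
  by (intro divide_nonneg_pos mult_nonneg_nonneg) auto

lemma ksin_denominator_pos:
  assumes "0 \<le> t" "t < pi / 2"
  shows "0 < (pi * (real k + 1 / 2))\<^sup>2 - t\<^sup>2"
proof -
  have "pi / 2 \<le> pi * (real k + 1 / 2)"
    by (simp add: field_simps)
  then have "t < pi * (real k + 1 / 2)"
    using assms by linarith
  then show ?thesis
    using assms power_strict_mono [of t "pi * (real k + 1 / 2)" 2] by simp
qed

lemma ksin_nonneg: "0 \<le> t \<Longrightarrow> t < pi / 2 \<Longrightarrow> 0 \<le> ksin t k"
  unfolding ksin_def using ksin_denominator_pos [of t k] cos_ge_zero [of t]
  by (intro divide_nonneg_pos mult_nonneg_nonneg) auto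

text \<open>At the endpoint \<open>\<xi> = 1\<close> the signs \<open>(-1) ^ k\<close> and
  \<open>cos (pi * (real k + 1))\<close> multiply to -1 for every \<open>k\<close>. The expansion
  therefore adds up the coefficients themselves, and their partial sums increase to the
  limit.\<close>

lemma kcos_sum_le:
  assumes "0 \<le> t" "t < pi"
  shows "kcos0 t + (\<Sum>k<N. kcos t k) \<le> 1 - cos t"
proof (cases "t = 0")
  case True
  then show ?thesis
    by (simp add: kcos0_def kcos_def)
next
  case False
  have "(\<lambda>N. sin t / t + (\<Sum>k<N. (-1) ^ k * kcos t k * cos (pi * (real k + 1) * 1))) \<longlonglongrightarrow> cos (t * 1)"
    using assms False by (intro tendsto_uniform_limitI [OF cosine_expansion]) auto
  moreover have "(-1) ^ k * kcos t k * cos (pi * (real k + 1) * 1) = - kcos t k" for k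
    using cos_npi [of "Suc k"] by (simp add: mult.commute add.commute power_mult_distrib [symmetric])
  ultimately have "(\<lambda>N. 1 - (sin t / t + (\<Sum>k<N. - kcos t k))) \<longlonglongrightarrow> 1 - cos t"
    by (intro tendsto_diff tendsto_const) simp
  moreover have "incseq (\<lambda>N. 1 - (sin t / t + (\<Sum>k<N. - kcos t k)))"
    using assms by (intro incseq_SucI) (simp add: kcos_nonneg)
  ultimately have "1 - (sin t / t + (\<Sum>k<N. - kcos t k)) \<le> 1 - cos t"
    by (rule incseq_le [rotated])
  then show ?thesis
    using False by (simp add: kcos0_def sum_negf)
qed

text \<open>Again the endpoint: the half-integer frequency makes
  \<open>(-1) ^ k * sin (pi * (real k + 1 / 2))\<close> equal to 1.\<close>

lemma ksin_sum_le:
  assumes "0 \<le> t" "t < pi / 2"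
  shows "(\<Sum>k<N. ksin t k) \<le> sin t"
proof (cases "t = 0")
  case True
  then show ?thesis
    by (simp add: ksin_def)
next
  case False
  have "(\<lambda>N. \<Sum>k<N. (-1) ^ k * ksin t k * sin (pi * (real k + 1 / 2) * 1)) \<longlonglongrightarrow> sin (t * 1)"
    using assms False by (intro tendsto_uniform_limitI [OF sine_expansion]) auto
  moreover have eq: "(-1) ^ k * ksin t k * sin (pi * (real k + 1 / 2)) = ksin t k" for k
  proof -
    have "pi * (real k + 1 / 2) = real k * pi + pi / 2"
      by (simp add: algebra_simps)
    then show ?thesis
      by (simp add: sin_add power_mult_distrib [symmetric])
  qed
  ultimately have "(\<lambda>N. \<Sum>k<N. ksin t k) \<longlonglongrightarrow> sin t"
    by (simp only: eq mult_1_right)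
  moreover have "incseq (\<lambda>N. \<Sum>k<N. ksin t k)"
    using assms by (intro incseq_SucI) (simp add: ksin_nonneg)
  ultimately show ?thesis
    by (rule incseq_le [rotated])
qed

lemma kcos_mono:
  assumes "0 \<le> s" "s \<le> t" "t \<le> pi / 2"
  shows "kcos s k \<le> kcos t k"
  unfolding kcos_def
proof (rule frac_le)
  have "t < pi"
    using assms pi_gt_zero by linarith
  then show "0 < (pi * (real k + 1))\<^sup>2 - t\<^sup>2"
    using assms by (intro kcos_denominator_ge) auto
  show "2 * s * sin s \<le> 2 * t * sin t" "0 \<le> 2 * t * sin t"
    using assms sin_monotone_2pi_le [of s t] sin_ge_zero [of s] by (auto intro!: mult_mono mult_nonneg_nonneg)
  show "(pi * (real k + 1))\<^sup>2 - t\<^sup>2 \<le> (pi * (real k + 1))\<^sup>2 - s\<^sup>2"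
    using assms by simp
qed

text \<open>The bound pi / 4 serves the derivative \<open>cos x - x * sin x\<close>: it ensures
  \<open>x \<le> 1\<close> and \<open>sin x \<le> cos x\<close>.\<close>

lemma mult_cos_mono:
  assumes "0 \<le> s" "s \<le> t" "t \<le> pi / 4"
  shows "s * cos s \<le> t * cos t"
proof (rule DERIV_nonneg_imp_nondecreasing [OF assms(2)])
  fix x
  assume x: "s \<le> x" "x \<le> t"
  have "x * sin x \<le> 1 * sin x"
    using x assms pi_less_4 by (intro mult_right_mono sin_ge_zero) auto
  also have "sin x \<le> sin (pi / 2 - x)"
    using x assms by (intro sin_monotone_2pi_le) auto
  also have "\<dots> = cos x"
    by (simp add: cos_sin_eq)
  finally show "\<exists>y. ((\<lambda>x. x * cos x) has_real_derivative y) (at x) \<and> 0 \<le> y"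
    by (intro exI [of _ "cos x - x * sin x"]) (auto intro!: derivative_eq_intros)
qed

lemma ksin_mono:
  assumes "0 \<le> s" "s \<le> t" "t \<le> pi / 4"
  shows "ksin s k \<le> ksin t k"
  unfolding ksin_def
proof (rule frac_le)
  show "0 < (pi * (real k + 1 / 2))\<^sup>2 - t\<^sup>2"
    using assms pi_gt_zero by (intro ksin_denominator_pos) linarith+
  show "2 * s * cos s \<le> 2 * t * cos t" "0 \<le> 2 * t * cos t"
    using mult_cos_mono [OF assms] assms cos_ge_zero [of t] by auto
  show "(pi * (real k + 1 / 2))\<^sup>2 - t\<^sup>2 \<le> (pi * (real k + 1 / 2))\<^sup>2 - s\<^sup>2"
    using assms by simp
qed

lemma mult_cos_le_sin:
  assumes "0 \<le> x" "x \<le> pi"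
  shows "x * cos x \<le> sin x"
proof -
  have "sin 0 - 0 * cos 0 \<le> sin x - x * cos x"
  proof (rule DERIV_nonneg_imp_nondecreasing [OF assms(1)])
    fix z
    assume "0 \<le> z" "z \<le> x"
    then show "\<exists>y. ((\<lambda>x. sin x - x * cos x) has_real_derivative y) (at z) \<and> 0 \<le> y"
      using assms sin_ge_zero [of z]
      by (intro exI [of _ "z * sin z"]) (auto intro!: derivative_eq_intros)
  qed
  then show ?thesis
    by simp
qed

lemma kcos0_mono:
  assumes "0 \<le> s" "s \<le> t" "t \<le> pi"
  shows "kcos0 s \<le> kcos0 t" and "0 \<le> kcos0 s"
proof -
  have nonneg: "0 \<le> kcos0 s" if "0 \<le> s" for s
    using sin_x_le_x [OF that] that by (simp add: kcos0_def divide_le_eq)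
  then show "0 \<le> kcos0 s"
    using assms by blast
  show "kcos0 s \<le> kcos0 t"
  proof (cases "s = 0")
    case True
    then show ?thesis
      using nonneg [of t] assms by (simp add: kcos0_def)
  next
    case False
    have "sin t / t \<le> sin s / s"
    proof (rule DERIV_nonpos_imp_nonincreasing [OF assms(2)])
      fix x
      assume x: "s \<le> x" "x \<le> t"
      then have "x * cos x \<le> sin x"
        using assms by (intro mult_cos_le_sin) auto
      then show "\<exists>y. ((\<lambda>x. sin x / x) has_real_derivative y) (at x) \<and> y \<le> 0"
        using x False assms
        by (intro exI [of _ "(cos x * x - sin x) / (x * x)"])
          (auto intro!: derivative_eq_intros divide_nonpos_nonneg simp: mult.commute)
    qed
    then show ?thesis
      using False assms by (simp add: kcos0_def)
  qed
qed

section \<open>Perturbation of the orbit\<close>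

lemma L2_set_norm_add:
  "L2_set (\<lambda>n. norm (a n + b n)) F \<le> L2_set (\<lambda>n. norm (a n)) F + L2_set (\<lambda>n. norm (b n)) F"
  by (rule order_trans [OF L2_set_mono L2_set_triangle_ineq]) (auto intro: norm_triangle_ineq)

lemma L2_set_norm_sum:
  "finite K \<Longrightarrow> L2_set (\<lambda>n. norm (\<Sum>k\<in>K. a k n)) F \<le> (\<Sum>k\<in>K. L2_set (\<lambda>n. norm (a k n)) F)"
proof (induction K rule: finite_induct)
  case (insert k K)
  then show ?case
    using L2_set_norm_add [of "a k" "\<lambda>n. \<Sum>k\<in>K. a k n" F] by simp
qed (simp add: L2_set_def)

lemma L2_set_norm_mult:
  fixes c u :: "'i \<Rightarrow> complex"
  assumes c: "\<And>n. n \<in> F \<Longrightarrow> cmod (c n) \<le> M" and u: "L2_set (\<lambda>n. cmod (u n)) F \<le> U" and "0 \<le> M"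
  shows "L2_set (\<lambda>n. cmod (c n * u n)) F \<le> M * U"
proof -
  have "L2_set (\<lambda>n. cmod (c n * u n)) F \<le> L2_set (\<lambda>n. M * cmod (u n)) F"
    by (intro L2_set_mono) (auto simp: norm_mult intro: mult_right_mono c)
  also have "\<dots> = M * L2_set (\<lambda>n. cmod (u n)) F"
    using L2_set_right_distrib [OF \<open>0 \<le> M\<close>, of "\<lambda>n. cmod (u n)" F] by simp
  also have "\<dots> \<le> M * U"
    by (intro mult_left_mono u \<open>0 \<le> M\<close>)
  finally show ?thesis .
qed

text \<open>Finite sections carry no summability condition. The constant is the square root of the
  customary Bessel bound, so that constants add under perturbation.\<close>

definition bessel :: "('i \<Rightarrow> 'a::complex_hilbert_space) \<Rightarrow> real \<Rightarrow> bool" where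
  "bessel \<phi> b \<longleftrightarrow> (\<forall>y F. finite F \<longrightarrow> L2_set (\<lambda>n. cmod (cinner y (\<phi> n))) F \<le> b * norm y)"

context isometric_rep
begin

definition Cop :: "real \<Rightarrow> 'a \<Rightarrow> 'a" where
  "Cop s y = (1 / 2) *\<^sub>C (T s y + T (- s) y)"

text \<open>Dividing by 2 and not by 2 \<i> keeps the coefficients in
  \<open>T_diff_expansion\<close> real; the price is the sign in \<open>cinner_Sop\<close>.\<close>

definition Sop :: "real \<Rightarrow> 'a \<Rightarrow> 'a" where
  "Sop s y = (1 / 2) *\<^sub>C (T s y + (-1) *\<^sub>C T (- s) y)"

lemma symbol_Cop: "symbol (Cop s) (\<lambda>\<xi>. of_real (cos (\<xi> * s)))"
proof -
  have "(1 / 2) * (cis (\<xi> * s) + cis (\<xi> * - s)) = of_real (cos (\<xi> * s))" for \<xi>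
    by (simp add: complex_eq_iff)
  then show ?thesis
    using symbol.scale [OF symbol.add [OF symbol.base symbol.base], of "1 / 2" s "- s"]
    by (simp add: Cop_def [abs_def])
qed

lemma symbol_Sop: "symbol (Sop s) (\<lambda>\<xi>. \<i> * of_real (sin (\<xi> * s)))"
proof -
  have "(1 / 2) * (cis (\<xi> * s) + (-1) * cis (\<xi> * - s)) = \<i> * of_real (sin (\<xi> * s))" for \<xi>
    by (simp add: complex_eq_iff)
  then show ?thesis
    using symbol.scale [OF symbol.add [OF symbol.base symbol.scale [OF symbol.base]], of "1 / 2" s "-1" "- s"]
    by (simp only: Sop_def [abs_def])
qed

lemma symbol_sum:
  fixes N :: nat
  assumes "\<And>k. symbol (R k) (g k)"
  shows "symbol (\<lambda>y. \<Sum>k<N. c k *\<^sub>C R k y) (\<lambda>\<xi>. \<Sum>k<N. c k * g k \<xi>)"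
proof (induction N)
  case 0
  \<comment> \<open>The rules for \<open>symbol\<close> do not contain the zero operator; the empty
    sum is obtained as \<open>0\<close> times \<open>T 0\<close>.\<close>
  show ?case
    using symbol.scale [OF symbol.base, of 0 0] by simp
next
  case (Suc N)
  show ?case
    using symbol.add [OF Suc symbol.scale [OF assms]] by simp
qed

lemma norm_Cop: "norm (Cop s y) \<le> norm y"
  using norm_triangle_ineq [of "T s y" "T (- s) y"] by (simp add: Cop_def norm_scaleC)

lemma norm_Sop: "norm (Sop s y) \<le> norm y"
  using norm_triangle_ineq [of "T s y" "(-1) *\<^sub>C T (- s) y"] by (simp add: Sop_def norm_scaleC)

lemma cinner_T_right: "cinner y (T s z) = cinner (T (- s) y) z"
  using cinner_T_T [of 0 y s z] by simp

lemma cinner_Cop: "cinner y (Cop s z) = cinner (Cop s y) z"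
  by (simp add: Cop_def cinner_scaleC_left cinner_scaleC_right cinner_add_left cinner_add_right
      cinner_T_right)

lemma cinner_Sop: "cinner y (Sop s z) = - cinner (Sop s y) z"
  by (simp add: Sop_def cinner_scaleC_left cinner_scaleC_right cinner_add_left cinner_add_right
      cinner_T_right cinner.diff_left cinner.diff_right) (simp add: field_simps)

text \<open>The error after \<open>N\<close> terms is a trigonometric polynomial in
  \<open>T\<close>. On the spectrum, with \<open>\<xi> = \<gamma> * x\<close>, its symbol is the
  error of the scalar cosine and sine expansions, so \<open>symbol_norm_bound\<close> turns their
  uniform convergence into convergence of operators. Only \<open>\<bar>d\<bar>\<close> enters the
  coefficients; as sine is odd, \<open>sgn d\<close> restores the sign.\<close>

lemma T_diff_expansion:
  assumes \<gamma>: "\<gamma> > 0" and spec: "beurling_spectrum T \<subseteq> {-\<gamma>..\<gamma>}" and d: "\<bar>d\<bar> * \<gamma> < pi / 2"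
  defines "t \<equiv> \<bar>d\<bar> * \<gamma>"
  shows "(\<lambda>N. of_real (- kcos0 t) *\<^sub>C z
      + (\<Sum>k<N. of_real ((-1) ^ k * kcos t k) *\<^sub>C Cop (pi * (real k + 1) / \<gamma>) z)
      + (\<Sum>k<N. of_real (sgn d * ((-1) ^ k * ksin t k)) *\<^sub>C Sop (pi * (real k + 1 / 2) / \<gamma>) z))
    \<longlonglongrightarrow> T d z - z"
proof (cases "d = 0")
  case True
  then show ?thesis
    by (simp add: t_def kcos0_def kcos_def)
next
  case False
  then have t: "0 < t" "t < pi / 2"
    using d \<gamma> by (auto simp: t_def)
  \<comment> \<open>The identity is written as \<open>T 0\<close>, so that every summand has a
    symbol.\<close>
  define R where "R N z = of_real (- kcos0 t) *\<^sub>C T 0 z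
      + (\<Sum>k<N. of_real ((-1) ^ k * kcos t k) *\<^sub>C Cop (pi * (real k + 1) / \<gamma>) z)
      + (\<Sum>k<N. of_real (sgn d * ((-1) ^ k * ksin t k)) *\<^sub>C Sop (pi * (real k + 1 / 2) / \<gamma>) z)
      + (-1) *\<^sub>C (T d z + (-1) *\<^sub>C T 0 z)" for N z
  define g where "g N \<xi> = of_real (- kcos0 t) * cis (\<xi> * 0)
      + (\<Sum>k<N. of_real ((-1) ^ k * kcos t k) * of_real (cos (\<xi> * (pi * (real k + 1) / \<gamma>))))
      + (\<Sum>k<N. of_real (sgn d * ((-1) ^ k * ksin t k)) * (\<i> * of_real (sin (\<xi> * (pi * (real k + 1 / 2) / \<gamma>)))))
      + (-1) * (cis (\<xi> * d) + (-1) * cis (\<xi> * 0))" for N \<xi>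
  have sym: "symbol (R N) (g N)" for N
    unfolding R_def [abs_def] g_def [abs_def]
    by (intro symbol.add symbol.scale symbol_sum symbol_Cop symbol_Sop symbol.base)
  have g_eq: "g N (\<gamma> * x) = of_real (sin t / t + (\<Sum>k<N. (-1) ^ k * kcos t k * cos (pi * (real k + 1) * x)) - cos (t * x))
      + \<i> * of_real (sgn d * ((\<Sum>k<N. (-1) ^ k * ksin t k * sin (pi * (real k + 1 / 2) * x)) - sin (t * x)))" for N x
  proof -
    have arg: "\<gamma> * x * (a / \<gamma>) = a * x" for a
      using \<gamma> by simp
    have "\<gamma> * x * d = sgn d * (t * x)"
      by (simp add: t_def abs_mult_sgn mult_ac sgn_mult_abs)
    then have "cis (\<gamma> * x * d) = of_real (cos (t * x)) + \<i> * of_real (sgn d * sin (t * x))"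
      using False by (simp only:) (simp add: complex_eq_iff sgn_real_def)
    then show ?thesis
      using t unfolding g_def arg
      by (simp add: kcos0_def complex_eq_iff sum_distrib_left algebra_simps Re_sum Im_sum)
  qed
  have "(\<lambda>N. R N z) \<longlonglongrightarrow> 0"
  proof (rule LIMSEQ_I)
    fix e :: real
    assume e: "0 < e"
    define e' where "e' = e / (2 * (norm z + 1))"
    have e': "0 < e'" "2 * e' * norm z < e"
    proof -
      have pos: "0 < norm z + 1"
        by (intro add_nonneg_pos) auto
      then show "0 < e'"
        using e by (simp add: e'_def)
      have "2 * e' * norm z = e * (norm z / (norm z + 1))"
        using pos by (simp add: e'_def field_simps)
      also have "\<dots> < e * 1"
        using pos e by (intro mult_strict_left_mono) (simp_all add: divide_less_eq)
      finally show "2 * e' * norm z < e"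
        by simp
    qed
    have "\<forall>\<^sub>F N in sequentially. \<forall>x\<in>{-1..1}.
        dist (sin t / t + (\<Sum>k<N. (-1) ^ k * kcos t k * cos (pi * (real k + 1) * x))) (cos (t * x)) < e'"
      using t by (intro uniform_limitD [OF cosine_expansion] e') auto
    moreover have "\<forall>\<^sub>F N in sequentially. \<forall>x\<in>{-1..1}.
        dist (\<Sum>k<N. (-1) ^ k * ksin t k * sin (pi * (real k + 1 / 2) * x)) (sin (t * x)) < e'"
      by (intro uniform_limitD [OF sine_expansion] e' t)
    ultimately have "\<forall>\<^sub>F N in sequentially. norm (R N z) < e"
    proof eventually_elim
      case (elim N)
      have "norm (R N z) \<le> 2 * e' * norm z"
      proof (rule symbol_norm_bound [OF sym])
        show "0 \<le> 2 * e'"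
          using e' by simp
        show "cmod (g N \<xi>) \<le> 2 * e'" if "\<xi> \<in> beurling_spectrum T" for \<xi>
        proof -
          define x where "x = \<xi> / \<gamma>"
          have "-\<gamma> \<le> \<xi>" "\<xi> \<le> \<gamma>"
            using that spec by auto
          then have x: "x \<in> {-1..1}" and \<xi>: "\<xi> = \<gamma> * x"
            using \<gamma> by (auto simp: x_def field_simps)
          have "cmod (g N \<xi>) \<le> \<bar>sin t / t + (\<Sum>k<N. (-1) ^ k * kcos t k * cos (pi * (real k + 1) * x)) - cos (t * x)\<bar>
              + \<bar>sgn d * ((\<Sum>k<N. (-1) ^ k * ksin t k * sin (pi * (real k + 1 / 2) * x)) - sin (t * x))\<bar>"
            unfolding \<xi> g_eq by (rule order_trans [OF norm_triangle_ineq]) (simp only: norm_mult norm_ii norm_of_real mult_1_left order_refl real_norm_def)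
          also have "\<dots> \<le> e' + e'"
          proof (rule add_mono)
            show "\<bar>sin t / t + (\<Sum>k<N. (-1) ^ k * kcos t k * cos (pi * (real k + 1) * x)) - cos (t * x)\<bar> \<le> e'"
              using elim(1) x unfolding dist_real_def by (meson less_imp_le)
            have "\<bar>(\<Sum>k<N. (-1) ^ k * ksin t k * sin (pi * (real k + 1 / 2) * x)) - sin (t * x)\<bar> \<le> e'"
              using elim(2) x unfolding dist_real_def by (meson less_imp_le)
            then show "\<bar>sgn d * ((\<Sum>k<N. (-1) ^ k * ksin t k * sin (pi * (real k + 1 / 2) * x)) - sin (t * x))\<bar> \<le> e'"
              using False by (simp add: abs_mult abs_sgn_eq)
          qed
          finally show ?thesis
            by simp
        qed
      qed
      then show ?case
        using e' by linarith
    qed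
    then show "\<exists>no. \<forall>N\<ge>no. norm (R N z - 0) < e"
      by (simp add: eventually_sequentially)
  qed
  then have "(\<lambda>N. R N z + (T d z - z)) \<longlonglongrightarrow> 0 + (T d z - z)"
    by (intro tendsto_intros)
  moreover have "R N z + (T d z - z) = of_real (- kcos0 t) *\<^sub>C z
      + (\<Sum>k<N. of_real ((-1) ^ k * kcos t k) *\<^sub>C Cop (pi * (real k + 1) / \<gamma>) z)
      + (\<Sum>k<N. of_real (sgn d * ((-1) ^ k * ksin t k)) *\<^sub>C Sop (pi * (real k + 1 / 2) / \<gamma>) z)" for N
    by (simp add: R_def scaleC.minus_left scaleC_one)
  ultimately show ?thesis
    by simp
qed

text \<open>In the expansion of \<open>T (d n) - I\<close> the operators do not involve
  \<open>n\<close>. Their adjoints turn \<open>y\<close> into \<open>Cop s y\<close> or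
  \<open>- Sop s y\<close>, vectors no longer than \<open>y\<close>, to which the Bessel inequality
  of \<phi> applies. The coefficients depending on \<open>n\<close> are multipliers, bounded by
  their values at \<tau> through monotonicity, and these values are summed by
  \<open>kcos_sum_le\<close> and \<open>ksin_sum_le\<close>.\<close>

lemma bessel_orbit_perturbation:
  fixes \<phi> :: "'i \<Rightarrow> 'a"
  assumes \<gamma>: "\<gamma> > 0" and spec: "beurling_spectrum T \<subseteq> {-\<gamma>..\<gamma>}"
    and \<phi>: "bessel \<phi> b" and b: "0 \<le> b"
    and d: "\<And>n. \<bar>d n\<bar> * \<gamma> \<le> \<tau>" and \<tau>: "0 \<le> \<tau>" "\<tau> \<le> pi / 4"
  shows "bessel (\<lambda>n. T (d n) (\<phi> n) - \<phi> n) (b * (1 - cos \<tau> + sin \<tau>))"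
  unfolding bessel_def
proof (intro allI impI)
  fix y :: 'a and F :: "'i set"
  assume F: "finite F"
  define t where "t n = \<bar>d n\<bar> * \<gamma>" for n
  have t: "0 \<le> t n" "t n \<le> \<tau>" for n
    using d \<gamma> by (auto simp: t_def)
  have \<tau>': "\<tau> < pi / 2" "\<tau> < pi" "\<tau> \<le> pi / 2" "\<tau> \<le> pi"
    using \<tau> pi_gt_zero by linarith+
  let ?c = "\<lambda>k. Cop (pi * (real k + 1) / \<gamma>)" and ?s = "\<lambda>k. Sop (pi * (real k + 1 / 2) / \<gamma>)"
  define p where "p N n = of_real (- kcos0 (t n)) *\<^sub>C \<phi> n
      + (\<Sum>k<N. of_real ((-1) ^ k * kcos (t n) k) *\<^sub>C ?c k (\<phi> n))
      + (\<Sum>k<N. of_real (sgn (d n) * ((-1) ^ k * ksin (t n) k)) *\<^sub>C ?s k (\<phi> n))" for N n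
  have p_lim: "(\<lambda>N. p N n) \<longlonglongrightarrow> T (d n) (\<phi> n) - \<phi> n" for n
    unfolding p_def t_def
    using t(2) [of n] \<tau>'(1) by (intro T_diff_expansion \<gamma> spec) (auto simp: t_def)
  have lim: "(\<lambda>N. L2_set (\<lambda>n. cmod (cinner y (p N n))) F) \<longlonglongrightarrow>
      L2_set (\<lambda>n. cmod (cinner y (T (d n) (\<phi> n) - \<phi> n))) F"
    unfolding L2_set_def by (intro tendsto_intros cinner.tendsto p_lim)
  have main: "L2_set (\<lambda>n. cmod (cinner z (\<phi> n))) F \<le> b * norm y" if "norm z \<le> norm y" for z
  proof -
    have "L2_set (\<lambda>n. cmod (cinner z (\<phi> n))) F \<le> b * norm z"
      using \<phi> F by (simp add: bessel_def)
    also have "\<dots> \<le> b * norm y"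
      using that b by (rule mult_left_mono)
    finally show ?thesis .
  qed
  have bound: "L2_set (\<lambda>n. cmod (cinner y (p N n))) F \<le> b * (1 - cos \<tau> + sin \<tau>) * norm y" for N
  proof -
    let ?u = "\<lambda>n. of_real (- kcos0 (t n)) * cinner y (\<phi> n)"
    let ?v = "\<lambda>k n. of_real ((-1) ^ k * kcos (t n) k) * cinner (?c k y) (\<phi> n)"
    let ?w = "\<lambda>k n. of_real (- (sgn (d n) * ((-1) ^ k * ksin (t n) k))) * cinner (?s k y) (\<phi> n)"
    have "cinner y (p N n) = ?u n + (\<Sum>k<N. ?v k n) + (\<Sum>k<N. ?w k n)" for n
      by (simp add: p_def cinner_add_right cinner.diff_right cinner.sum_right cinner_scaleC_right cinner_Cop cinner_Sop)
    then have "L2_set (\<lambda>n. cmod (cinner y (p N n))) F \<le>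
        L2_set (\<lambda>n. cmod (?u n)) F + L2_set (\<lambda>n. cmod (\<Sum>k<N. ?v k n)) F + L2_set (\<lambda>n. cmod (\<Sum>k<N. ?w k n)) F"
      by (auto intro!: order_trans [OF L2_set_norm_add] add_right_mono L2_set_norm_add simp del: of_real_minus of_real_mult)
    also have "\<dots> \<le> kcos0 \<tau> * (b * norm y) + (\<Sum>k<N. kcos \<tau> k * (b * norm y)) + (\<Sum>k<N. ksin \<tau> k * (b * norm y))"
    proof (intro add_mono order_trans [OF L2_set_norm_sum] sum_mono finite_lessThan)
      show "L2_set (\<lambda>n. cmod (?u n)) F \<le> kcos0 \<tau> * (b * norm y)"
        using kcos0_mono [OF t \<tau>'(4)] kcos0_mono(2) [OF \<tau>(1) order_refl \<tau>'(4)]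
        by (intro L2_set_norm_mult main) auto
      show "L2_set (\<lambda>n. cmod (?v k n)) F \<le> kcos \<tau> k * (b * norm y)" for k
        using kcos_mono [OF t \<tau>'(3)] kcos_nonneg [OF \<tau>(1) \<tau>'(2)] kcos_nonneg [OF t(1) le_less_trans [OF t(2) \<tau>'(2)]]
        by (intro L2_set_norm_mult main norm_Cop) (auto simp: norm_mult norm_power)
      show "L2_set (\<lambda>n. cmod (?w k n)) F \<le> ksin \<tau> k * (b * norm y)" for k
      proof (intro L2_set_norm_mult main norm_Sop)
        show "0 \<le> ksin \<tau> k"
          by (rule ksin_nonneg [OF \<tau>(1) \<tau>'(1)])
        have "0 \<le> ksin (t n) k" "ksin (t n) k \<le> ksin \<tau> k" for n
          using ksin_mono [OF t \<tau>(2)] ksin_nonneg [OF t(1) le_less_trans [OF t(2) \<tau>'(1)]] by auto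
        then show "cmod (of_real (- (sgn (d n) * ((-1) ^ k * ksin (t n) k)))) \<le> ksin \<tau> k" for n
          using \<open>0 \<le> ksin \<tau> k\<close> by (simp add: norm_mult norm_power abs_sgn_eq abs_mult power_abs)
      qed
    qed
    also have "\<dots> = (kcos0 \<tau> + (\<Sum>k<N. kcos \<tau> k) + (\<Sum>k<N. ksin \<tau> k)) * (b * norm y)"
      by (simp add: distrib_right sum_distrib_right)
    also have "\<dots> \<le> (1 - cos \<tau> + sin \<tau>) * (b * norm y)"
      using kcos_sum_le [OF \<tau>(1) \<tau>'(2), of N] ksin_sum_le [OF \<tau>(1) \<tau>'(1), of N] b
      by (intro mult_right_mono) auto
    finally show ?thesis
      by (simp add: mult_ac)
  qed
  show "L2_set (\<lambda>n. cmod (cinner y (T (d n) (\<phi> n) - \<phi> n))) F \<le> b * (1 - cos \<tau> + sin \<tau>) * norm y"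
    by (rule LIMSEQ_le_const2 [OF lim]) (use bound in blast)
qed

end

section \<open>Bessel sequences, frames and Riesz bases\<close>

text \<open>Cauchy criterion along finite sets: applied to \<open>F - F0\<close>, the estimate
  bounds the change of the sum by a tail of \<open>a\<close>. The denominator \<open>K + 1\<close>
  in \<epsilon> covers \<open>K = 0\<close>.\<close>

lemma summable_on_square_dominated:
  fixes f :: "'i \<Rightarrow> 'a::banach" and a :: "'i \<Rightarrow> real"
  assumes a: "a summable_on UNIV" "\<And>n. 0 \<le> a n" and K: "0 \<le> K"
    and le: "\<And>F. finite F \<Longrightarrow> (norm (sum f F))\<^sup>2 \<le> K * sum a F"
  shows "f summable_on UNIV"
proof -
  have "\<exists>P. eventually P (finite_subsets_at_top UNIV) \<and> (\<forall>F F'. P F \<and> P F' \<longrightarrow> dist (sum f F) (sum f F') < e)"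
    if e: "e > 0" for e
  proof -
    define \<epsilon> where "\<epsilon> = (e / 2)\<^sup>2 / (K + 1)"
    have \<epsilon>: "\<epsilon> > 0" "K * \<epsilon> < (e / 2)\<^sup>2"
      using e K by (simp_all add: \<epsilon>_def field_simps)
    obtain F0 where F0: "finite F0" "dist (sum a F0) (infsum a UNIV) \<le> \<epsilon>"
      using infsum_finite_approximation [OF a(1) \<epsilon>(1)] by blast
    have close: "dist (sum f F) (sum f F0) < e / 2" if F: "finite F" "F0 \<subseteq> F" for F
    proof -
      have "sum a F \<le> infsum a UNIV"
        by (rule finite_sum_le_infsum) (use a F in auto)
      then have "sum a (F - F0) \<le> \<epsilon>"
        using F0 F by (subst sum_diff) (auto simp: dist_real_def)
      then have "K * sum a (F - F0) \<le> K * \<epsilon>"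
        using K by (rule mult_left_mono)
      then have "(norm (sum f (F - F0)))\<^sup>2 < (e / 2)\<^sup>2"
        using le [of "F - F0"] F \<epsilon>(2) by simp
      then have "norm (sum f (F - F0)) < e / 2"
        by (rule power2_less_imp_less) (use e in simp)
      then show ?thesis
        using F0 F by (simp add: dist_norm sum_diff)
    qed
    show ?thesis
    proof (intro exI conjI allI impI)
      show "\<forall>\<^sub>F F in finite_subsets_at_top UNIV. finite F \<and> F0 \<subseteq> F"
        using F0 by (auto simp: eventually_finite_subsets_at_top)
      show "dist (sum f F) (sum f F') < e" if "(finite F \<and> F0 \<subseteq> F) \<and> finite F' \<and> F0 \<subseteq> F'" for F F'
        using dist_triangle2 [of "sum f F" "sum f F'" "sum f F0"] close [of F] close [of F'] that by simp
    qed
  qed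
  then have "cauchy_filter (filtermap (sum f) (finite_subsets_at_top UNIV))"
    by (simp add: cauchy_filter_metric_filtermap)
  then obtain L where "(sum f \<longlongrightarrow> L) (finite_subsets_at_top UNIV)"
    using complete_uniform [where S = "UNIV :: 'a set"] complete_UNIV by (force simp add: filterlim_def)
  then show ?thesis
    using summable_on_def has_sum_def by blast
qed

lemma has_sum_minus:
  fixes f g :: "'i \<Rightarrow> 'a::real_normed_vector"
  assumes "(f has_sum a) I" and "(g has_sum b) I"
  shows "((\<lambda>n. f n - g n) has_sum a - b) I"
  using has_sum_add [OF assms(1) has_sum_bounded_linear [OF bounded_linear_minus [OF bounded_linear_ident] assms(2)]]
  by simp

text \<open>On families that are not square summable the value is 0, by the convention for
  \<open>infsum\<close>; upper bounds by \<open>l2norm\<close> are therefore accompanied by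
  summability facts.\<close>

definition l2norm :: "('i \<Rightarrow> complex) \<Rightarrow> real" where
  "l2norm c = sqrt (\<Sum>\<^sub>\<infinity>n. (cmod (c n))\<^sup>2)"

lemma l2norm_nonneg: "0 \<le> l2norm c"
  by (simp add: l2norm_def infsum_nonneg)

lemma l2norm_sq: "(l2norm c)\<^sup>2 = (\<Sum>\<^sub>\<infinity>n. (cmod (c n))\<^sup>2)"
  by (simp add: l2norm_def infsum_nonneg)

lemma L2_set_le_l2norm:
  assumes "(\<lambda>n. (cmod (c n))\<^sup>2) summable_on UNIV" "finite F"
  shows "L2_set (\<lambda>n. cmod (c n)) F \<le> l2norm c"
  unfolding L2_set_def l2norm_def
  by (intro real_sqrt_le_mono finite_sum_le_infsum) (use assms in auto)

lemma l2norm_le: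
  assumes "\<And>F. finite F \<Longrightarrow> L2_set (\<lambda>n. cmod (c n)) F \<le> M"
  shows "(\<lambda>n. (cmod (c n))\<^sup>2) summable_on UNIV" and "l2norm c \<le> M"
proof -
  have M: "0 \<le> M"
    using assms [of "{}"] by simp
  have le: "(\<Sum>n\<in>F. (cmod (c n))\<^sup>2) \<le> M\<^sup>2" if "finite F" for F
    using assms [OF that] M by (simp add: L2_set_def real_sqrt_le_iff [of _ "M\<^sup>2", symmetric])
  show sum: "(\<lambda>n. (cmod (c n))\<^sup>2) summable_on UNIV"
    by (rule nonneg_bdd_above_summable_on) (auto intro!: bdd_aboveI [of _ "M\<^sup>2"] le)
  have "(l2norm c)\<^sup>2 \<le> M\<^sup>2"
    unfolding l2norm_sq by (rule infsum_le_finite_sums [OF sum]) (rule le)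
  then show "l2norm c \<le> M"
    using M by (rule power2_le_imp_le)
qed

lemma bessel_l2norm:
  assumes "bessel \<phi> b"
  shows "(\<lambda>n. (cmod (cinner y (\<phi> n)))\<^sup>2) summable_on UNIV"
    and "l2norm (\<lambda>n. cinner y (\<phi> n)) \<le> b * norm y"
  using l2norm_le [of "\<lambda>n. cinner y (\<phi> n)" "b * norm y"] assms unfolding bessel_def by auto

text \<open>Synthesis is adjoint to analysis and inherits its bound: the sum is tested against
  itself and one factor \<open>norm y\<close> is cancelled.\<close>

lemma bessel_synthesis_finite:
  assumes \<phi>: "bessel \<phi> b" and b: "0 \<le> b" and F: "finite F"
  shows "norm (\<Sum>n\<in>F. c n *\<^sub>C \<phi> n) \<le> b * L2_set (\<lambda>n. cmod (c n)) F"
proof -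
  define y where "y = (\<Sum>n\<in>F. c n *\<^sub>C \<phi> n)"
  have "(norm y)\<^sup>2 = cmod (cinner y y)"
    unfolding cinner_norm norm_of_real by simp
  also have "cinner y y = (\<Sum>n\<in>F. cnj (c n) * cinner y (\<phi> n))"
    unfolding y_def cinner.sum_right cinner_scaleC_right ..
  also have "cmod \<dots> \<le> (\<Sum>n\<in>F. \<bar>cmod (c n)\<bar> * \<bar>cmod (cinner y (\<phi> n))\<bar>)"
    by (rule order_trans [OF norm_sum]) (simp add: norm_mult)
  also have "\<dots> \<le> L2_set (\<lambda>n. cmod (c n)) F * L2_set (\<lambda>n. cmod (cinner y (\<phi> n))) F"
    by (rule L2_set_mult_ineq)
  also have "\<dots> \<le> L2_set (\<lambda>n. cmod (c n)) F * (b * norm y)"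
    using \<phi> F by (intro mult_left_mono) (auto simp: bessel_def)
  finally have "norm y * norm y \<le> (b * L2_set (\<lambda>n. cmod (c n)) F) * norm y"
    by (simp add: power2_eq_square mult_ac)
  then have "norm y \<le> b * L2_set (\<lambda>n. cmod (c n)) F"
    using b by (cases "norm y = 0") auto
  then show ?thesis
    by (simp add: y_def)
qed

lemma bessel_synthesis:
  assumes \<phi>: "bessel \<phi> b" and b: "0 \<le> b" and c: "(\<lambda>n. (cmod (c n))\<^sup>2) summable_on UNIV"
  shows "(\<lambda>n. c n *\<^sub>C \<phi> n) summable_on UNIV" and "norm (\<Sum>\<^sub>\<infinity>n. c n *\<^sub>C \<phi> n) \<le> b * l2norm c"
proof -
  have sq: "(norm (\<Sum>n\<in>F. c n *\<^sub>C \<phi> n))\<^sup>2 \<le> b\<^sup>2 * (\<Sum>n\<in>F. (cmod (c n))\<^sup>2)" if "finite F" for F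
  proof -
    have "(norm (\<Sum>n\<in>F. c n *\<^sub>C \<phi> n))\<^sup>2 \<le> (b * L2_set (\<lambda>n. cmod (c n)) F)\<^sup>2"
      by (intro power_mono bessel_synthesis_finite \<phi> b that) simp
    also have "\<dots> = b\<^sup>2 * (\<Sum>n\<in>F. (cmod (c n))\<^sup>2)"
      by (simp add: L2_set_def power_mult_distrib sum_nonneg)
    finally show ?thesis .
  qed
  show sum: "(\<lambda>n. c n *\<^sub>C \<phi> n) summable_on UNIV"
    by (rule summable_on_square_dominated [OF c _ _ sq]) auto
  then have "((\<lambda>F. norm (\<Sum>n\<in>F. c n *\<^sub>C \<phi> n)) \<longlongrightarrow> norm (\<Sum>\<^sub>\<infinity>n. c n *\<^sub>C \<phi> n)) (finite_subsets_at_top UNIV)"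
    by (intro tendsto_norm infsum_tendsto)
  moreover have "norm (\<Sum>n\<in>F. c n *\<^sub>C \<phi> n) \<le> b * l2norm c" if "finite F" for F
    by (rule order_trans [OF bessel_synthesis_finite [OF \<phi> b that]])
      (intro mult_left_mono L2_set_le_l2norm c that b)
  ultimately show "norm (\<Sum>\<^sub>\<infinity>n. c n *\<^sub>C \<phi> n) \<le> b * l2norm c"
    by (intro tendsto_upperbound [where F = "finite_subsets_at_top UNIV"])
      (auto intro: eventually_finite_subsets_at_top_weakI)
qed

lemma bessel_perturbed:
  fixes \<phi> \<psi> :: "'i \<Rightarrow> 'a::complex_hilbert_space"
  assumes \<phi>: "bessel \<phi> b" and d: "bessel (\<lambda>n. \<psi> n - \<phi> n) e"
  shows "bessel \<psi> (b + e)"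
  unfolding bessel_def
proof (intro allI impI)
  fix y :: 'a and F :: "'i set"
  assume F: "finite F"
  have "L2_set (\<lambda>n. cmod (cinner y (\<phi> n) + cinner y (\<psi> n - \<phi> n))) F \<le>
      L2_set (\<lambda>n. cmod (cinner y (\<phi> n))) F + L2_set (\<lambda>n. cmod (cinner y (\<psi> n - \<phi> n))) F"
    by (rule L2_set_norm_add)
  also have "\<dots> \<le> b * norm y + e * norm y"
    using \<phi> d F by (intro add_mono) (auto simp: bessel_def)
  finally show "L2_set (\<lambda>n. cmod (cinner y (\<psi> n))) F \<le> (b + e) * norm y"
    by (simp add: cinner.diff_right distrib_right)
qed

lemma frame_bounds_bessel:
  assumes "frame_bounds \<phi> A B"
  shows "bessel \<phi> (sqrt B)" and "sqrt A * norm y \<le> l2norm (\<lambda>n. cinner y (\<phi> n))"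
proof -
  have AB: "0 < A" "0 < B"
    using assms by (auto simp: frame_bounds_def)
  show "sqrt A * norm y \<le> l2norm (\<lambda>n. cinner y (\<phi> n))"
  proof (rule power2_le_imp_le)
    show "(sqrt A * norm y)\<^sup>2 \<le> (l2norm (\<lambda>n. cinner y (\<phi> n)))\<^sup>2"
      using assms AB unfolding l2norm_sq frame_bounds_def by (simp add: power_mult_distrib)
  qed (rule l2norm_nonneg)
  show "bessel \<phi> (sqrt B)"
    unfolding bessel_def
  proof (intro allI impI)
    fix y and F :: "int set"
    assume F: "finite F"
    have "L2_set (\<lambda>n. cmod (cinner y (\<phi> n))) F \<le> l2norm (\<lambda>n. cinner y (\<phi> n))"
      using assms F by (intro L2_set_le_l2norm) (auto simp: frame_bounds_def)
    also have "\<dots> \<le> sqrt B * norm y"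
    proof (rule power2_le_imp_le)
      show "(l2norm (\<lambda>n. cinner y (\<phi> n)))\<^sup>2 \<le> (sqrt B * norm y)\<^sup>2"
        using assms AB unfolding l2norm_sq frame_bounds_def by (simp add: power_mult_distrib)
    qed (use AB in simp)
    finally show "L2_set (\<lambda>n. cmod (cinner y (\<phi> n))) F \<le> sqrt B * norm y" .
  qed
qed

lemma frame_boundsI:
  assumes \<phi>: "bessel \<phi> b" and ab: "0 < a" "a \<le> b"
    and low: "\<And>y. a * norm y \<le> l2norm (\<lambda>n. cinner y (\<phi> n))"
  shows "frame_bounds \<phi> (a\<^sup>2) (b\<^sup>2)"
  unfolding frame_bounds_def
proof (intro conjI allI)
  show "0 < a\<^sup>2" "a\<^sup>2 \<le> b\<^sup>2"
    using ab by (auto intro: power_mono)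
  fix y
  show "(\<lambda>n. (cmod (cinner y (\<phi> n)))\<^sup>2) summable_on UNIV"
    by (rule bessel_l2norm(1) [OF \<phi>])
  show "a\<^sup>2 * (norm y)\<^sup>2 \<le> (\<Sum>\<^sub>\<infinity>n. (cmod (cinner y (\<phi> n)))\<^sup>2)"
    using power_mono [OF low [of y], of 2] ab by (simp add: l2norm_sq power_mult_distrib)
  show "(\<Sum>\<^sub>\<infinity>n. (cmod (cinner y (\<phi> n)))\<^sup>2) \<le> b\<^sup>2 * (norm y)\<^sup>2"
    using power_mono [OF bessel_l2norm(2) [OF \<phi>, of y] l2norm_nonneg, of 2]
    by (simp add: l2norm_sq power_mult_distrib)
qed

text \<open>The triangle inequality for the sequences of frame coefficients of a fixed
  \<open>y\<close>, used in both directions; hence square roots of the bounds are shifted by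
  \<open>e\<close>.\<close>

lemma frame_bounds_perturbed:
  assumes \<phi>: "frame_bounds \<phi> A B" and d: "bessel (\<lambda>n. \<psi> n - \<phi> n) e" and e: "0 \<le> e" "e < sqrt A"
  shows "frame_bounds \<psi> ((sqrt A - e)\<^sup>2) ((sqrt B + e)\<^sup>2)"
proof (rule frame_boundsI)
  show \<psi>: "bessel \<psi> (sqrt B + e)"
    by (rule bessel_perturbed [OF frame_bounds_bessel(1) [OF \<phi>] d])
  show "0 < sqrt A - e"
    using e by simp
  have "sqrt A \<le> sqrt B"
    using \<phi> by (simp add: frame_bounds_def)
  then show "sqrt A - e \<le> sqrt B + e"
    using e by linarith
  fix y
  have "L2_set (\<lambda>n. cmod (cinner y (\<phi> n))) F \<le> l2norm (\<lambda>n. cinner y (\<psi> n)) + e * norm y" if F: "finite F" for F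
  proof -
    have "L2_set (\<lambda>n. cmod (cinner y (\<psi> n) + - cinner y (\<psi> n - \<phi> n))) F \<le>
        L2_set (\<lambda>n. cmod (cinner y (\<psi> n))) F + L2_set (\<lambda>n. cmod (- cinner y (\<psi> n - \<phi> n))) F"
      by (rule L2_set_norm_add)
    also have "\<dots> \<le> l2norm (\<lambda>n. cinner y (\<psi> n)) + e * norm y"
      using d F by (intro add_mono L2_set_le_l2norm bessel_l2norm(1) [OF \<psi>]) (auto simp: bessel_def)
    finally show ?thesis
      by (simp add: cinner.diff_right)
  qed
  then have "l2norm (\<lambda>n. cinner y (\<phi> n)) \<le> l2norm (\<lambda>n. cinner y (\<psi> n)) + e * norm y"
    by (rule l2norm_le(2))
  then show "(sqrt A - e) * norm y \<le> l2norm (\<lambda>n. cinner y (\<psi> n))"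
    using frame_bounds_bessel(2) [OF \<phi>, of y] by (simp add: left_diff_distrib)
qed


lemma frame_operator:
  assumes \<phi>: "frame_bounds \<phi> A B"
  defines "S \<equiv> \<lambda>z. \<Sum>\<^sub>\<infinity>n. cinner z (\<phi> n) *\<^sub>C \<phi> n"
  shows "((\<lambda>n. cinner z (\<phi> n) *\<^sub>C \<phi> n) has_sum S z) UNIV"
    and "norm (S z) \<le> sqrt B * l2norm (\<lambda>n. cinner z (\<phi> n))"
    and "Re (cinner (S z) z) = (l2norm (\<lambda>n. cinner z (\<phi> n)))\<^sup>2"
    and "S (u - v) = S u - S v"
proof -
  have B: "0 \<le> sqrt B"
    using \<phi> by (simp add: frame_bounds_def)
  note bes = frame_bounds_bessel(1) [OF \<phi>]
  note syn = bessel_synthesis [OF bes B bessel_l2norm(1) [OF bes]]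
  show S: "((\<lambda>n. cinner z (\<phi> n) *\<^sub>C \<phi> n) has_sum S z) UNIV" for z
    unfolding S_def by (rule has_sum_infsum [OF syn(1)])
  show "norm (S z) \<le> sqrt B * l2norm (\<lambda>n. cinner z (\<phi> n))"
    unfolding S_def by (rule syn(2))
  have "((\<lambda>n. cinner (cinner z (\<phi> n) *\<^sub>C \<phi> n) z) has_sum cinner (S z) z) UNIV"
    by (rule has_sum_bounded_linear [OF cinner.bounded_linear_left S])
  moreover have "cinner (cinner z (\<phi> n) *\<^sub>C \<phi> n) z = of_real ((cmod (cinner z (\<phi> n)))\<^sup>2)" for n
    using cinner_commute [of "\<phi> n" z] complex_norm_square [of "cinner z (\<phi> n)"]
    by (simp add: cinner_scaleC_left)
  ultimately have "((\<lambda>n. complex_of_real ((cmod (cinner z (\<phi> n)))\<^sup>2)) has_sum cinner (S z) z) UNIV"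
    by simp
  moreover have "((\<lambda>n. complex_of_real ((cmod (cinner z (\<phi> n)))\<^sup>2)) has_sum
      of_real ((l2norm (\<lambda>n. cinner z (\<phi> n)))\<^sup>2)) UNIV"
    unfolding l2norm_sq by (rule has_sum_of_real [OF has_sum_infsum [OF bessel_l2norm(1) [OF bes]]])
  ultimately have "cinner (S z) z = of_real ((l2norm (\<lambda>n. cinner z (\<phi> n)))\<^sup>2)"
    by (rule has_sum_unique)
  then show "Re (cinner (S z) z) = (l2norm (\<lambda>n. cinner z (\<phi> n)))\<^sup>2"
    by (simp only: Re_complex_of_real)
  have "((\<lambda>n. cinner (u - v) (\<phi> n) *\<^sub>C \<phi> n) has_sum S u - S v) UNIV"
    using has_sum_minus [OF S [of u] S [of v]] by (simp add: cinner.diff_left scaleC.diff_left)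
  then show "S (u - v) = S u - S v"
    using has_sum_unique [OF S [of "u - v"]] by simp
qed

text \<open>The frame operator divided by the upper bound is a contractive perturbation of the identity, hence onto.\<close>

lemma frame_operator_surj:
  fixes \<phi> :: "int \<Rightarrow> 'a::complex_hilbert_space" and w :: 'a
  assumes \<phi>: "frame_bounds \<phi> A B"
  obtains z where "((\<lambda>n. cinner z (\<phi> n) *\<^sub>C \<phi> n) has_sum w) UNIV"
proof -
  have AB: "0 < A" "0 < B" "A \<le> B"
    using \<phi> by (auto simp: frame_bounds_def)
  define S where "S z = (\<Sum>\<^sub>\<infinity>n. cinner z (\<phi> n) *\<^sub>C \<phi> n)" for z
  note S = frame_operator [OF \<phi>, folded S_def]
  \<comment> \<open>With \<open>l\<close> the norm of the coefficients, expanding the square gives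
    at most \<open>(norm z)\<^sup>2 - 2 * l\<^sup>2 / B + l\<^sup>2 / B\<close>, and
    \<open>l\<^sup>2 \<ge> A * (norm z)\<^sup>2\<close> leaves the factor
    \<open>1 - A / B\<close>.\<close>
  have contr: "norm (z - (1 / B) *\<^sub>R S z) \<le> sqrt (1 - A / B) * norm z" for z
  proof (rule power2_le_imp_le)
    let ?l = "l2norm (\<lambda>n. cinner z (\<phi> n))"
    have "Re (cinner z (S z)) = ?l\<^sup>2"
      using S(3) [of z] cinner_commute [of z "S z"] by simp
    then have "(norm (z - (1 / B) *\<^sub>R S z))\<^sup>2 = (norm z)\<^sup>2 - 2 / B * ?l\<^sup>2 + (norm (S z))\<^sup>2 / B\<^sup>2"
      using norm_add_sq [of z "- ((1 / B) *\<^sub>R S z)"]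
      by (simp add: cinner.minus_right cinner_scaleR_right power_divide)
    also have "(norm (S z))\<^sup>2 / B\<^sup>2 \<le> ?l\<^sup>2 / B"
    proof -
      have "(norm (S z))\<^sup>2 \<le> B * ?l\<^sup>2"
        using power_mono [OF S(2) [of z], of 2] AB by (simp add: power_mult_distrib)
      then have "(norm (S z))\<^sup>2 / B\<^sup>2 \<le> B * ?l\<^sup>2 / B\<^sup>2"
        by (rule divide_right_mono) simp
      then show ?thesis
        using AB by (simp add: power2_eq_square)
    qed
    also have "(norm z)\<^sup>2 - 2 / B * ?l\<^sup>2 + ?l\<^sup>2 / B = (norm z)\<^sup>2 - ?l\<^sup>2 / B"
      by simp
    also have "\<dots> \<le> (norm z)\<^sup>2 - A * (norm z)\<^sup>2 / B"
    proof -
      have "A * (norm z)\<^sup>2 \<le> ?l\<^sup>2"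
        using power_mono [OF frame_bounds_bessel(2) [OF \<phi>, of z], of 2] AB by (simp add: power_mult_distrib)
      then show ?thesis
        using AB by (intro diff_left_mono divide_right_mono) auto
    qed
    also have "\<dots> = (sqrt (1 - A / B) * norm z)\<^sup>2"
      using AB by (simp add: power_mult_distrib left_diff_distrib)
    finally show "(norm (z - (1 / B) *\<^sub>R S z))\<^sup>2 \<le> (sqrt (1 - A / B) * norm z)\<^sup>2"
      by simp
  qed (use AB in simp)
  \<comment> \<open>A fixed point of this map is precisely a solution of
    \<open>S z = w\<close>.\<close>
  have "\<exists>!z. z + (1 / B) *\<^sub>R (w - S z) = z"
  proof (rule banach_fix_type)
    show "0 \<le> sqrt (1 - A / B)" "sqrt (1 - A / B) < 1"
      using AB by auto
    have "dist (u + (1 / B) *\<^sub>R (w - S u)) (v + (1 / B) *\<^sub>R (w - S v)) =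
        norm ((u - v) - (1 / B) *\<^sub>R S (u - v))" for u v
      by (simp add: dist_norm S(4) algebra_simps)
    then show "\<forall>u v. dist (u + (1 / B) *\<^sub>R (w - S u)) (v + (1 / B) *\<^sub>R (w - S v)) \<le> sqrt (1 - A / B) * dist u v"
      using contr by (simp add: dist_norm)
  qed
  then obtain z where "z + (1 / B) *\<^sub>R (w - S z) = z"
    by blast
  then have "S z = w"
    using AB by simp
  then show ?thesis
    using S(1) [of z] that by blast
qed

lemma frame_span_dense:
  fixes \<phi> :: "int \<Rightarrow> 'a::complex_hilbert_space"
  assumes \<phi>: "frame_bounds \<phi> A B"
  shows "closure (complex_vector.span (range \<phi>)) = UNIV"
proof -
  have "w \<in> closure (complex_vector.span (range \<phi>))" for w
  proof -
    obtain z where "((\<lambda>n. cinner z (\<phi> n) *\<^sub>C \<phi> n) has_sum w) UNIV"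
      using frame_operator_surj [OF \<phi>] by blast
    then have lim: "((\<lambda>F. \<Sum>n\<in>F. cinner z (\<phi> n) *\<^sub>C \<phi> n) \<longlongrightarrow> w) (finite_subsets_at_top UNIV)"
      by (simp add: has_sum_def)
    have "(\<Sum>n\<in>F. cinner z (\<phi> n) *\<^sub>C \<phi> n) \<in> closure (complex_vector.span (range \<phi>))" for F
      by (intro subsetD [OF closure_subset] complex_vector.span_sum complex_vector.span_scale
          complex_vector.span_base) auto
    then show ?thesis
      by (intro Lim_in_closed_set [OF closed_closure _ _ lim]) auto
  qed
  then show ?thesis
    by blast
qed

text \<open>Writing \<open>w = S z\<close> with the frame operator \<open>S\<close>, injectivity of
  synthesis forces \<open>c\<close> to be the family of frame coefficients of \<open>z\<close>. Then
  \<open>(l2norm c)\<^sup>2\<close> is the inner product of \<open>w\<close> with \<open>z\<close>,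
  at most \<open>norm w * norm z\<close>, and the lower frame bound estimates \<open>norm z\<close>
  by \<open>l2norm c / sqrt A\<close>.\<close>

lemma frame_riesz_lower_bound:
  fixes \<phi> :: "int \<Rightarrow> 'a::complex_hilbert_space"
  assumes \<phi>: "frame_bounds \<phi> A B" and riesz: "riesz_basis \<phi>"
    and c: "(\<lambda>n. (cmod (c n))\<^sup>2) summable_on UNIV"
  shows "sqrt A * l2norm c \<le> norm (\<Sum>\<^sub>\<infinity>n. c n *\<^sub>C \<phi> n)"
proof -
  obtain A' B' where A': "A' > 0"
    and R: "\<And>c. (\<lambda>n. (cmod (c n))\<^sup>2) summable_on UNIV \<Longrightarrow> (\<lambda>n. c n *\<^sub>C \<phi> n) summable_on UNIV"
      "\<And>c. (\<lambda>n. (cmod (c n))\<^sup>2) summable_on UNIV \<Longrightarrow>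
        A' * (\<Sum>\<^sub>\<infinity>n. (cmod (c n))\<^sup>2) \<le> (norm (\<Sum>\<^sub>\<infinity>n. c n *\<^sub>C \<phi> n))\<^sup>2"
    using riesz unfolding riesz_basis_def riesz_basis_bounds_def by blast
  define w where "w = (\<Sum>\<^sub>\<infinity>n. c n *\<^sub>C \<phi> n)"
  obtain z where z: "((\<lambda>n. cinner z (\<phi> n) *\<^sub>C \<phi> n) has_sum w) UNIV"
    using frame_operator_surj [OF \<phi>] by blast
  \<comment> \<open>Both families synthesize to \<open>w\<close>, so \<open>u\<close> synthesizes to
    0; the lower Riesz bound \<open>A'\<close> then forces \<open>u\<close> to vanish.\<close>
  define u where "u n = c n - cinner z (\<phi> n)" for n
  note z_sum = bessel_l2norm(1) [OF frame_bounds_bessel(1) [OF \<phi>], of z]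
  have u_sum: "(\<lambda>n. (cmod (u n))\<^sup>2) summable_on UNIV"
  proof (rule l2norm_le(1))
    fix F :: "int set"
    assume F: "finite F"
    have "L2_set (\<lambda>n. cmod (c n + - cinner z (\<phi> n))) F \<le>
        L2_set (\<lambda>n. cmod (c n)) F + L2_set (\<lambda>n. cmod (- cinner z (\<phi> n))) F"
      by (rule L2_set_norm_add)
    also have "\<dots> \<le> l2norm c + l2norm (\<lambda>n. cinner z (\<phi> n))"
      using L2_set_le_l2norm [OF c F] L2_set_le_l2norm [OF z_sum F] by simp
    finally show "L2_set (\<lambda>n. cmod (u n)) F \<le> l2norm c + l2norm (\<lambda>n. cinner z (\<phi> n))"
      by (simp add: u_def)
  qed
  have "((\<lambda>n. c n *\<^sub>C \<phi> n) has_sum w) UNIV"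
    unfolding w_def by (rule has_sum_infsum [OF R(1) [OF c]])
  from has_sum_minus [OF this z] have "((\<lambda>n. u n *\<^sub>C \<phi> n) has_sum 0) UNIV"
    by (simp add: u_def scaleC.diff_left)
  then have "A' * (\<Sum>\<^sub>\<infinity>n. (cmod (u n))\<^sup>2) \<le> 0"
    using R(2) [OF u_sum] by (simp add: infsumI)
  then have u_zero: "(\<Sum>\<^sub>\<infinity>n. (cmod (u n))\<^sup>2) \<le> 0"
    using A' by (simp add: mult_le_0_iff)
  have "c n = cinner z (\<phi> n)" for n
  proof -
    have "(\<Sum>k\<in>{n}. (cmod (u k))\<^sup>2) \<le> (\<Sum>\<^sub>\<infinity>n. (cmod (u n))\<^sup>2)"
      by (rule finite_sum_le_infsum [OF u_sum]) auto
    from order_trans [OF this u_zero] show ?thesis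
      by (simp add: u_def)
  qed
  then have c_eq: "c = (\<lambda>n. cinner z (\<phi> n))"
    by blast
  have "(l2norm c)\<^sup>2 = Re (cinner w z)"
    using frame_operator(3) [OF \<phi>, of z] infsumI [OF z] by (simp add: c_eq)
  also have "\<dots> \<le> norm w * norm z"
    using complex_Re_le_cmod [of "cinner w z"] cinner_cauchy_schwarz [of w z] by linarith
  finally have "sqrt A * (l2norm c)\<^sup>2 \<le> sqrt A * (norm w * norm z)"
    using \<phi> by (intro mult_left_mono) (auto simp: frame_bounds_def)
  also have "\<dots> = norm w * (sqrt A * norm z)"
    by (simp add: mult_ac)
  also have "\<dots> \<le> norm w * l2norm c"
    using frame_bounds_bessel(2) [OF \<phi>, of z] by (intro mult_left_mono) (auto simp: c_eq)
  finally have "(sqrt A * l2norm c) * l2norm c \<le> norm w * l2norm c"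
    by (simp add: power2_eq_square mult_ac)
  then show ?thesis
    using l2norm_nonneg [of c] unfolding w_def by (cases "l2norm c = 0") auto
qed

text \<open>Density comes from the perturbed frame. The lower bound subtracts the synthesis of the
  differences, of norm at most \<open>e * l2norm c\<close>, from that of \<phi>, which
  \<open>frame_riesz_lower_bound\<close> estimates with \<open>sqrt A\<close>.\<close>

lemma riesz_basis_perturbed:
  fixes \<phi> \<psi> :: "int \<Rightarrow> 'a::complex_hilbert_space"
  assumes \<phi>: "frame_bounds \<phi> A B" and riesz: "riesz_basis \<phi>"
    and d: "bessel (\<lambda>n. \<psi> n - \<phi> n) e" and e: "0 \<le> e" "e < sqrt A"
  shows "riesz_basis \<psi>"
  unfolding riesz_basis_def riesz_basis_bounds_def
proof (intro exI conjI allI impI)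
  note frame = frame_bounds_perturbed [OF \<phi> d e]
  have B: "0 \<le> sqrt B" "0 \<le> sqrt B + e"
    using \<phi> e by (auto simp: frame_bounds_def)
  show "0 < (sqrt A - e)\<^sup>2" "(sqrt A - e)\<^sup>2 \<le> (sqrt B + e)\<^sup>2"
    using frame by (auto simp: frame_bounds_def)
  show "closure (complex_vector.span (range \<psi>)) = UNIV"
    by (rule frame_span_dense [OF frame])
  fix c :: "int \<Rightarrow> complex"
  assume c: "(\<lambda>n. (cmod (c n))\<^sup>2) summable_on UNIV"
  note bes = frame_bounds_bessel(1) [OF \<phi>]
  note syn = bessel_synthesis [OF bessel_perturbed [OF bes d] B(2) c]
  show "(\<lambda>n. c n *\<^sub>C \<psi> n) summable_on UNIV"
    by (rule syn(1))
  show "(norm (\<Sum>\<^sub>\<infinity>n. c n *\<^sub>C \<psi> n))\<^sup>2 \<le> (sqrt B + e)\<^sup>2 * (\<Sum>\<^sub>\<infinity>n. (cmod (c n))\<^sup>2)"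
    using power_mono [OF syn(2) norm_ge_zero, of 2] by (simp add: power_mult_distrib l2norm_sq)
  have "((\<lambda>n. c n *\<^sub>C \<phi> n + c n *\<^sub>C (\<psi> n - \<phi> n)) has_sum
      (\<Sum>\<^sub>\<infinity>n. c n *\<^sub>C \<phi> n) + (\<Sum>\<^sub>\<infinity>n. c n *\<^sub>C (\<psi> n - \<phi> n))) UNIV"
    by (intro has_sum_add has_sum_infsum bessel_synthesis(1) [OF bes B(1) c] bessel_synthesis(1) [OF d e(1) c])
  then have "(\<Sum>\<^sub>\<infinity>n. c n *\<^sub>C \<psi> n) = (\<Sum>\<^sub>\<infinity>n. c n *\<^sub>C \<phi> n) + (\<Sum>\<^sub>\<infinity>n. c n *\<^sub>C (\<psi> n - \<phi> n))"
    by (intro infsumI) (simp flip: scaleC.add_right)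
  then have "norm (\<Sum>\<^sub>\<infinity>n. c n *\<^sub>C \<phi> n) - norm (\<Sum>\<^sub>\<infinity>n. c n *\<^sub>C (\<psi> n - \<phi> n)) \<le> norm (\<Sum>\<^sub>\<infinity>n. c n *\<^sub>C \<psi> n)"
    using norm_diff_ineq by metis
  then have "(sqrt A - e) * l2norm c \<le> norm (\<Sum>\<^sub>\<infinity>n. c n *\<^sub>C \<psi> n)"
    using frame_riesz_lower_bound [OF \<phi> riesz c] bessel_synthesis(2) [OF d e(1) c]
    by (simp add: left_diff_distrib)
  then have "((sqrt A - e) * l2norm c)\<^sup>2 \<le> (norm (\<Sum>\<^sub>\<infinity>n. c n *\<^sub>C \<psi> n))\<^sup>2"
    using e by (intro power_mono mult_nonneg_nonneg l2norm_nonneg) auto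
  then show "(sqrt A - e)\<^sup>2 * (\<Sum>\<^sub>\<infinity>n. (cmod (c n))\<^sup>2) \<le> (norm (\<Sum>\<^sub>\<infinity>n. c n *\<^sub>C \<psi> n))\<^sup>2"
    by (simp add: power_mult_distrib l2norm_sq)
qed

theorem theorem1p1:
  fixes T :: "real \<Rightarrow> 'a::complex_hilbert_space \<Rightarrow> 'a"
    and x :: 'a
    and \<Gamma> \<Gamma>' :: "int \<Rightarrow> real"
    and \<gamma> \<delta> A B :: real
  assumes "operator_representation T" and "isometric T" and "strongly_continuous T"
    and "\<gamma> > 0" and "beurling_spectrum T \<subseteq> {-\<gamma>..\<gamma>}"
    and "frame_bounds (\<lambda>n. T (\<Gamma> n) x) A B"
    and "bdd_above (range (\<lambda>n. \<bar>\<Gamma>' n - \<Gamma> n\<bar>))"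
    and "\<delta> = (SUP n. \<bar>\<Gamma>' n - \<Gamma> n\<bar>)"
    and "\<delta> < pi / (4 * \<gamma>) - 1 / \<gamma> * arcsin (1 / sqrt 2 * (1 - sqrt (A / B)))"
  shows "frame_bounds (\<lambda>n. T (\<Gamma>' n) x)
           (A * (1 - sqrt (B / A) * (1 - cos (\<delta> * \<gamma>) + sin (\<delta> * \<gamma>)))\<^sup>2)
           (B * (2 - cos (\<delta> * \<gamma>) + sin (\<delta> * \<gamma>))\<^sup>2)
         \<and> (riesz_basis (\<lambda>n. T (\<Gamma> n) x) \<longrightarrow> riesz_basis (\<lambda>n. T (\<Gamma>' n) x))"
proof -
  interpret isometric_rep T
    by unfold_locales fact+
  define \<tau> where "\<tau> = \<delta> * \<gamma>"
  define h where "h = 1 / sqrt 2 * (1 - sqrt (A / B))"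
  define e where "e = sqrt B * (1 - cos \<tau> + sin \<tau>)"
  have AB: "0 < A" "0 < B" "A \<le> B"
    using assms(6) by (auto simp: frame_bounds_def)
  have d_le: "\<bar>\<Gamma>' n - \<Gamma> n\<bar> \<le> \<delta>" for n
    unfolding assms(8) by (intro cSUP_upper assms(7)) auto
  then have \<tau>0: "0 \<le> \<tau>"
    unfolding \<tau>_def using assms(4) order_trans [OF abs_ge_zero d_le] by (intro mult_nonneg_nonneg) auto
  have "0 \<le> sqrt (A / B)" "sqrt (A / B) \<le> 1"
    using AB by auto
  then have h: "0 \<le> h" "h \<le> 1"
  proof -
    show "0 \<le> h"
      using \<open>sqrt (A / B) \<le> 1\<close> by (simp add: h_def)
    have "1 / sqrt 2 * (1 - sqrt (A / B)) \<le> 1 * 1"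
      using \<open>0 \<le> sqrt (A / B)\<close> \<open>sqrt (A / B) \<le> 1\<close> by (intro mult_mono) auto
    then show "h \<le> 1"
      by (simp add: h_def)
  qed
  have "\<tau> < (pi / (4 * \<gamma>) - 1 / \<gamma> * arcsin h) * \<gamma>"
    unfolding \<tau>_def h_def using assms(4,9) by (rule mult_strict_right_mono [rotated])
  then have less: "arcsin h < pi / 4 - \<tau>"
    using assms(4) by (simp add: left_diff_distrib)
  have "0 \<le> arcsin h"
    using arcsin_le_arcsin [of 0 h] h by simp
  then have \<tau>_le: "\<tau> \<le> pi / 4"
    using less by linarith
  \<comment> \<open>Both angles lie where sine increases. The addition formula at pi / 4 turns the
    inequality into \<open>1 - sqrt (A / B) < cos \<tau> - sin \<tau>\<close>, which explains the
    shape of the bound on \<delta>.\<close>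
  have "sin (arcsin h) < sin (pi / 4 - \<tau>)"
    using less \<tau>0 \<open>0 \<le> arcsin h\<close> by (intro sin_monotone_2pi) auto
  also have "sin (pi / 4 - \<tau>) = 1 / sqrt 2 * (cos \<tau> - sin \<tau>)"
  proof -
    have "sqrt 2 / 2 = 1 / sqrt 2"
      by (simp add: field_simps)
    then show ?thesis
      by (simp only: sin_diff sin_45 cos_45 right_diff_distrib)
  qed
  finally have "1 / sqrt 2 * (1 - sqrt (A / B)) < 1 / sqrt 2 * (cos \<tau> - sin \<tau>)"
    using h by (simp add: h_def)
  then have \<lambda>: "1 - cos \<tau> + sin \<tau> < sqrt (A / B)"
    by (subst (asm) mult_less_cancel_left_pos) auto
  have e: "0 \<le> e" "e < sqrt A"
  proof -
    have "0 \<le> sin \<tau>"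
      using \<tau>0 \<tau>_le pi_gt_zero by (intro sin_ge_zero) linarith+
    then show "0 \<le> e"
      using AB cos_le_one [of \<tau>] by (simp add: e_def)
    have "e < sqrt B * sqrt (A / B)"
      unfolding e_def using \<lambda> AB by (intro mult_strict_left_mono) auto
    also have "\<dots> = sqrt A"
      using AB by (simp add: real_sqrt_divide)
    finally show "e < sqrt A" .
  qed
  \<comment> \<open>By the group law each new orbit vector is a small translate of the old frame
    vector, so the perturbation acts on the frame itself.\<close>
  have "bessel (\<lambda>n. T (\<Gamma>' n - \<Gamma> n) (T (\<Gamma> n) x) - T (\<Gamma> n) x) e"
    unfolding e_def
  proof (rule bessel_orbit_perturbation [OF assms(4,5) frame_bounds_bessel(1) [OF assms(6)] _ _ \<tau>0 \<tau>_le])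
    show "0 \<le> sqrt B"
      using AB by simp
    show "\<bar>\<Gamma>' n - \<Gamma> n\<bar> * \<gamma> \<le> \<tau>" for n
      unfolding \<tau>_def using d_le assms(4) by (intro mult_right_mono) auto
  qed
  then have bes: "bessel (\<lambda>n. T (\<Gamma>' n) x - T (\<Gamma> n) x) e"
    by simp
  have "sqrt A * sqrt (B / A) = sqrt B"
    using AB by (simp add: real_sqrt_divide)
  then have "sqrt A - e = sqrt A * (1 - sqrt (B / A) * (1 - cos \<tau> + sin \<tau>))"
    by (simp add: e_def right_diff_distrib mult.assoc [symmetric])
  then have lower: "(sqrt A - e)\<^sup>2 = A * (1 - sqrt (B / A) * (1 - cos \<tau> + sin \<tau>))\<^sup>2"
    using AB by (simp add: power_mult_distrib)
  have "sqrt B + e = sqrt B * (2 - cos \<tau> + sin \<tau>)"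
    by (simp add: e_def algebra_simps)
  then have upper: "(sqrt B + e)\<^sup>2 = B * (2 - cos \<tau> + sin \<tau>)\<^sup>2"
    using AB by (simp add: power_mult_distrib)
  show ?thesis
    using frame_bounds_perturbed [OF assms(6) bes e] riesz_basis_perturbed [OF assms(6) _ bes e]
    unfolding lower upper \<tau>_def by blast
qed

end
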